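(* Let $D$ be a skew field and let $k$ be a central subfield of $D$. If $D$ contains a free field $k(\langle x,y\rangle)$ on two generators $x,y$, then $D\otimes_k D^{\mathrm{op}}$ cannot be a left noetherian ring.
   Context: Skew field means division ring. $D^{\mathrm{op}}$ is the opposite algebra of $D$. Free fields. For a ring $R$, an $R$-field is a skew field $K$ with a ring homomorphism $R\to K$; it is epic if $K$ is generated as a skew field by the image of $R$. A local homomorphism between $R$-fields $K,L$ is an $R$-ring homomorphism $\alpha\colon K_0\to L$ from a subring $K_0\subseteq K$ containing the image of $R$ such that every element of $K_0\setminus\ker\alpha$ is a unit of $K_0$. Two local homomorphisms are equivalent if they agree on some subring, contained in both domains and containing the image of $R$, on which their common restriction is still a local homomorphism. A specialization is an equivalence class of local homomorphisms. A universal $R$-field is an epic $R$-field $U$ such that for every epic $R$-field $K$ there is a unique specialization from $U$ to $K$; if moreover $R\to U$ is injective, $U$ is called the universal field of fractions of $R$ (it is unique up to isomorphism). For a commutative field $k$ and a set $X$, $k(\langle X\rangle)$ denotes the universal field of fractions of the free associative algebra $k\langle X\rangle$ (it exists). A skew field $D$ containing $k$ contains a free field $k(\langle X\rangle)$ if there is a ring homomorphism $k(\langle X\rangle)\to D$ which is the identity on $k$. *)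

theory Defs
  imports "HOL-Algebra.QuotRing" "HOL-Algebra.Generated_Fields"
begin

section \<open>Skew fields, opposite rings, left noetherian rings\<close>

locale skew_field = ring +
  assumes one_not_zero: "\<one> \<noteq> \<zero>"
    and skew_field_Units: "Units R = carrier R - {\<zero>}"

text \<open>The library's \<^locale>\<open>subfield\<close> does not assume the ambient ring commutative, only the
  subring itself.\<close>

definition central_subfield :: "'a set \<Rightarrow> ('a, 'm) ring_scheme \<Rightarrow> bool" where
  "central_subfield k D \<longleftrightarrow>
     subfield k D \<and> (\<forall>c\<in>k. \<forall>d\<in>carrier D. c \<otimes>\<^bsub>D\<^esub> d = d \<otimes>\<^bsub>D\<^esub> c)"

definition opposite :: "('a, 'm) ring_scheme \<Rightarrow> ('a, 'm) ring_scheme" where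
  "opposite R = R\<lparr>mult := \<lambda>a b. b \<otimes>\<^bsub>R\<^esub> a\<rparr>"

lemma opposite_simps [simp]:
  "carrier (opposite R) = carrier R" "\<one>\<^bsub>opposite R\<^esub> = \<one>\<^bsub>R\<^esub>" "\<zero>\<^bsub>opposite R\<^esub> = \<zero>\<^bsub>R\<^esub>"
  "a \<oplus>\<^bsub>opposite R\<^esub> b = a \<oplus>\<^bsub>R\<^esub> b" "a \<otimes>\<^bsub>opposite R\<^esub> b = b \<otimes>\<^bsub>R\<^esub> a"
  by (simp_all add: opposite_def)

lemma opposite_ring:
  assumes "ring R" shows "ring (opposite R)"
proof -
  interpret ring R by fact
  show ?thesis
  proof (rule ringI)
    show "abelian_group (opposite R)"
      by (rule abelian_groupI) (auto simp: a_ac intro: l_neg a_inv_closed)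
    show "monoid (opposite R)"
      by (rule monoidI) (auto simp: m_assoc)
  qed (auto simp: l_distr r_distr)
qed

locale left_ideal = additive_subgroup I R + ring R for I and R (structure) +
  assumes I_l_closed: "\<lbrakk>a \<in> I; x \<in> carrier R\<rbrakk> \<Longrightarrow> x \<otimes> a \<in> I"

definition left_ideal_generated :: "('a, 'm) ring_scheme \<Rightarrow> 'a set \<Rightarrow> 'a set" where
  "left_ideal_generated R S = \<Inter>{I. left_ideal I R \<and> S \<subseteq> I}"

text \<open>That \<open>R\<close> is a ring is not part of this predicate, so that its negation says that some left ideal
  fails to be finitely generated; \<open>tensor_algebra_ring\<close> below shows that tensor products are rings.\<close>

definition left_noetherian :: "('a, 'm) ring_scheme \<Rightarrow> bool" where
  "left_noetherian R \<longleftrightarrow>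
     (\<forall>I. left_ideal I R \<longrightarrow>
        (\<exists>A \<subseteq> carrier R. finite A \<and> I = left_ideal_generated R A))"

section \<open>Monoid rings and the free associative algebra\<close>

definition monoid_ring :: "('c, 'f) ring_scheme \<Rightarrow> ('w, 'm) monoid_scheme \<Rightarrow> ('w \<Rightarrow> 'c) ring" where
  "monoid_ring F M =
     \<lparr>carrier = {f. f \<in> carrier M \<rightarrow> carrier F \<and> (\<forall>m. m \<notin> carrier M \<longrightarrow> f m = \<zero>\<^bsub>F\<^esub>)
                    \<and> finite {m. f m \<noteq> \<zero>\<^bsub>F\<^esub>}},
      mult = (\<lambda>f g m. finsum F (\<lambda>(u, v). f u \<otimes>\<^bsub>F\<^esub> g v)
                {(u, v). f u \<noteq> \<zero>\<^bsub>F\<^esub> \<and> g v \<noteq> \<zero>\<^bsub>F\<^esub> \<and> u \<otimes>\<^bsub>M\<^esub> v = m}),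
      one = (\<lambda>m. if m = \<one>\<^bsub>M\<^esub> then \<one>\<^bsub>F\<^esub> else \<zero>\<^bsub>F\<^esub>),
      zero = (\<lambda>m. \<zero>\<^bsub>F\<^esub>),
      add = (\<lambda>f g m. f m \<oplus>\<^bsub>F\<^esub> g m)\<rparr>"

text \<open>The element \<open>c \<cdot> m\<close> of the monoid ring.\<close>

definition monomial :: "('c, 'f) ring_scheme \<Rightarrow> 'c \<Rightarrow> 'w \<Rightarrow> 'w \<Rightarrow> 'c" where
  "monomial F c m = (\<lambda>n. if n = m then c else \<zero>\<^bsub>F\<^esub>)"

definition word_monoid :: "'x set \<Rightarrow> 'x list monoid" where
  "word_monoid X = \<lparr>carrier = lists X, mult = (@), one = []\<rparr>"

definition free_algebra :: "('c, 'f) ring_scheme \<Rightarrow> 'x set \<Rightarrow> ('x list \<Rightarrow> 'c) ring" where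
  "free_algebra F X = monoid_ring F (word_monoid X)"

definition free_algebra_const :: "('c, 'f) ring_scheme \<Rightarrow> 'c \<Rightarrow> 'x list \<Rightarrow> 'c" where
  "free_algebra_const F c = monomial F c []"

section \<open>Tensor products of algebras\<close>

text \<open>For algebras \<open>A\<close>, \<open>B\<close> over a commutative ring \<open>F\<close> with structure maps \<open>p\<close>, \<open>q\<close> into the
  centres of \<open>A\<close>, \<open>B\<close>, the tensor product is the free \<open>F\<close>-module on \<open>A \<times> B\<close> modulo the bilinearity
  relations, with \<open>(a \<otimes> b) (a' \<otimes> b') = a a' \<otimes> b b'\<close>. This multiplication already lives on the free
  module, which thereby is the monoid ring of the multiplicative monoid \<open>A \<times> B\<close>; the submodule
  spanned by the relations is an ideal there, so it equals the ideal generated by them.\<close>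

definition bilinear_relations ::
    "('c, 'f) ring_scheme \<Rightarrow> ('c \<Rightarrow> 'a) \<Rightarrow> ('a, 'm) ring_scheme \<Rightarrow> ('c \<Rightarrow> 'b) \<Rightarrow> ('b, 'n) ring_scheme
      \<Rightarrow> ('a \<times> 'b \<Rightarrow> 'c) set" where
  "bilinear_relations F p A q B =
     (let P = monoid_ring F (A \<times>\<times> B); gen = (\<lambda>a b. monomial F \<one>\<^bsub>F\<^esub> (a, b)) in
        {gen (a \<oplus>\<^bsub>A\<^esub> a') b \<ominus>\<^bsub>P\<^esub> (gen a b \<oplus>\<^bsub>P\<^esub> gen a' b) | a a' b.
           a \<in> carrier A \<and> a' \<in> carrier A \<and> b \<in> carrier B}
      \<union> {gen a (b \<oplus>\<^bsub>B\<^esub> b') \<ominus>\<^bsub>P\<^esub> (gen a b \<oplus>\<^bsub>P\<^esub> gen a b') | a b b'.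
           a \<in> carrier A \<and> b \<in> carrier B \<and> b' \<in> carrier B}
      \<union> {gen (p c \<otimes>\<^bsub>A\<^esub> a) b \<ominus>\<^bsub>P\<^esub> monomial F c (a, b) | c a b.
           c \<in> carrier F \<and> a \<in> carrier A \<and> b \<in> carrier B}
      \<union> {gen a (q c \<otimes>\<^bsub>B\<^esub> b) \<ominus>\<^bsub>P\<^esub> monomial F c (a, b) | c a b.
           c \<in> carrier F \<and> a \<in> carrier A \<and> b \<in> carrier B})"

definition tensor_algebra ::
    "('c, 'f) ring_scheme \<Rightarrow> ('c \<Rightarrow> 'a) \<Rightarrow> ('a, 'm) ring_scheme \<Rightarrow> ('c \<Rightarrow> 'b) \<Rightarrow> ('b, 'n) ring_scheme
      \<Rightarrow> ('a \<times> 'b \<Rightarrow> 'c) set ring" where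
  "tensor_algebra F p A q B =
     monoid_ring F (A \<times>\<times> B) Quot (Idl\<^bsub>monoid_ring F (A \<times>\<times> B)\<^esub> (bilinear_relations F p A q B))"

section \<open>Fields over a ring, specializations, universal fields of fractions\<close>

definition field_over :: "('r, 'c) ring_scheme \<Rightarrow> ('k, 'd) ring_scheme \<Rightarrow> ('r \<Rightarrow> 'k) \<Rightarrow> bool" where
  "field_over R K i \<longleftrightarrow> skew_field K \<and> i \<in> ring_hom R K"

text \<open>Despite its name, \<^const>\<open>generate_field\<close> merely closes a set under the ring operations and
  inverses of nonzero elements, so in a skew field it yields the generated sub-skew-field.\<close>

definition epic_field_over :: "('r, 'c) ring_scheme \<Rightarrow> ('k, 'd) ring_scheme \<Rightarrow> ('r \<Rightarrow> 'k) \<Rightarrow> bool" where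
  "epic_field_over R K i \<longleftrightarrow> field_over R K i \<and> generate_field K (i ` carrier R) = carrier K"

text \<open>A local homomorphism is a pair of its domain \<open>K\<^sub>0\<close> and a function; the values of the function
  outside \<open>K\<^sub>0\<close> are irrelevant and are identified by the equivalence below.\<close>

definition local_homs ::
    "('r, 'c) ring_scheme \<Rightarrow> ('k, 'd) ring_scheme \<Rightarrow> ('r \<Rightarrow> 'k) \<Rightarrow> ('l, 'e) ring_scheme \<Rightarrow> ('r \<Rightarrow> 'l)
      \<Rightarrow> ('k set \<times> ('k \<Rightarrow> 'l)) set" where
  "local_homs R K i L j =
     {(K\<^sub>0, \<alpha>). subring K\<^sub>0 K \<and> i ` carrier R \<subseteq> K\<^sub>0
        \<and> \<alpha> \<in> ring_hom (K\<lparr>carrier := K\<^sub>0\<rparr>) L \<and> (\<forall>r\<in>carrier R. \<alpha> (i r) = j r)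
        \<and> (\<forall>a\<in>K\<^sub>0. \<alpha> a \<noteq> \<zero>\<^bsub>L\<^esub> \<longrightarrow> a \<in> Units (K\<lparr>carrier := K\<^sub>0\<rparr>))}"

definition local_hom_rel ::
    "('r, 'c) ring_scheme \<Rightarrow> ('k, 'd) ring_scheme \<Rightarrow> ('r \<Rightarrow> 'k) \<Rightarrow> ('l, 'e) ring_scheme \<Rightarrow> ('r \<Rightarrow> 'l)
      \<Rightarrow> (('k set \<times> ('k \<Rightarrow> 'l)) \<times> ('k set \<times> ('k \<Rightarrow> 'l))) set" where
  "local_hom_rel R K i L j =
     {((K\<^sub>0, \<alpha>), (K\<^sub>1, \<beta>)). (K\<^sub>0, \<alpha>) \<in> local_homs R K i L j \<and> (K\<^sub>1, \<beta>) \<in> local_homs R K i L j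
        \<and> (\<exists>S. S \<subseteq> K\<^sub>0 \<inter> K\<^sub>1 \<and> (\<forall>a\<in>S. \<alpha> a = \<beta> a) \<and> (S, \<alpha>) \<in> local_homs R K i L j)}"

definition specializations ::
    "('r, 'c) ring_scheme \<Rightarrow> ('k, 'd) ring_scheme \<Rightarrow> ('r \<Rightarrow> 'k) \<Rightarrow> ('l, 'e) ring_scheme \<Rightarrow> ('r \<Rightarrow> 'l)
      \<Rightarrow> ('k set \<times> ('k \<Rightarrow> 'l)) set set" where
  "specializations R K i L j = local_homs R K i L j // local_hom_rel R K i L j"

text \<open>HOL cannot quantify over all types, so \<open>K\<close> ranges over the epic \<open>R\<close>-fields whose carrier lies
  in the type of the elements of \<open>R\<close>. Up to isomorphism these are all of them: an epic \<open>R\<close>-field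
  has at most as many elements as \<open>R\<close> if \<open>R\<close> is infinite, and it is the image of \<open>R\<close> if \<open>R\<close> is
  finite.\<close>

definition universal_field_over :: "('r, 'c) ring_scheme \<Rightarrow> ('u, 'd) ring_scheme \<Rightarrow> ('r \<Rightarrow> 'u) \<Rightarrow> bool" where
  "universal_field_over R U i \<longleftrightarrow>
     epic_field_over R U i \<and>
     (\<forall>(K :: 'r ring) j. epic_field_over R K j \<longrightarrow> (\<exists>!s. s \<in> specializations R U i K j))"

definition universal_field_of_fractions ::
    "('r, 'c) ring_scheme \<Rightarrow> ('u, 'd) ring_scheme \<Rightarrow> ('r \<Rightarrow> 'u) \<Rightarrow> bool" where
  "universal_field_of_fractions R U i \<longleftrightarrow> universal_field_over R U i \<and> inj_on i (carrier R)"

section \<open>Well-definedness of the constructions\<close>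

lemma (in abelian_monoid) finsum_swap:
  assumes "finite A" "finite B" "\<And>a b. a \<in> A \<Longrightarrow> b \<in> B \<Longrightarrow> f a b \<in> carrier G"
  shows "(\<Oplus>a\<in>A. \<Oplus>b\<in>B. f a b) = (\<Oplus>b\<in>B. \<Oplus>a\<in>A. f a b)"
  using assms(1,3)
proof (induction A rule: finite_induct)
  case empty
  then show ?case by simp
next
  case (insert a A)
  have "(\<Oplus>a\<in>insert a A. \<Oplus>b\<in>B. f a b) = (\<Oplus>b\<in>B. f a b) \<oplus> (\<Oplus>a\<in>A. \<Oplus>b\<in>B. f a b)"
    using insert.hyps insert.prems by (intro finsum_insert) auto
  also have "\<dots> = (\<Oplus>b\<in>B. f a b) \<oplus> (\<Oplus>b\<in>B. \<Oplus>a\<in>A. f a b)"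
    using insert by simp
  also have "\<dots> = (\<Oplus>b\<in>B. f a b \<oplus> (\<Oplus>a\<in>A. f a b))"
    using insert.prems by (intro finsum_addf [symmetric]) auto
  also have "\<dots> = (\<Oplus>b\<in>B. \<Oplus>a\<in>insert a A. f a b)"
    using insert.hyps insert.prems by (intro finsum_cong' refl) (auto intro!: finsum_insert [symmetric])
  finally show ?case .
qed

lemma (in abelian_monoid) finsum_swap3:
  assumes "finite S" "finite A" "finite B"
    and f: "\<And>p a b. p \<in> S \<Longrightarrow> a \<in> A \<Longrightarrow> b \<in> B \<Longrightarrow> f p a b \<in> carrier G"
  shows "(\<Oplus>p\<in>S. \<Oplus>a\<in>A. \<Oplus>b\<in>B. f p a b) = (\<Oplus>a\<in>A. \<Oplus>b\<in>B. \<Oplus>p\<in>S. f p a b)"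
proof -
  have "(\<Oplus>p\<in>S. \<Oplus>a\<in>A. \<Oplus>b\<in>B. f p a b) = (\<Oplus>a\<in>A. \<Oplus>p\<in>S. \<Oplus>b\<in>B. f p a b)"
    using assms by (intro finsum_swap) (auto intro!: finsum_closed)
  also have "\<dots> = (\<Oplus>a\<in>A. \<Oplus>b\<in>B. \<Oplus>p\<in>S. f p a b)"
  proof (rule finsum_cong' [OF refl])
    show "(\<Oplus>p\<in>S. \<Oplus>b\<in>B. f p a b) = (\<Oplus>b\<in>B. \<Oplus>p\<in>S. f p a b)" if "a \<in> A" for a
      using assms that by (intro finsum_swap) auto
  qed (use f in \<open>auto intro!: finsum_closed\<close>)
  finally show ?thesis .
qed

lemma (in abelian_monoid) finsum_swap4:
  assumes "finite S" "finite A" "finite B" "finite C"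
    and f: "\<And>p a b c. p \<in> S \<Longrightarrow> c \<in> C \<Longrightarrow> a \<in> A \<Longrightarrow> b \<in> B \<Longrightarrow> f p c a b \<in> carrier G"
  shows "(\<Oplus>p\<in>S. \<Oplus>c\<in>C. \<Oplus>a\<in>A. \<Oplus>b\<in>B. f p c a b) = (\<Oplus>c\<in>C. \<Oplus>a\<in>A. \<Oplus>b\<in>B. \<Oplus>p\<in>S. f p c a b)"
proof -
  have "(\<Oplus>p\<in>S. \<Oplus>c\<in>C. \<Oplus>a\<in>A. \<Oplus>b\<in>B. f p c a b) = (\<Oplus>c\<in>C. \<Oplus>p\<in>S. \<Oplus>a\<in>A. \<Oplus>b\<in>B. f p c a b)"
    using assms by (intro finsum_swap) (auto intro!: finsum_closed)
  also have "\<dots> = (\<Oplus>c\<in>C. \<Oplus>a\<in>A. \<Oplus>b\<in>B. \<Oplus>p\<in>S. f p c a b)"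
  proof (rule finsum_cong' [OF refl])
    show "(\<Oplus>p\<in>S. \<Oplus>a\<in>A. \<Oplus>b\<in>B. f p c a b) = (\<Oplus>a\<in>A. \<Oplus>b\<in>B. \<Oplus>p\<in>S. f p c a b)" if "c \<in> C" for c
      using assms that by (intro finsum_swap3) auto
  qed (use f in \<open>auto intro!: finsum_closed\<close>)
  finally show ?thesis .
qed

lemma (in abelian_monoid) finsum_Times:
  assumes "finite A" "finite B" "\<And>a b. a \<in> A \<Longrightarrow> b \<in> B \<Longrightarrow> f a b \<in> carrier G"
  shows "finsum G (\<lambda>(a, b). f a b) (A \<times> B) = (\<Oplus>a\<in>A. \<Oplus>b\<in>B. f a b)"
  using assms(1,3)
proof (induction A rule: finite_induct)
  case empty
  then show ?case by simp
next
  case (insert a A)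
  have "insert a A \<times> B = (Pair a ` B) \<union> (A \<times> B)" by auto
  then have "finsum G (\<lambda>(a, b). f a b) (insert a A \<times> B)
      = finsum G (\<lambda>(a, b). f a b) (Pair a ` B) \<oplus> finsum G (\<lambda>(a, b). f a b) (A \<times> B)"
    using insert.hyps insert.prems assms(2)
    by (simp only:) (intro finsum_Un_disjoint; auto)
  also have "finsum G (\<lambda>(a, b). f a b) (Pair a ` B) = (\<Oplus>b\<in>B. f a b)"
    using insert.prems by (subst finsum_reindex) (auto simp: inj_on_def)
  also have "finsum G (\<lambda>(a, b). f a b) (A \<times> B) = (\<Oplus>a\<in>A. \<Oplus>b\<in>B. f a b)"
    using insert by simp
  also have "(\<Oplus>b\<in>B. f a b) \<oplus> (\<Oplus>a\<in>A. \<Oplus>b\<in>B. f a b) = (\<Oplus>a\<in>insert a A. \<Oplus>b\<in>B. f a b)"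
    using insert.hyps insert.prems by (intro finsum_insert [symmetric]) auto
  finally show ?case .
qed

lemma (in abelian_monoid) finsum_cong2:
  assumes "\<And>a b. a \<in> A \<Longrightarrow> b \<in> B \<Longrightarrow> f a b = g a b"
    and g: "\<And>a b. a \<in> A \<Longrightarrow> b \<in> B \<Longrightarrow> g a b \<in> carrier G"
  shows "(\<Oplus>a\<in>A. \<Oplus>b\<in>B. f a b) = (\<Oplus>a\<in>A. \<Oplus>b\<in>B. g a b)"
proof (rule finsum_cong' [OF refl])
  show "(\<Oplus>b\<in>B. f a b) = (\<Oplus>b\<in>B. g a b)" if "a \<in> A" for a
    by (rule finsum_cong' [OF refl]) (use assms that in auto)
qed (use g in \<open>auto intro!: finsum_closed\<close>)

lemma (in abelian_monoid) finsum_cong3: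
  assumes "\<And>a b c. a \<in> A \<Longrightarrow> b \<in> B \<Longrightarrow> c \<in> C \<Longrightarrow> f a b c = g a b c"
    and g: "\<And>a b c. a \<in> A \<Longrightarrow> b \<in> B \<Longrightarrow> c \<in> C \<Longrightarrow> g a b c \<in> carrier G"
  shows "(\<Oplus>a\<in>A. \<Oplus>b\<in>B. \<Oplus>c\<in>C. f a b c) = (\<Oplus>a\<in>A. \<Oplus>b\<in>B. \<Oplus>c\<in>C. g a b c)"
proof (rule finsum_cong' [OF refl])
  show "(\<Oplus>b\<in>B. \<Oplus>c\<in>C. f a b c) = (\<Oplus>b\<in>B. \<Oplus>c\<in>C. g a b c)" if "a \<in> A" for a
    by (rule finsum_cong2) (use assms that in auto)
qed (use g in \<open>auto intro!: finsum_closed\<close>)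

lemma (in ring) finsum_distr2:
  assumes "finite A" "finite B" and c: "c \<in> carrier R"
    and f: "\<And>a b. a \<in> A \<Longrightarrow> b \<in> B \<Longrightarrow> f a b \<in> carrier R"
  shows "(\<Oplus>a\<in>A. \<Oplus>b\<in>B. f a b) \<otimes> c = (\<Oplus>a\<in>A. \<Oplus>b\<in>B. f a b \<otimes> c)"
    and "c \<otimes> (\<Oplus>a\<in>A. \<Oplus>b\<in>B. f a b) = (\<Oplus>a\<in>A. \<Oplus>b\<in>B. c \<otimes> f a b)"
proof -
  have "(\<Oplus>a\<in>A. \<Oplus>b\<in>B. f a b) \<otimes> c = (\<Oplus>a\<in>A. (\<Oplus>b\<in>B. f a b) \<otimes> c)"
    using assms by (intro finsum_ldistr) (auto intro!: finsum_closed)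
  also have "\<dots> = (\<Oplus>a\<in>A. \<Oplus>b\<in>B. f a b \<otimes> c)"
  proof (rule finsum_cong' [OF refl])
    show "(\<Oplus>b\<in>B. f a b) \<otimes> c = (\<Oplus>b\<in>B. f a b \<otimes> c)" if "a \<in> A" for a
      using assms that by (intro finsum_ldistr) auto
  qed (use f c in \<open>auto intro!: finsum_closed\<close>)
  finally show "(\<Oplus>a\<in>A. \<Oplus>b\<in>B. f a b) \<otimes> c = (\<Oplus>a\<in>A. \<Oplus>b\<in>B. f a b \<otimes> c)" .
  have "c \<otimes> (\<Oplus>a\<in>A. \<Oplus>b\<in>B. f a b) = (\<Oplus>a\<in>A. c \<otimes> (\<Oplus>b\<in>B. f a b))"
    using assms by (intro finsum_rdistr) (auto intro!: finsum_closed)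
  also have "\<dots> = (\<Oplus>a\<in>A. \<Oplus>b\<in>B. c \<otimes> f a b)"
  proof (rule finsum_cong' [OF refl])
    show "c \<otimes> (\<Oplus>b\<in>B. f a b) = (\<Oplus>b\<in>B. c \<otimes> f a b)" if "a \<in> A" for a
      using assms that by (intro finsum_rdistr) auto
  qed (use f c in \<open>auto intro!: finsum_closed\<close>)
  finally show "c \<otimes> (\<Oplus>a\<in>A. \<Oplus>b\<in>B. f a b) = (\<Oplus>a\<in>A. \<Oplus>b\<in>B. c \<otimes> f a b)" .
qed

locale monoid_ring_context = F: ring F + M: monoid M for F (structure) and M (structure)
begin

abbreviation P where "P \<equiv> monoid_ring F M"

lemma mr_closed: "f \<in> carrier P \<Longrightarrow> f m \<in> carrier F"
  by (cases "m \<in> carrier M") (auto simp: monoid_ring_def Pi_iff)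

lemma mr_supp: "f \<in> carrier P \<Longrightarrow> f m \<noteq> \<zero>\<^bsub>F\<^esub> \<Longrightarrow> m \<in> carrier M"
  by (auto simp: monoid_ring_def)

lemma mr_finite: "f \<in> carrier P \<Longrightarrow> finite {m. f m \<noteq> \<zero>\<^bsub>F\<^esub>}"
  by (auto simp: monoid_ring_def)

lemma mr_memI:
  "(\<And>m. f m \<in> carrier F) \<Longrightarrow> (\<And>m. f m \<noteq> \<zero>\<^bsub>F\<^esub> \<Longrightarrow> m \<in> carrier M) \<Longrightarrow> finite {m. f m \<noteq> \<zero>\<^bsub>F\<^esub>}
    \<Longrightarrow> f \<in> carrier P"
  by (auto simp: monoid_ring_def)

declare mr_closed [simp]

lemma mult_alt:
  assumes f: "f \<in> carrier P" and g: "g \<in> carrier P"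
    and A: "finite A" "{m. f m \<noteq> \<zero>\<^bsub>F\<^esub>} \<subseteq> A" and B: "finite B" "{m. g m \<noteq> \<zero>\<^bsub>F\<^esub>} \<subseteq> B"
  shows "(f \<otimes>\<^bsub>P\<^esub> g) m = (\<Oplus>\<^bsub>F\<^esub>u\<in>A. \<Oplus>\<^bsub>F\<^esub>v\<in>B. if u \<otimes>\<^bsub>M\<^esub> v = m then f u \<otimes>\<^bsub>F\<^esub> g v else \<zero>\<^bsub>F\<^esub>)"
proof -
  have "(f \<otimes>\<^bsub>P\<^esub> g) m = finsum F (\<lambda>(u, v). f u \<otimes>\<^bsub>F\<^esub> g v)
        {(u, v). f u \<noteq> \<zero>\<^bsub>F\<^esub> \<and> g v \<noteq> \<zero>\<^bsub>F\<^esub> \<and> u \<otimes>\<^bsub>M\<^esub> v = m}"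
    by (simp add: monoid_ring_def del: mr_closed)
  also have "\<dots> = finsum F (\<lambda>(u, v). if u \<otimes>\<^bsub>M\<^esub> v = m then f u \<otimes>\<^bsub>F\<^esub> g v else \<zero>\<^bsub>F\<^esub>) (A \<times> B)"
    proof (rule F.add.finprod_mono_neutral_cong_left)
    show "finite (A \<times> B)" using A B by simp
    show "{(u, v). f u \<noteq> \<zero>\<^bsub>F\<^esub> \<and> g v \<noteq> \<zero>\<^bsub>F\<^esub> \<and> u \<otimes>\<^bsub>M\<^esub> v = m} \<subseteq> A \<times> B" using A B by blast
    fix p
    show "(case p of (u, v) \<Rightarrow> if u \<otimes>\<^bsub>M\<^esub> v = m then f u \<otimes>\<^bsub>F\<^esub> g v else \<zero>\<^bsub>F\<^esub>) = \<zero>\<^bsub>F\<^esub>"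
      if "p \<in> A \<times> B - {(u, v). f u \<noteq> \<zero>\<^bsub>F\<^esub> \<and> g v \<noteq> \<zero>\<^bsub>F\<^esub> \<and> u \<otimes>\<^bsub>M\<^esub> v = m}"
    proof -
      obtain u v where p: "p = (u, v)" by (cases p)
      with that have "f u = \<zero>\<^bsub>F\<^esub> \<or> g v = \<zero>\<^bsub>F\<^esub> \<or> u \<otimes>\<^bsub>M\<^esub> v \<noteq> m" by auto
      then show ?thesis
        unfolding p prod.case using mr_closed [OF f, of u] mr_closed [OF g, of v] by (elim disjE) simp_all
    qed
    show "(case p of (u, v) \<Rightarrow> f u \<otimes>\<^bsub>F\<^esub> g v)
        = (case p of (u, v) \<Rightarrow> if u \<otimes>\<^bsub>M\<^esub> v = m then f u \<otimes>\<^bsub>F\<^esub> g v else \<zero>\<^bsub>F\<^esub>)"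
      if "p \<in> {(u, v). f u \<noteq> \<zero>\<^bsub>F\<^esub> \<and> g v \<noteq> \<zero>\<^bsub>F\<^esub> \<and> u \<otimes>\<^bsub>M\<^esub> v = m}"
      using that by auto
  qed (use mr_closed [OF f] mr_closed [OF g] in auto)
  also have "\<dots> = (\<Oplus>\<^bsub>F\<^esub>u\<in>A. \<Oplus>\<^bsub>F\<^esub>v\<in>B. if u \<otimes>\<^bsub>M\<^esub> v = m then f u \<otimes>\<^bsub>F\<^esub> g v else \<zero>\<^bsub>F\<^esub>)"
    using A B f g by (intro F.finsum_Times) auto
  finally show ?thesis .
qed

lemma mult_closed:
  assumes f: "f \<in> carrier P" and g: "g \<in> carrier P"
  shows "f \<otimes>\<^bsub>P\<^esub> g \<in> carrier P"
proof -
  let ?A = "{m. f m \<noteq> \<zero>\<^bsub>F\<^esub>}" and ?B = "{m. g m \<noteq> \<zero>\<^bsub>F\<^esub>}"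
  have alt: "(f \<otimes>\<^bsub>P\<^esub> g) m = (\<Oplus>\<^bsub>F\<^esub>u\<in>?A. \<Oplus>\<^bsub>F\<^esub>v\<in>?B. if u \<otimes>\<^bsub>M\<^esub> v = m then f u \<otimes>\<^bsub>F\<^esub> g v else \<zero>\<^bsub>F\<^esub>)" for m
    using mr_finite [OF f] mr_finite [OF g] by (intro mult_alt f g) auto
  have sub: "{m. (f \<otimes>\<^bsub>P\<^esub> g) m \<noteq> \<zero>\<^bsub>F\<^esub>} \<subseteq> (\<lambda>(u, v). u \<otimes>\<^bsub>M\<^esub> v) ` (?A \<times> ?B)"
  proof
    fix m assume "m \<in> {m. (f \<otimes>\<^bsub>P\<^esub> g) m \<noteq> \<zero>\<^bsub>F\<^esub>}"
    then have nz: "(f \<otimes>\<^bsub>P\<^esub> g) m \<noteq> \<zero>\<^bsub>F\<^esub>" by simp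
    show "m \<in> (\<lambda>(u, v). u \<otimes>\<^bsub>M\<^esub> v) ` (?A \<times> ?B)"
    proof (rule ccontr)
      assume "m \<notin> (\<lambda>(u, v). u \<otimes>\<^bsub>M\<^esub> v) ` (?A \<times> ?B)"
      then have ne: "u \<otimes>\<^bsub>M\<^esub> v \<noteq> m" if "u \<in> ?A" "v \<in> ?B" for u v using that by auto
      have z: "(\<Oplus>\<^bsub>F\<^esub>v\<in>?B. if u \<otimes>\<^bsub>M\<^esub> v = m then f u \<otimes>\<^bsub>F\<^esub> g v else \<zero>\<^bsub>F\<^esub>) = \<zero>\<^bsub>F\<^esub>" if "u \<in> ?A" for u
        by (rule F.add.finprod_one_eqI) (simp add: ne [OF that])
      have "(f \<otimes>\<^bsub>P\<^esub> g) m = \<zero>\<^bsub>F\<^esub>"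
        unfolding alt by (rule F.add.finprod_one_eqI) (rule z)
      with nz show False by simp
    qed
  qed
  show ?thesis
  proof (rule mr_memI)
    show "(f \<otimes>\<^bsub>P\<^esub> g) m \<in> carrier F" for m
      unfolding alt using f g by (intro F.finsum_closed) (auto intro!: F.finsum_closed)
    show "m \<in> carrier M" if nz: "(f \<otimes>\<^bsub>P\<^esub> g) m \<noteq> \<zero>\<^bsub>F\<^esub>" for m
    proof -
      obtain u v where "u \<in> ?A" "v \<in> ?B" "m = u \<otimes>\<^bsub>M\<^esub> v" using nz subsetD [OF sub, of m] by auto
      then show ?thesis using mr_supp [OF f, of u] mr_supp [OF g, of v] by simp
    qed
    show "finite {m. (f \<otimes>\<^bsub>P\<^esub> g) m \<noteq> \<zero>\<^bsub>F\<^esub>}"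
      using sub mr_finite [OF f] mr_finite [OF g] by (meson finite_SigmaI finite_imageI finite_subset)
  qed
qed

lemma add_simp: "(f \<oplus>\<^bsub>P\<^esub> g) m = f m \<oplus>\<^bsub>F\<^esub> g m"
  by (simp add: monoid_ring_def del: mr_closed)

lemma zero_simp: "\<zero>\<^bsub>P\<^esub> m = \<zero>\<^bsub>F\<^esub>"
  by (simp add: monoid_ring_def del: mr_closed)

lemma one_simp: "\<one>\<^bsub>P\<^esub> m = (if m = \<one>\<^bsub>M\<^esub> then \<one>\<^bsub>F\<^esub> else \<zero>\<^bsub>F\<^esub>)"
  by (simp add: monoid_ring_def del: mr_closed)

lemma add_closed:
  assumes f: "f \<in> carrier P" and g: "g \<in> carrier P"
  shows "f \<oplus>\<^bsub>P\<^esub> g \<in> carrier P"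
proof (rule mr_memI)
  have sub: "{m. (f \<oplus>\<^bsub>P\<^esub> g) m \<noteq> \<zero>\<^bsub>F\<^esub>} \<subseteq> {m. f m \<noteq> \<zero>\<^bsub>F\<^esub>} \<union> {m. g m \<noteq> \<zero>\<^bsub>F\<^esub>}"
    by (auto simp: add_simp)
  then show "finite {m. (f \<oplus>\<^bsub>P\<^esub> g) m \<noteq> \<zero>\<^bsub>F\<^esub>}"
    using mr_finite [OF f] mr_finite [OF g] by (meson finite_Un finite_subset)
  show "m \<in> carrier M" if "(f \<oplus>\<^bsub>P\<^esub> g) m \<noteq> \<zero>\<^bsub>F\<^esub>" for m
    using that sub mr_supp [OF f] mr_supp [OF g] by blast
qed (use f g in \<open>auto simp: add_simp\<close>)

lemma monomial_closed:
  assumes "c \<in> carrier F" "m \<in> carrier M"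
  shows "monomial F c m \<in> carrier P"
proof (rule mr_memI)
  have "{n. monomial F c m n \<noteq> \<zero>\<^bsub>F\<^esub>} \<subseteq> {m}"
    by (auto simp: monomial_def)
  then show "finite {n. monomial F c m n \<noteq> \<zero>\<^bsub>F\<^esub>}"
    by (rule finite_subset) simp
  show "monomial F c m n \<in> carrier F" for n
    unfolding monomial_def using assms by (cases "n = m") simp_all
  show "n \<in> carrier M" if "monomial F c m n \<noteq> \<zero>\<^bsub>F\<^esub>" for n
    using that assms unfolding monomial_def by (cases "n = m") simp_all
qed

lemma one_eq: "\<one>\<^bsub>P\<^esub> = monomial F \<one>\<^bsub>F\<^esub> \<one>\<^bsub>M\<^esub>"
  by (simp add: monoid_ring_def monomial_def del: mr_closed)

lemma monomial_mult:
  assumes c: "c \<in> carrier F" and d: "d \<in> carrier F" and u: "u \<in> carrier M" and v: "v \<in> carrier M"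
  shows "monomial F c u \<otimes>\<^bsub>P\<^esub> monomial F d v = monomial F (c \<otimes>\<^bsub>F\<^esub> d) (u \<otimes>\<^bsub>M\<^esub> v)"
proof
  fix m
  have mc: "monomial F c u \<in> carrier P" and md: "monomial F d v \<in> carrier P"
    using assms by (simp_all add: monomial_closed)
  have "(monomial F c u \<otimes>\<^bsub>P\<^esub> monomial F d v) m
      = (\<Oplus>\<^bsub>F\<^esub>u'\<in>{u}. \<Oplus>\<^bsub>F\<^esub>v'\<in>{v}. if u' \<otimes>\<^bsub>M\<^esub> v' = m
           then monomial F c u u' \<otimes>\<^bsub>F\<^esub> monomial F d v v' else \<zero>\<^bsub>F\<^esub>)"
    by (rule mult_alt [OF mc md]) (auto simp: monomial_def)
  also have "\<dots> = monomial F (c \<otimes>\<^bsub>F\<^esub> d) (u \<otimes>\<^bsub>M\<^esub> v) m"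
    using c d by (simp add: F.finsum_insert monomial_def)
  finally show "(monomial F c u \<otimes>\<^bsub>P\<^esub> monomial F d v) m = monomial F (c \<otimes>\<^bsub>F\<^esub> d) (u \<otimes>\<^bsub>M\<^esub> v) m" .
qed

lemma mult_assoc:
  assumes f: "f \<in> carrier P" and g: "g \<in> carrier P" and h: "h \<in> carrier P"
  shows "f \<otimes>\<^bsub>P\<^esub> g \<otimes>\<^bsub>P\<^esub> h = f \<otimes>\<^bsub>P\<^esub> (g \<otimes>\<^bsub>P\<^esub> h)"
proof
  fix m
  define A where "A = {m. f m \<noteq> \<zero>\<^bsub>F\<^esub>}"
  define B where "B = {m. g m \<noteq> \<zero>\<^bsub>F\<^esub>}"
  define C where "C = {m. h m \<noteq> \<zero>\<^bsub>F\<^esub>}"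
  have fin: "finite A" "finite B" "finite C"
    using mr_finite f g h by (simp_all add: A_def B_def C_def)
  have car: "A \<subseteq> carrier M" "B \<subseteq> carrier M" "C \<subseteq> carrier M"
    using mr_supp f g h by (auto simp: A_def B_def C_def)
  define S where "S = (\<lambda>(u, v). u \<otimes>\<^bsub>M\<^esub> v) ` (A \<times> B) \<union> {p. (f \<otimes>\<^bsub>P\<^esub> g) p \<noteq> \<zero>\<^bsub>F\<^esub>}"
  define T where "T = (\<lambda>(u, v). u \<otimes>\<^bsub>M\<^esub> v) ` (B \<times> C) \<union> {p. (g \<otimes>\<^bsub>P\<^esub> h) p \<noteq> \<zero>\<^bsub>F\<^esub>}"
  have finS: "finite S" and finT: "finite T"
    using fin mr_finite [OF mult_closed [OF f g]] mr_finite [OF mult_closed [OF g h]]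
    by (auto simp: S_def T_def)
  let ?x = "\<lambda>u v w. if u \<otimes>\<^bsub>M\<^esub> v \<otimes>\<^bsub>M\<^esub> w = m then f u \<otimes>\<^bsub>F\<^esub> g v \<otimes>\<^bsub>F\<^esub> h w else \<zero>\<^bsub>F\<^esub>"
  have fg: "(f \<otimes>\<^bsub>P\<^esub> g) p = (\<Oplus>\<^bsub>F\<^esub>u\<in>A. \<Oplus>\<^bsub>F\<^esub>v\<in>B. if u \<otimes>\<^bsub>M\<^esub> v = p then f u \<otimes>\<^bsub>F\<^esub> g v else \<zero>\<^bsub>F\<^esub>)" for p
    using fin by (intro mult_alt f g) (auto simp: A_def B_def)
  have gh: "(g \<otimes>\<^bsub>P\<^esub> h) p = (\<Oplus>\<^bsub>F\<^esub>u\<in>B. \<Oplus>\<^bsub>F\<^esub>v\<in>C. if u \<otimes>\<^bsub>M\<^esub> v = p then g u \<otimes>\<^bsub>F\<^esub> h v else \<zero>\<^bsub>F\<^esub>)" for p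
    using fin by (intro mult_alt g h) (auto simp: B_def C_def)
  have "(f \<otimes>\<^bsub>P\<^esub> g \<otimes>\<^bsub>P\<^esub> h) m
      = (\<Oplus>\<^bsub>F\<^esub>p\<in>S. \<Oplus>\<^bsub>F\<^esub>w\<in>C. if p \<otimes>\<^bsub>M\<^esub> w = m then (f \<otimes>\<^bsub>P\<^esub> g) p \<otimes>\<^bsub>F\<^esub> h w else \<zero>\<^bsub>F\<^esub>)"
    using finS fin by (intro mult_alt mult_closed f g h) (auto simp: S_def C_def)
  also have "\<dots> = (\<Oplus>\<^bsub>F\<^esub>p\<in>S. \<Oplus>\<^bsub>F\<^esub>w\<in>C. \<Oplus>\<^bsub>F\<^esub>u\<in>A. \<Oplus>\<^bsub>F\<^esub>v\<in>B.
       if p = u \<otimes>\<^bsub>M\<^esub> v then ?x u v w else \<zero>\<^bsub>F\<^esub>)"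
  proof (rule F.finsum_cong2)
    fix p w assume "p \<in> S" "w \<in> C"
    have "(f \<otimes>\<^bsub>P\<^esub> g) p \<otimes>\<^bsub>F\<^esub> h w
        = (\<Oplus>\<^bsub>F\<^esub>u\<in>A. \<Oplus>\<^bsub>F\<^esub>v\<in>B. (if u \<otimes>\<^bsub>M\<^esub> v = p then f u \<otimes>\<^bsub>F\<^esub> g v else \<zero>\<^bsub>F\<^esub>) \<otimes>\<^bsub>F\<^esub> h w)"
      unfolding fg using fin f g h by (intro F.finsum_distr2) auto
    also have "\<dots> = (\<Oplus>\<^bsub>F\<^esub>u\<in>A. \<Oplus>\<^bsub>F\<^esub>v\<in>B. if p = u \<otimes>\<^bsub>M\<^esub> v then f u \<otimes>\<^bsub>F\<^esub> g v \<otimes>\<^bsub>F\<^esub> h w else \<zero>\<^bsub>F\<^esub>)"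
      using f g h by (intro F.finsum_cong2) auto
    finally have *: "(f \<otimes>\<^bsub>P\<^esub> g) p \<otimes>\<^bsub>F\<^esub> h w = \<dots>" .
    show "(if p \<otimes>\<^bsub>M\<^esub> w = m then (f \<otimes>\<^bsub>P\<^esub> g) p \<otimes>\<^bsub>F\<^esub> h w else \<zero>\<^bsub>F\<^esub>)
        = (\<Oplus>\<^bsub>F\<^esub>u\<in>A. \<Oplus>\<^bsub>F\<^esub>v\<in>B. if p = u \<otimes>\<^bsub>M\<^esub> v then ?x u v w else \<zero>\<^bsub>F\<^esub>)"
    proof (cases "p \<otimes>\<^bsub>M\<^esub> w = m")
      case True
      then show ?thesis
        unfolding * if_P [OF True] using f g h by (intro F.finsum_cong2) auto
    next
      case False
      have z: "(\<Oplus>\<^bsub>F\<^esub>v\<in>B. if p = u \<otimes>\<^bsub>M\<^esub> v then ?x u v w else \<zero>\<^bsub>F\<^esub>) = \<zero>\<^bsub>F\<^esub>" for u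
        by (rule F.add.finprod_one_eqI) (use False in auto)
      have "(\<Oplus>\<^bsub>F\<^esub>u\<in>A. \<Oplus>\<^bsub>F\<^esub>v\<in>B. if p = u \<otimes>\<^bsub>M\<^esub> v then ?x u v w else \<zero>\<^bsub>F\<^esub>) = \<zero>\<^bsub>F\<^esub>"
        by (rule F.add.finprod_one_eqI) (rule z)
      with False show ?thesis by simp
    qed
  qed (use f g h in \<open>auto intro!: F.finsum_closed\<close>)
  also have "\<dots> = (\<Oplus>\<^bsub>F\<^esub>w\<in>C. \<Oplus>\<^bsub>F\<^esub>u\<in>A. \<Oplus>\<^bsub>F\<^esub>v\<in>B. \<Oplus>\<^bsub>F\<^esub>p\<in>S.
       if p = u \<otimes>\<^bsub>M\<^esub> v then ?x u v w else \<zero>\<^bsub>F\<^esub>)"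
    using fin finS f g h by (intro F.finsum_swap4) auto
  also have "\<dots> = (\<Oplus>\<^bsub>F\<^esub>w\<in>C. \<Oplus>\<^bsub>F\<^esub>u\<in>A. \<Oplus>\<^bsub>F\<^esub>v\<in>B. ?x u v w)"
  proof (rule F.finsum_cong3)
    fix w u v assume "w \<in> C" "u \<in> A" "v \<in> B"
    then show "(\<Oplus>\<^bsub>F\<^esub>p\<in>S. if p = u \<otimes>\<^bsub>M\<^esub> v then ?x u v w else \<zero>\<^bsub>F\<^esub>) = ?x u v w"
      using finS f g h
      by (intro F.add.finprod_singleton_swap) (auto simp: S_def)
  qed (use f g h in \<open>auto intro!: F.finsum_closed\<close>)
  also have "\<dots> = (\<Oplus>\<^bsub>F\<^esub>u\<in>A. \<Oplus>\<^bsub>F\<^esub>w\<in>C. \<Oplus>\<^bsub>F\<^esub>v\<in>B. ?x u v w)"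
    using fin f g h by (intro F.finsum_swap) (auto intro!: F.finsum_closed)
  also have "\<dots> = (\<Oplus>\<^bsub>F\<^esub>u\<in>A. \<Oplus>\<^bsub>F\<^esub>v\<in>B. \<Oplus>\<^bsub>F\<^esub>w\<in>C. ?x u v w)"
  proof (rule F.finsum_cong' [OF refl])
    show "(\<Oplus>\<^bsub>F\<^esub>w\<in>C. \<Oplus>\<^bsub>F\<^esub>v\<in>B. ?x u v w) = (\<Oplus>\<^bsub>F\<^esub>v\<in>B. \<Oplus>\<^bsub>F\<^esub>w\<in>C. ?x u v w)" for u
      using fin f g h by (intro F.finsum_swap) auto
  qed (use f g h in \<open>auto intro!: F.finsum_closed\<close>)
  finally have L: "(f \<otimes>\<^bsub>P\<^esub> g \<otimes>\<^bsub>P\<^esub> h) m = \<dots>" .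
  have "(f \<otimes>\<^bsub>P\<^esub> (g \<otimes>\<^bsub>P\<^esub> h)) m
      = (\<Oplus>\<^bsub>F\<^esub>u\<in>A. \<Oplus>\<^bsub>F\<^esub>p\<in>T. if u \<otimes>\<^bsub>M\<^esub> p = m then f u \<otimes>\<^bsub>F\<^esub> (g \<otimes>\<^bsub>P\<^esub> h) p else \<zero>\<^bsub>F\<^esub>)"
    using finT fin by (intro mult_alt mult_closed f g h) (auto simp: T_def A_def)
  also have "\<dots> = (\<Oplus>\<^bsub>F\<^esub>u\<in>A. \<Oplus>\<^bsub>F\<^esub>p\<in>T. \<Oplus>\<^bsub>F\<^esub>v\<in>B. \<Oplus>\<^bsub>F\<^esub>w\<in>C.
       if p = v \<otimes>\<^bsub>M\<^esub> w then ?x u v w else \<zero>\<^bsub>F\<^esub>)"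
  proof (rule F.finsum_cong2)
    fix u p assume u: "u \<in> A" and "p \<in> T"
    have "f u \<otimes>\<^bsub>F\<^esub> (g \<otimes>\<^bsub>P\<^esub> h) p
        = (\<Oplus>\<^bsub>F\<^esub>v\<in>B. \<Oplus>\<^bsub>F\<^esub>w\<in>C. f u \<otimes>\<^bsub>F\<^esub> (if v \<otimes>\<^bsub>M\<^esub> w = p then g v \<otimes>\<^bsub>F\<^esub> h w else \<zero>\<^bsub>F\<^esub>))"
      unfolding gh using fin f g h by (intro F.finsum_distr2) auto
    also have "\<dots> = (\<Oplus>\<^bsub>F\<^esub>v\<in>B. \<Oplus>\<^bsub>F\<^esub>w\<in>C. if p = v \<otimes>\<^bsub>M\<^esub> w then f u \<otimes>\<^bsub>F\<^esub> g v \<otimes>\<^bsub>F\<^esub> h w else \<zero>\<^bsub>F\<^esub>)"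
      using f g h by (intro F.finsum_cong2) (auto simp: F.m_assoc)
    finally have *: "f u \<otimes>\<^bsub>F\<^esub> (g \<otimes>\<^bsub>P\<^esub> h) p = \<dots>" .
    have as: "u \<otimes>\<^bsub>M\<^esub> v \<otimes>\<^bsub>M\<^esub> w = u \<otimes>\<^bsub>M\<^esub> (v \<otimes>\<^bsub>M\<^esub> w)" if "v \<in> B" "w \<in> C" for v w
      using car u that by (intro M.m_assoc) auto
    show "(if u \<otimes>\<^bsub>M\<^esub> p = m then f u \<otimes>\<^bsub>F\<^esub> (g \<otimes>\<^bsub>P\<^esub> h) p else \<zero>\<^bsub>F\<^esub>)
        = (\<Oplus>\<^bsub>F\<^esub>v\<in>B. \<Oplus>\<^bsub>F\<^esub>w\<in>C. if p = v \<otimes>\<^bsub>M\<^esub> w then ?x u v w else \<zero>\<^bsub>F\<^esub>)"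
    proof (cases "u \<otimes>\<^bsub>M\<^esub> p = m")
      case True
      then show ?thesis
        unfolding * if_P [OF True] using f g h by (intro F.finsum_cong2) (auto simp: as)
    next
      case False
      have z: "(\<Oplus>\<^bsub>F\<^esub>w\<in>C. if p = v \<otimes>\<^bsub>M\<^esub> w then ?x u v w else \<zero>\<^bsub>F\<^esub>) = \<zero>\<^bsub>F\<^esub>" if "v \<in> B" for v
        by (rule F.add.finprod_one_eqI) (use False that in \<open>auto simp: as\<close>)
      have "(\<Oplus>\<^bsub>F\<^esub>v\<in>B. \<Oplus>\<^bsub>F\<^esub>w\<in>C. if p = v \<otimes>\<^bsub>M\<^esub> w then ?x u v w else \<zero>\<^bsub>F\<^esub>) = \<zero>\<^bsub>F\<^esub>"
        by (rule F.add.finprod_one_eqI) (rule z)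
      with False show ?thesis by simp
    qed
  qed (use f g h mult_closed [OF g h] in \<open>auto intro!: F.finsum_closed\<close>)
  also have "\<dots> = (\<Oplus>\<^bsub>F\<^esub>u\<in>A. \<Oplus>\<^bsub>F\<^esub>v\<in>B. \<Oplus>\<^bsub>F\<^esub>w\<in>C. \<Oplus>\<^bsub>F\<^esub>p\<in>T.
       if p = v \<otimes>\<^bsub>M\<^esub> w then ?x u v w else \<zero>\<^bsub>F\<^esub>)"
  proof (rule F.finsum_cong' [OF refl])
    show "(\<Oplus>\<^bsub>F\<^esub>p\<in>T. \<Oplus>\<^bsub>F\<^esub>v\<in>B. \<Oplus>\<^bsub>F\<^esub>w\<in>C. if p = v \<otimes>\<^bsub>M\<^esub> w then ?x u v w else \<zero>\<^bsub>F\<^esub>)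
        = (\<Oplus>\<^bsub>F\<^esub>v\<in>B. \<Oplus>\<^bsub>F\<^esub>w\<in>C. \<Oplus>\<^bsub>F\<^esub>p\<in>T. if p = v \<otimes>\<^bsub>M\<^esub> w then ?x u v w else \<zero>\<^bsub>F\<^esub>)" for u
      using fin finT f g h by (intro F.finsum_swap3) auto
  qed (use f g h in \<open>auto intro!: F.finsum_closed\<close>)
  also have "\<dots> = (\<Oplus>\<^bsub>F\<^esub>u\<in>A. \<Oplus>\<^bsub>F\<^esub>v\<in>B. \<Oplus>\<^bsub>F\<^esub>w\<in>C. ?x u v w)"
  proof (rule F.finsum_cong3)
    fix u v w assume "u \<in> A" "v \<in> B" "w \<in> C"
    then show "(\<Oplus>\<^bsub>F\<^esub>p\<in>T. if p = v \<otimes>\<^bsub>M\<^esub> w then ?x u v w else \<zero>\<^bsub>F\<^esub>) = ?x u v w"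
      using finT f g h
      by (intro F.add.finprod_singleton_swap) (auto simp: T_def)
  qed (use f g h in \<open>auto intro!: F.finsum_closed\<close>)
  finally show "(f \<otimes>\<^bsub>P\<^esub> g \<otimes>\<^bsub>P\<^esub> h) m = (f \<otimes>\<^bsub>P\<^esub> (g \<otimes>\<^bsub>P\<^esub> h)) m"
    using L by simp
qed

lemma mult_one:
  assumes f: "f \<in> carrier P"
  shows "\<one>\<^bsub>P\<^esub> \<otimes>\<^bsub>P\<^esub> f = f" and "f \<otimes>\<^bsub>P\<^esub> \<one>\<^bsub>P\<^esub> = f"
proof -
  have one: "\<one>\<^bsub>P\<^esub> \<in> carrier P" by (simp add: one_eq monomial_closed)
  show "\<one>\<^bsub>P\<^esub> \<otimes>\<^bsub>P\<^esub> f = f"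
  proof
    fix m
    define A where "A = insert m {m. f m \<noteq> \<zero>\<^bsub>F\<^esub>}"
    have fin: "finite A" using mr_finite [OF f] by (simp add: A_def)
    have "(\<one>\<^bsub>P\<^esub> \<otimes>\<^bsub>P\<^esub> f) m
        = (\<Oplus>\<^bsub>F\<^esub>u\<in>{\<one>\<^bsub>M\<^esub>}. \<Oplus>\<^bsub>F\<^esub>v\<in>A. if u \<otimes>\<^bsub>M\<^esub> v = m then \<one>\<^bsub>P\<^esub> u \<otimes>\<^bsub>F\<^esub> f v else \<zero>\<^bsub>F\<^esub>)"
      using fin by (intro mult_alt one f) (auto simp: one_simp A_def)
    also have "\<dots> = (\<Oplus>\<^bsub>F\<^esub>v\<in>A. if \<one>\<^bsub>M\<^esub> \<otimes>\<^bsub>M\<^esub> v = m then \<one>\<^bsub>P\<^esub> \<one>\<^bsub>M\<^esub> \<otimes>\<^bsub>F\<^esub> f v else \<zero>\<^bsub>F\<^esub>)"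
      using f one by (simp add: F.finsum_insert F.finsum_closed)
    also have "\<dots> = (\<Oplus>\<^bsub>F\<^esub>v\<in>A. if v = m then f v else \<zero>\<^bsub>F\<^esub>)"
    proof (intro F.finsum_cong' refl)
      fix v assume "v \<in> A"
      show "(if \<one>\<^bsub>M\<^esub> \<otimes>\<^bsub>M\<^esub> v = m then \<one>\<^bsub>P\<^esub> \<one>\<^bsub>M\<^esub> \<otimes>\<^bsub>F\<^esub> f v else \<zero>\<^bsub>F\<^esub>) = (if v = m then f v else \<zero>\<^bsub>F\<^esub>)"
        using mr_supp [OF f, of v] f by (cases "f v = \<zero>\<^bsub>F\<^esub>") (auto simp: one_simp)
    qed (use f in auto)
    also have "\<dots> = f m"
      using fin f by (intro F.add.finprod_singleton_swap) (auto simp: A_def)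
    finally show "(\<one>\<^bsub>P\<^esub> \<otimes>\<^bsub>P\<^esub> f) m = f m" .
  qed
  show "f \<otimes>\<^bsub>P\<^esub> \<one>\<^bsub>P\<^esub> = f"
  proof
    fix m
    define A where "A = insert m {m. f m \<noteq> \<zero>\<^bsub>F\<^esub>}"
    have fin: "finite A" using mr_finite [OF f] by (simp add: A_def)
    have "(f \<otimes>\<^bsub>P\<^esub> \<one>\<^bsub>P\<^esub>) m
        = (\<Oplus>\<^bsub>F\<^esub>u\<in>A. \<Oplus>\<^bsub>F\<^esub>v\<in>{\<one>\<^bsub>M\<^esub>}. if u \<otimes>\<^bsub>M\<^esub> v = m then f u \<otimes>\<^bsub>F\<^esub> \<one>\<^bsub>P\<^esub> v else \<zero>\<^bsub>F\<^esub>)"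
      using fin by (intro mult_alt one f) (auto simp: one_simp A_def)
    also have "\<dots> = (\<Oplus>\<^bsub>F\<^esub>u\<in>A. if u = m then f u else \<zero>\<^bsub>F\<^esub>)"
    proof (intro F.finsum_cong' refl)
      fix u assume "u \<in> A"
      show "(\<Oplus>\<^bsub>F\<^esub>v\<in>{\<one>\<^bsub>M\<^esub>}. if u \<otimes>\<^bsub>M\<^esub> v = m then f u \<otimes>\<^bsub>F\<^esub> \<one>\<^bsub>P\<^esub> v else \<zero>\<^bsub>F\<^esub>)
          = (if u = m then f u else \<zero>\<^bsub>F\<^esub>)"
        using mr_supp [OF f, of u] f by (cases "f u = \<zero>\<^bsub>F\<^esub>") (auto simp: one_simp)
    qed (use f in auto)
    also have "\<dots> = f m"
      using fin f by (intro F.add.finprod_singleton_swap) (auto simp: A_def)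
    finally show "(f \<otimes>\<^bsub>P\<^esub> \<one>\<^bsub>P\<^esub>) m = f m" .
  qed
qed

lemma mult_distr:
  assumes f: "f \<in> carrier P" and g: "g \<in> carrier P" and h: "h \<in> carrier P"
  shows "(f \<oplus>\<^bsub>P\<^esub> g) \<otimes>\<^bsub>P\<^esub> h = f \<otimes>\<^bsub>P\<^esub> h \<oplus>\<^bsub>P\<^esub> g \<otimes>\<^bsub>P\<^esub> h"
    and "h \<otimes>\<^bsub>P\<^esub> (f \<oplus>\<^bsub>P\<^esub> g) = h \<otimes>\<^bsub>P\<^esub> f \<oplus>\<^bsub>P\<^esub> h \<otimes>\<^bsub>P\<^esub> g"
proof -
  define A where "A = {m. f m \<noteq> \<zero>\<^bsub>F\<^esub>} \<union> {m. g m \<noteq> \<zero>\<^bsub>F\<^esub>}"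
  define C where "C = {m. h m \<noteq> \<zero>\<^bsub>F\<^esub>}"
  have fin: "finite A" "finite C" using mr_finite f g h by (simp_all add: A_def C_def)
  have sub: "{m. f m \<noteq> \<zero>\<^bsub>F\<^esub>} \<subseteq> A" "{m. g m \<noteq> \<zero>\<^bsub>F\<^esub>} \<subseteq> A" "{m. (f \<oplus>\<^bsub>P\<^esub> g) m \<noteq> \<zero>\<^bsub>F\<^esub>} \<subseteq> A"
      "{m. h m \<noteq> \<zero>\<^bsub>F\<^esub>} \<subseteq> C"
    by (auto simp: A_def C_def add_simp)
  show "(f \<oplus>\<^bsub>P\<^esub> g) \<otimes>\<^bsub>P\<^esub> h = f \<otimes>\<^bsub>P\<^esub> h \<oplus>\<^bsub>P\<^esub> g \<otimes>\<^bsub>P\<^esub> h"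
  proof
    fix m
    note alt = mult_alt [OF _ h fin(1) _ fin(2) sub(4), of _ m]
    let ?t = "\<lambda>f u w. if u \<otimes>\<^bsub>M\<^esub> w = m then f u \<otimes>\<^bsub>F\<^esub> h w else \<zero>\<^bsub>F\<^esub>"
    have "((f \<oplus>\<^bsub>P\<^esub> g) \<otimes>\<^bsub>P\<^esub> h) m = (\<Oplus>\<^bsub>F\<^esub>u\<in>A. \<Oplus>\<^bsub>F\<^esub>w\<in>C. ?t (f \<oplus>\<^bsub>P\<^esub> g) u w)"
      by (rule alt [OF add_closed [OF f g] sub(3)])
    also have "\<dots> = (\<Oplus>\<^bsub>F\<^esub>u\<in>A. \<Oplus>\<^bsub>F\<^esub>w\<in>C. ?t f u w \<oplus>\<^bsub>F\<^esub> ?t g u w)"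
      using f g h by (intro F.finsum_cong2) (auto simp: add_simp F.l_distr)
    also have "\<dots> = (\<Oplus>\<^bsub>F\<^esub>u\<in>A. (\<Oplus>\<^bsub>F\<^esub>w\<in>C. ?t f u w) \<oplus>\<^bsub>F\<^esub> (\<Oplus>\<^bsub>F\<^esub>w\<in>C. ?t g u w))"
      using f g h by (intro F.finsum_cong' [OF refl] F.finsum_addf) (auto intro!: F.finsum_closed)
    also have "\<dots> = (\<Oplus>\<^bsub>F\<^esub>u\<in>A. \<Oplus>\<^bsub>F\<^esub>w\<in>C. ?t f u w) \<oplus>\<^bsub>F\<^esub> (\<Oplus>\<^bsub>F\<^esub>u\<in>A. \<Oplus>\<^bsub>F\<^esub>w\<in>C. ?t g u w)"
      using f g h by (intro F.finsum_addf) (auto intro!: F.finsum_closed)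
    also have "\<dots> = (f \<otimes>\<^bsub>P\<^esub> h \<oplus>\<^bsub>P\<^esub> g \<otimes>\<^bsub>P\<^esub> h) m"
      by (simp only: add_simp alt [OF f sub(1)] alt [OF g sub(2)])
    finally show "((f \<oplus>\<^bsub>P\<^esub> g) \<otimes>\<^bsub>P\<^esub> h) m = (f \<otimes>\<^bsub>P\<^esub> h \<oplus>\<^bsub>P\<^esub> g \<otimes>\<^bsub>P\<^esub> h) m" .
  qed
  show "h \<otimes>\<^bsub>P\<^esub> (f \<oplus>\<^bsub>P\<^esub> g) = h \<otimes>\<^bsub>P\<^esub> f \<oplus>\<^bsub>P\<^esub> h \<otimes>\<^bsub>P\<^esub> g"
  proof
    fix m
    note alt = mult_alt [OF h _ fin(2) sub(4) fin(1), of _ m]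
    let ?t = "\<lambda>f w u. if w \<otimes>\<^bsub>M\<^esub> u = m then h w \<otimes>\<^bsub>F\<^esub> f u else \<zero>\<^bsub>F\<^esub>"
    have "(h \<otimes>\<^bsub>P\<^esub> (f \<oplus>\<^bsub>P\<^esub> g)) m = (\<Oplus>\<^bsub>F\<^esub>w\<in>C. \<Oplus>\<^bsub>F\<^esub>u\<in>A. ?t (f \<oplus>\<^bsub>P\<^esub> g) w u)"
      by (rule alt [OF add_closed [OF f g] sub(3)])
    also have "\<dots> = (\<Oplus>\<^bsub>F\<^esub>w\<in>C. \<Oplus>\<^bsub>F\<^esub>u\<in>A. ?t f w u \<oplus>\<^bsub>F\<^esub> ?t g w u)"
      using f g h by (intro F.finsum_cong2) (auto simp: add_simp F.r_distr)
    also have "\<dots> = (\<Oplus>\<^bsub>F\<^esub>w\<in>C. (\<Oplus>\<^bsub>F\<^esub>u\<in>A. ?t f w u) \<oplus>\<^bsub>F\<^esub> (\<Oplus>\<^bsub>F\<^esub>u\<in>A. ?t g w u))"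
      using f g h by (intro F.finsum_cong' [OF refl] F.finsum_addf) (auto intro!: F.finsum_closed)
    also have "\<dots> = (\<Oplus>\<^bsub>F\<^esub>w\<in>C. \<Oplus>\<^bsub>F\<^esub>u\<in>A. ?t f w u) \<oplus>\<^bsub>F\<^esub> (\<Oplus>\<^bsub>F\<^esub>w\<in>C. \<Oplus>\<^bsub>F\<^esub>u\<in>A. ?t g w u)"
      using f g h by (intro F.finsum_addf) (auto intro!: F.finsum_closed)
    also have "\<dots> = (h \<otimes>\<^bsub>P\<^esub> f \<oplus>\<^bsub>P\<^esub> h \<otimes>\<^bsub>P\<^esub> g) m"
      by (simp only: add_simp alt [OF f sub(1)] alt [OF g sub(2)])
    finally show "(h \<otimes>\<^bsub>P\<^esub> (f \<oplus>\<^bsub>P\<^esub> g)) m = (h \<otimes>\<^bsub>P\<^esub> f \<oplus>\<^bsub>P\<^esub> h \<otimes>\<^bsub>P\<^esub> g) m" .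
  qed
qed

theorem monoid_ring_ring: "ring (monoid_ring F M)"
proof (rule ringI)
  show "abelian_group P"
  proof (rule abelian_groupI)
    show "\<zero>\<^bsub>P\<^esub> \<in> carrier P" by (rule mr_memI) (auto simp: zero_simp)
    fix f assume f: "f \<in> carrier P"
    show "\<exists>g\<in>carrier P. g \<oplus>\<^bsub>P\<^esub> f = \<zero>\<^bsub>P\<^esub>"
    proof
      have eq: "{m. \<ominus>\<^bsub>F\<^esub> f m \<noteq> \<zero>\<^bsub>F\<^esub>} = {m. f m \<noteq> \<zero>\<^bsub>F\<^esub>}"
        using f by (auto simp: F.minus_equality dest: arg_cong [where f = "\<lambda>x. \<ominus>\<^bsub>F\<^esub> x"])
      show "(\<lambda>m. \<ominus>\<^bsub>F\<^esub> f m) \<in> carrier P"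
      proof (rule mr_memI)
        show "finite {m. \<ominus>\<^bsub>F\<^esub> f m \<noteq> \<zero>\<^bsub>F\<^esub>}" unfolding eq by (rule mr_finite [OF f])
        show "m \<in> carrier M" if "\<ominus>\<^bsub>F\<^esub> f m \<noteq> \<zero>\<^bsub>F\<^esub>" for m
          using that eq mr_supp [OF f] by blast
      qed (use f in auto)
      show "(\<lambda>m. \<ominus>\<^bsub>F\<^esub> f m) \<oplus>\<^bsub>P\<^esub> f = \<zero>\<^bsub>P\<^esub>"
        using f by (auto simp: fun_eq_iff add_simp zero_simp F.l_neg)
    qed
  qed (auto simp: fun_eq_iff add_simp zero_simp F.a_ac intro: add_closed)
  show "monoid P"
    by (rule monoidI) (auto simp: mult_closed mult_assoc mult_one one_eq [symmetric]
        monomial_closed [of "\<one>\<^bsub>F\<^esub>" "\<one>\<^bsub>M\<^esub>", folded one_eq])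
qed (auto simp: mult_distr)

end

lemma free_algebra_ring: "ring F \<Longrightarrow> ring (free_algebra F X)"
  unfolding free_algebra_def
  by (intro monoid_ring_context.monoid_ring_ring monoid_ring_context.intro monoidI)
    (auto simp: word_monoid_def)

theorem tensor_algebra_ring:
  assumes "ring F" "ring A" "ring B"
    and p: "p \<in> carrier F \<rightarrow> carrier A" and q: "q \<in> carrier F \<rightarrow> carrier B"
  shows "ring (tensor_algebra F p A q B)"
proof -
  interpret F: ring F by fact
  interpret A: ring A by fact
  interpret B: ring B by fact
  interpret MR: monoid_ring_context F "A \<times>\<times> B"
    by (intro monoid_ring_context.intro DirProd_monoid F.ring_axioms A.monoid_axioms B.monoid_axioms)
  interpret P: ring "monoid_ring F (A \<times>\<times> B)" by (rule MR.monoid_ring_ring)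
  have m: "monomial F c (a, b) \<in> carrier (monoid_ring F (A \<times>\<times> B))"
    if "c \<in> carrier F" "a \<in> carrier A" "b \<in> carrier B" for a b c
    using that by (intro MR.monomial_closed) (auto simp: DirProd_def)
  have "bilinear_relations F p A q B \<subseteq> carrier (monoid_ring F (A \<times>\<times> B))"
    using p q by (auto simp: bilinear_relations_def Let_def Pi_iff intro!: m P.minus_closed P.a_closed)
  then show ?thesis
    unfolding tensor_algebra_def by (intro ideal.quotient_is_ring P.genideal_ideal)
qed

lemma local_hom_rel_equiv:
  assumes K: "skew_field K"
  shows "equiv (local_homs R K i L j) (local_hom_rel R K i L j)"
proof (rule equivI)
  have restr: "(S, \<beta>) \<in> local_homs R K i L j"
    if "(S, \<alpha>) \<in> local_homs R K i L j" "\<forall>a\<in>S. \<alpha> a = \<beta> a" for S \<alpha> \<beta>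
  proof -
    have *: "subring S K" "i ` carrier R \<subseteq> S" using that by (auto simp: local_homs_def)
    have "\<one>\<^bsub>K\<^esub> \<in> S" "\<And>a b. a \<in> S \<Longrightarrow> b \<in> S \<Longrightarrow> a \<otimes>\<^bsub>K\<^esub> b \<in> S" "\<And>a b. a \<in> S \<Longrightarrow> b \<in> S \<Longrightarrow> a \<oplus>\<^bsub>K\<^esub> b \<in> S"
      using subringE(3,6,7) [OF *(1)] by auto
    then show ?thesis
      using that * by (auto simp: local_homs_def ring_hom_def image_subset_iff Pi_iff)
  qed
  interpret K: ring K using K by (rule skew_field.axioms)
  have inter: "(S \<inter> T, \<alpha>) \<in> local_homs R K i L j"
    if "(S, \<alpha>) \<in> local_homs R K i L j" "(T, \<alpha>) \<in> local_homs R K i L j" for S T \<alpha>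
  proof -
    have ST: "subring S K" "subring T K" using that by (auto simp: local_homs_def)
    then have "subring (S \<inter> T) K" by (rule K.subring_inter)
    moreover have "a \<in> Units (K\<lparr>carrier := S \<inter> T\<rparr>)"
      if U: "a \<in> Units (K\<lparr>carrier := S\<rparr>)" "a \<in> Units (K\<lparr>carrier := T\<rparr>)" for a
    proof -
      obtain b c where b: "a \<in> S" "b \<in> S" "b \<otimes>\<^bsub>K\<^esub> a = \<one>\<^bsub>K\<^esub>" "a \<otimes>\<^bsub>K\<^esub> b = \<one>\<^bsub>K\<^esub>"
        and c: "a \<in> T" "c \<in> T" "c \<otimes>\<^bsub>K\<^esub> a = \<one>\<^bsub>K\<^esub>" "a \<otimes>\<^bsub>K\<^esub> c = \<one>\<^bsub>K\<^esub>"
        using U by (auto simp: Units_def)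
      have "b = c"
        using b c subringE(1) [OF ST(1)] subringE(1) [OF ST(2)] by (intro K.inv_unique [of b a c]) auto
      with b c show ?thesis by (auto simp: Units_def)
    qed
    ultimately show ?thesis
      using that by (auto simp: local_homs_def ring_hom_def)
  qed
  show "refl_on (local_homs R K i L j) (local_hom_rel R K i L j)"
    by (rule refl_onI) (auto simp: local_hom_rel_def)
  show "sym (local_hom_rel R K i L j)"
  proof (rule symI)
    fix x y assume xy: "(x, y) \<in> local_hom_rel R K i L j"
    obtain K0 \<alpha> K1 \<beta> where e: "x = (K0, \<alpha>)" "y = (K1, \<beta>)"
      by (metis surj_pair)
    obtain S where S: "S \<subseteq> K0 \<inter> K1" "\<forall>a\<in>S. \<alpha> a = \<beta> a" "(S, \<alpha>) \<in> local_homs R K i L j"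
      using xy e by (auto simp: local_hom_rel_def)
    have "(S, \<beta>) \<in> local_homs R K i L j"
      by (rule restr [OF S(3,2)])
    then show "(y, x) \<in> local_hom_rel R K i L j"
      using xy S unfolding e local_hom_rel_def by (auto intro!: exI [of _ S])
  qed
  show "trans (local_hom_rel R K i L j)"
  proof (rule transI)
    fix x y z assume xy: "(x, y) \<in> local_hom_rel R K i L j" and yz: "(y, z) \<in> local_hom_rel R K i L j"
    obtain K0 \<alpha> K1 \<beta> K2 \<gamma> where e: "x = (K0, \<alpha>)" "y = (K1, \<beta>)" "z = (K2, \<gamma>)"
      by (metis surj_pair)
    obtain S where S: "S \<subseteq> K0 \<inter> K1" "\<forall>a\<in>S. \<alpha> a = \<beta> a" "(S, \<alpha>) \<in> local_homs R K i L j"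
      using xy e by (auto simp: local_hom_rel_def)
    obtain T where T: "T \<subseteq> K1 \<inter> K2" "\<forall>a\<in>T. \<beta> a = \<gamma> a" "(T, \<beta>) \<in> local_homs R K i L j"
      using yz e by (auto simp: local_hom_rel_def)
    have "(S \<inter> T, \<beta>) \<in> local_homs R K i L j"
      by (rule inter [OF restr [OF S(3,2)] T(3)])
    then have "(S \<inter> T, \<alpha>) \<in> local_homs R K i L j"
      by (rule restr) (use S in auto)
    then show "(x, z) \<in> local_hom_rel R K i L j"
      using xy yz e S T by (auto simp: local_hom_rel_def intro!: exI [of _ "S \<inter> T"])
  qed
qed (auto simp: local_hom_rel_def)

end

theory Submission
  imports Defs "HOL-Algebra.UnivPoly" "HOL-Algebra.Weak_Morphisms"
begin

text \<open>The tensor product $T = D \otimes_k D^{op}$ acts on the $k$-linear maps $g : D \to D$ by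
  $(a \otimes b) g = (v \mapsto a\, g(b v))$. For a skew subfield $E \supseteq k$ of $D$, the
  annihilator of the left $E$-linear maps is a left ideal of $T$ that grows with $E$. It determines $E$:
  the element $d \otimes 1 - 1 \otimes d$ kills every left $E$-linear map if $d \in E$, but if
  $d \notin E$ then some left $E$-linear $g$ has $g(1) = 1$ and $g(d) = 0$, and that $g$ survives.
  So a strictly ascending chain of skew subfields over $k$ refutes the noetherian property
  (\<open>tensor_not_noetherian\<close>). As a homomorphism from a skew field to a nonzero ring is injective,
  it suffices to find such a chain inside the free field $U = k(\langle x, y\rangle)$.

  The chain separates the elements $x_i = y^{-i} x y^i$ of $U$: its $n$-th member contains
  $x_0, \dots, x_n$, but not $x_{n+1}$. To define it one needs homomorphisms out of $U$, and the
  universal property only offers specializations, which are partial. They become total in the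
  following situation (\<open>universal_field_extension\<close>): let $j$ be a homomorphism from
  $R = k\langle x, y\rangle$ to a skew field $L$, and suppose that some local homomorphism from a
  subring of $L$ to $U$ takes $j$ back to the given map $\iota : R \to U$. Composing the
  specialization from $U$ to $L$ with it gives a specialization from $U$ to itself, by uniqueness the
  identity; hence everything was defined on all of $U$, and $j$ extends to $U$.

  Take for $L$ the iterated Laurent series field $U((a))((b))((s))$, in which $a$ and $b$ commute with
  $U$ and with each other, while $s$ commutes with $U$ and $a$ and satisfies $s b = a b s$. Let
  $\sigma$ be conjugation by $s$, so $\sigma(b) = a b$, and let $z = 1 + \cdots$ be the
  $q$-exponential series in $b$ (with $q = a$), which satisfies $\sigma(z) = z (1 + b)$. Setting
  $a$, $b$ and $s$ to $0$ is a local homomorphism to $U$, so $x \mapsto x + s$, $y \mapsto y z$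
  extends to a homomorphism $f : U \to L$. Its values are power series in $s$, and
  $f(u) = f_0(u) + d(u) s + \cdots$ gives a homomorphism $f_0$ and a twisted derivation $d$,
  $$d(u v) = f_0(u)\, d(v) + d(u)\, \sigma(f_0(v)), \qquad d(x) = 1, \qquad d(y) = 0.$$
  As $z$ commutes with $U$, one gets $f_0(x_i) = x_i$ and
  $d(x_i) = (y z)^{-i} \sigma(y z)^i = (1 + b)^i$. Therefore the skew subfields
  $E_n = \{u.\ f_0(u) = u,\ \deg_b d(u) \le n\}$ form a strictly ascending chain, and they contain $k$.\<close>

section \<open>Skew fields and their skew subfields\<close>

lemma (in skew_field) inv_nonzero:
  assumes "a \<in> carrier R" "a \<noteq> \<zero>"
  shows "inv a \<in> carrier R" "inv a \<otimes> a = \<one>" "a \<otimes> inv a = \<one>" "inv a \<noteq> \<zero>"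
proof -
  have "a \<in> Units R" using assms skew_field_Units by auto
  then show *: "inv a \<in> carrier R" "inv a \<otimes> a = \<one>" "a \<otimes> inv a = \<one>" by auto
  show "inv a \<noteq> \<zero>" using * one_not_zero assms by (metis r_null)
qed

lemma (in skew_field) integral:
  assumes "a \<in> carrier R" "b \<in> carrier R" "a \<otimes> b = \<zero>" "a \<noteq> \<zero>"
  shows "b = \<zero>"
  by (metis assms inv_nonzero(1,2) l_one m_assoc r_null)

lemma (in skew_field) inv_eqI:
  assumes "a \<in> carrier R" "b \<in> carrier R" "a \<otimes> b = \<one>"
  shows "inv a = b"
proof -
  have "a \<noteq> \<zero>" using assms one_not_zero by auto
  note i = inv_nonzero[OF assms(1) this]
  show ?thesis using i assms by (metis m_assoc l_one r_one)
qed

lemma skew_fieldI_right_inverse: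
  assumes "ring R" "\<one>\<^bsub>R\<^esub> \<noteq> \<zero>\<^bsub>R\<^esub>"
    and inv: "\<And>a. a \<in> carrier R \<Longrightarrow> a \<noteq> \<zero>\<^bsub>R\<^esub> \<Longrightarrow> \<exists>b\<in>carrier R. a \<otimes>\<^bsub>R\<^esub> b = \<one>\<^bsub>R\<^esub>"
  shows "skew_field R"
proof -
  interpret ring R by fact
  have "a \<in> Units R" if a: "a \<in> carrier R" "a \<noteq> \<zero>\<^bsub>R\<^esub>" for a
  proof -
    obtain b where b: "b \<in> carrier R" "a \<otimes>\<^bsub>R\<^esub> b = \<one>\<^bsub>R\<^esub>" using inv a by blast
    then have "b \<noteq> \<zero>\<^bsub>R\<^esub>" using assms(2) a by auto
    then obtain c where c: "c \<in> carrier R" "b \<otimes>\<^bsub>R\<^esub> c = \<one>\<^bsub>R\<^esub>" using inv b by blast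
    have "a = c" using a b c by (metis l_one m_assoc r_one)
    then show ?thesis using a b c by (auto simp: Units_def)
  qed
  moreover have "\<zero>\<^bsub>R\<^esub> \<notin> Units R" using assms(2) by (auto simp: Units_def)
  ultimately have "Units R = carrier R - {\<zero>\<^bsub>R\<^esub>}" by (auto simp: Units_def)
  then show ?thesis using assms by (intro skew_field.intro skew_field_axioms.intro)
qed

definition skew_subfield :: "'a set \<Rightarrow> ('a, 'm) ring_scheme \<Rightarrow> bool" where
  "skew_subfield E D \<longleftrightarrow> subring E D \<and> (\<forall>a\<in>E. a \<noteq> \<zero>\<^bsub>D\<^esub> \<longrightarrow> inv\<^bsub>D\<^esub> a \<in> E)"

lemma skew_subfieldD:
  assumes "skew_subfield E D"
  shows "E \<subseteq> carrier D" "\<zero>\<^bsub>D\<^esub> \<in> E" "\<one>\<^bsub>D\<^esub> \<in> E" "\<And>a. a \<in> E \<Longrightarrow> \<ominus>\<^bsub>D\<^esub> a \<in> E"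
    "\<And>a b. a \<in> E \<Longrightarrow> b \<in> E \<Longrightarrow> a \<otimes>\<^bsub>D\<^esub> b \<in> E" "\<And>a b. a \<in> E \<Longrightarrow> b \<in> E \<Longrightarrow> a \<oplus>\<^bsub>D\<^esub> b \<in> E"
    "\<And>a. a \<in> E \<Longrightarrow> a \<noteq> \<zero>\<^bsub>D\<^esub> \<Longrightarrow> inv\<^bsub>D\<^esub> a \<in> E"
  using assms subringE[of E D] by (auto simp: skew_subfield_def)

lemma (in skew_field) skew_subfield_imp_skew_field:
  assumes "skew_subfield E R"
  shows "skew_field (R\<lparr>carrier := E\<rparr>)"
proof (rule skew_fieldI_right_inverse)
  note E = skew_subfieldD[OF assms]
  show "ring (R\<lparr>carrier := E\<rparr>)" using assms subring_iff[OF E(1)] by (auto simp: skew_subfield_def)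
  show "\<one>\<^bsub>R\<lparr>carrier := E\<rparr>\<^esub> \<noteq> \<zero>\<^bsub>R\<lparr>carrier := E\<rparr>\<^esub>" using one_not_zero by simp
  show "\<exists>b\<in>carrier (R\<lparr>carrier := E\<rparr>). a \<otimes>\<^bsub>R\<lparr>carrier := E\<rparr>\<^esub> b = \<one>\<^bsub>R\<lparr>carrier := E\<rparr>\<^esub>"
    if "a \<in> carrier (R\<lparr>carrier := E\<rparr>)" "a \<noteq> \<zero>\<^bsub>R\<lparr>carrier := E\<rparr>\<^esub>" for a
    using that E inv_nonzero[of a] by (intro bexI[of _ "inv a"]) auto
qed

lemma (in skew_field) generate_field_skew_subfield:
  assumes H: "H \<subseteq> carrier R"
  shows "skew_subfield (generate_field R H) R"
proof -
  have sub: "x \<in> carrier R" if "x \<in> generate_field R H" for x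
    using that by (induction rule: generate_field.induct) (use H inv_nonzero(1) in auto)
  show ?thesis
    unfolding skew_subfield_def
    by (intro conjI subringI) (auto intro: sub generate_field.intros)
qed

lemma generate_field_least:
  assumes "skew_subfield E R" "H \<subseteq> E"
  shows "generate_field R H \<subseteq> E"
proof
  fix x assume "x \<in> generate_field R H"
  then show "x \<in> E"
    by (induction rule: generate_field.induct) (use assms(2) skew_subfieldD[OF assms(1)] in auto)
qed

lemma ring_hom_skew_field_inv:
  assumes K: "skew_field K" and L: "skew_field L" and h: "h \<in> ring_hom K L"
    and a: "a \<in> carrier K" "a \<noteq> \<zero>\<^bsub>K\<^esub>"
  shows "h (inv\<^bsub>K\<^esub> a) = inv\<^bsub>L\<^esub> (h a)" "h a \<noteq> \<zero>\<^bsub>L\<^esub>"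
proof -
  interpret K: skew_field K by fact
  interpret L: skew_field L by fact
  interpret h: ring_hom_ring K L h by (intro ring_hom_ringI2 h K.ring_axioms L.ring_axioms)
  note i = K.inv_nonzero[OF a]
  have e: "h a \<otimes>\<^bsub>L\<^esub> h (inv\<^bsub>K\<^esub> a) = \<one>\<^bsub>L\<^esub>" using a i by (metis h.hom_mult h.hom_one)
  show "h (inv\<^bsub>K\<^esub> a) = inv\<^bsub>L\<^esub> (h a)" using L.inv_eqI[OF _ _ e] a i by simp
  show "h a \<noteq> \<zero>\<^bsub>L\<^esub>" using e L.one_not_zero i by auto
qed

lemma ring_hom_skew_field_inj:
  assumes K: "skew_field K" and L: "skew_field L" and h: "h \<in> ring_hom K L"
  shows "inj_on h (carrier K)"
proof (rule inj_onI)
  interpret K: skew_field K by fact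
  interpret L: skew_field L by fact
  interpret h: ring_hom_ring K L h by (intro ring_hom_ringI2 h K.ring_axioms L.ring_axioms)
  fix a b assume ab: "a \<in> carrier K" "b \<in> carrier K" "h a = h b"
  have "h (a \<ominus>\<^bsub>K\<^esub> b) = \<zero>\<^bsub>L\<^esub>" using ab by (simp add: K.minus_eq L.r_neg)
  then have "a \<ominus>\<^bsub>K\<^esub> b = \<zero>\<^bsub>K\<^esub>" using ring_hom_skew_field_inv(2)[OF K L h] ab by blast
  then show "a = b" using ab by simp
qed

lemma skew_subfield_image:
  assumes U: "skew_field U" and D: "skew_field D" and \<phi>: "\<phi> \<in> ring_hom U D" and E: "skew_subfield E U"
  shows "skew_subfield (\<phi> ` E) D"
proof -
  interpret U: skew_field U by fact
  interpret D: skew_field D by fact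
  interpret \<phi>: ring_hom_ring U D \<phi> by (intro ring_hom_ringI2 U.ring_axioms D.ring_axioms \<phi>)
  note e = skew_subfieldD[OF E]
  have sub: "\<phi> ` E \<subseteq> carrier D" using e(1) by auto
  show ?thesis
    unfolding skew_subfield_def
  proof (intro conjI ballI impI D.subringI sub)
    show "\<one>\<^bsub>D\<^esub> \<in> \<phi> ` E" using e(3) \<phi>.hom_one by (metis imageI)
  next
    fix a assume "a \<in> \<phi> ` E"
    then obtain u where u: "u \<in> E" "a = \<phi> u" by auto
    then have uU: "u \<in> carrier U" using e(1) by auto
    show "\<ominus>\<^bsub>D\<^esub> a \<in> \<phi> ` E" using u uU e(4) by (metis \<phi>.hom_a_inv imageI)
    show "inv\<^bsub>D\<^esub> a \<in> \<phi> ` E" if "a \<noteq> \<zero>\<^bsub>D\<^esub>"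
    proof -
      have "u \<noteq> \<zero>\<^bsub>U\<^esub>" using that u by auto
      then show ?thesis using ring_hom_skew_field_inv(1)[OF U D \<phi> uU] u e(7) by (metis imageI)
    qed
    fix b assume "b \<in> \<phi> ` E"
    then obtain v where v: "v \<in> E" "b = \<phi> v" by auto
    then have vU: "v \<in> carrier U" using e(1) by auto
    show "a \<otimes>\<^bsub>D\<^esub> b \<in> \<phi> ` E" using u v uU vU e(5) by (metis \<phi>.hom_mult imageI)
    show "a \<oplus>\<^bsub>D\<^esub> b \<in> \<phi> ` E" using u v uU vU e(6) by (metis \<phi>.hom_add imageI)
  qed
qed

lemma skew_field_ring_iso:
  assumes K: "skew_field K" and "ring K'" and h: "h \<in> ring_iso K K'"
  shows "skew_field K'"
proof -
  interpret K: skew_field K by fact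
  interpret K': ring K' by fact
  have hom: "h \<in> ring_hom K K'" and im: "h ` carrier K = carrier K'" and inj: "inj_on h (carrier K)"
    using h by (auto simp: ring_iso_def bij_betw_def)
  interpret h: ring_hom_ring K K' h by (intro ring_hom_ringI2 hom K.ring_axioms K'.ring_axioms)
  show ?thesis
  proof (rule skew_fieldI_right_inverse[OF K'.ring_axioms])
    show "\<one>\<^bsub>K'\<^esub> \<noteq> \<zero>\<^bsub>K'\<^esub>"
      using inj_onD[OF inj, of "\<one>\<^bsub>K\<^esub>" "\<zero>\<^bsub>K\<^esub>"] K.one_not_zero by auto
    fix a assume a: "a \<in> carrier K'" "a \<noteq> \<zero>\<^bsub>K'\<^esub>"
    then obtain b where b: "b \<in> carrier K" "a = h b" using im by blast
    then have "b \<noteq> \<zero>\<^bsub>K\<^esub>" using a by auto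
    note i = K.inv_nonzero[OF b(1) this]
    have "a \<otimes>\<^bsub>K'\<^esub> h (inv\<^bsub>K\<^esub> b) = \<one>\<^bsub>K'\<^esub>"
      unfolding b(2) using b i by (metis h.hom_mult h.hom_one)
    then show "\<exists>c\<in>carrier K'. a \<otimes>\<^bsub>K'\<^esub> c = \<one>\<^bsub>K'\<^esub>" using i by (intro bexI[of _ "h (inv\<^bsub>K\<^esub> b)"]) auto
  qed
qed

section \<open>Left ideals and quotients\<close>

lemma additive_subgroupI_ring:
  assumes "ring R" "I \<subseteq> carrier R" "\<zero>\<^bsub>R\<^esub> \<in> I"
    and "\<And>a b. a \<in> I \<Longrightarrow> b \<in> I \<Longrightarrow> a \<oplus>\<^bsub>R\<^esub> b \<in> I" "\<And>a. a \<in> I \<Longrightarrow> \<ominus>\<^bsub>R\<^esub> a \<in> I"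
  shows "additive_subgroup I R"
proof -
  interpret ring R by fact
  show ?thesis
    by (rule additive_subgroup.intro, rule add.subgroupI) (use assms in \<open>auto simp: a_inv_def\<close>)
qed

lemma left_idealI:
  assumes "ring R" "I \<subseteq> carrier R" "\<zero>\<^bsub>R\<^esub> \<in> I"
    and add: "\<And>a b. a \<in> I \<Longrightarrow> b \<in> I \<Longrightarrow> a \<oplus>\<^bsub>R\<^esub> b \<in> I"
    and mult: "\<And>a x. a \<in> I \<Longrightarrow> x \<in> carrier R \<Longrightarrow> x \<otimes>\<^bsub>R\<^esub> a \<in> I"
  shows "left_ideal I R"
proof -
  interpret ring R by fact
  have "\<ominus>\<^bsub>R\<^esub> a \<in> I" if "a \<in> I" for a
    using mult[OF that, of "\<ominus>\<^bsub>R\<^esub> \<one>\<^bsub>R\<^esub>"] that assms(2) by (auto simp: l_minus)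
  then show ?thesis
    using assms by (intro left_ideal.intro left_ideal_axioms.intro additive_subgroupI_ring ring_axioms) auto
qed

text \<open>The finitely many generators of the union of the chain already lie in one member.\<close>

lemma left_noetherian_ascending_chain:
  assumes R: "ring R" and noeth: "left_noetherian R"
    and J: "\<And>n. left_ideal (J n) R" and asc: "\<And>n. J n \<subseteq> J (Suc n)"
  shows "\<exists>n. J (Suc n) = J n"
proof -
  have mono: "J m \<subseteq> J n" if "m \<le> n" for m n
    by (rule lift_Suc_mono_le[of J]) (use asc that in auto)
  have sub: "J n \<subseteq> carrier R" "\<zero>\<^bsub>R\<^esub> \<in> J n" for n
    using additive_subgroup.a_subset[OF left_ideal.axioms(1)[OF J]]
      additive_subgroup.zero_closed[OF left_ideal.axioms(1)[OF J]] by auto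
  have add: "a \<oplus>\<^bsub>R\<^esub> b \<in> J n" if "a \<in> J n" "b \<in> J n" for a b n
    by (rule additive_subgroup.a_closed[OF left_ideal.axioms(1)[OF J] that])
  define I where "I = (\<Union>n. J n)"
  have "left_ideal I R"
  proof (rule left_idealI[OF R])
    fix a b assume "a \<in> I" "b \<in> I"
    then obtain m n where "a \<in> J m" "b \<in> J n" by (auto simp: I_def)
    then have "a \<in> J (max m n)" "b \<in> J (max m n)" using mono[of m "max m n"] mono[of n "max m n"] by auto
    then show "a \<oplus>\<^bsub>R\<^esub> b \<in> I" using add by (auto simp: I_def)
  next
    show "x \<otimes>\<^bsub>R\<^esub> a \<in> I" if "a \<in> I" "x \<in> carrier R" for a x
      using that left_ideal.I_l_closed[OF J] by (auto simp: I_def)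
  qed (use sub in \<open>auto simp: I_def\<close>)
  then obtain A where A: "finite A" "A \<subseteq> carrier R" "I = left_ideal_generated R A"
    using noeth by (auto simp: left_noetherian_def)
  then have "A \<subseteq> I" by (auto simp: left_ideal_generated_def)
  with \<open>finite A\<close> have "\<exists>n. A \<subseteq> J n"
  proof (induction A rule: finite_induct)
    case (insert a A)
    then obtain m n where "A \<subseteq> J m" "a \<in> J n" by (auto simp: I_def)
    then show ?case using mono[of m "max m n"] mono[of n "max m n"] by (intro exI[of _ "max m n"]) auto
  qed auto
  then obtain n where "A \<subseteq> J n" by auto
  then have "I \<subseteq> J n" unfolding A(3) left_ideal_generated_def using J by blast
  then have "J (Suc n) = J n" using asc[of n] by (auto simp: I_def)
  then show ?thesis ..
qed

lemma ring_hom_quotient: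
  assumes h: "ring_hom_ring P S h" and I: "ideal I P" and ker: "\<And>p. p \<in> I \<Longrightarrow> h p = \<zero>\<^bsub>S\<^esub>"
  shows "\<exists>\<Theta>\<in>ring_hom (P Quot I) S. \<forall>p\<in>carrier P. \<Theta> (I +>\<^bsub>P\<^esub> p) = h p"
proof -
  interpret ring_hom_ring P S h by fact
  interpret I: ideal I P by fact
  have im: "h ` (I +>\<^bsub>P\<^esub> p) = {h p}" if p: "p \<in> carrier P" for p
  proof -
    have "h q = h p" if "q \<in> I +>\<^bsub>P\<^esub> p" for q
      using that p ker I.a_Hcarr by (auto simp: a_r_coset_def')
    moreover have "p \<in> I +>\<^bsub>P\<^esub> p" by (rule I.a_rcos_self[OF p])
    ultimately show ?thesis by blast
  qed
  define \<Theta> where "\<Theta> X = the_elem (h ` X)" for X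
  have eq: "\<Theta> (I +>\<^bsub>P\<^esub> p) = h p" if "p \<in> carrier P" for p
    by (simp add: \<Theta>_def im that)
  have "\<Theta> \<in> ring_hom (P Quot I) S"
  proof (rule ring_hom_memI)
    fix X assume "X \<in> carrier (P Quot I)"
    then obtain p where p: "p \<in> carrier P" "X = I +>\<^bsub>P\<^esub> p" by (auto simp: FactRing_def A_RCOSETS_def')
    then show "\<Theta> X \<in> carrier S" by (simp add: eq)
    fix Y assume "Y \<in> carrier (P Quot I)"
    then obtain q where q: "q \<in> carrier P" "Y = I +>\<^bsub>P\<^esub> q" by (auto simp: FactRing_def A_RCOSETS_def')
    show "\<Theta> (X \<otimes>\<^bsub>P Quot I\<^esub> Y) = \<Theta> X \<otimes>\<^bsub>S\<^esub> \<Theta> Y" "\<Theta> (X \<oplus>\<^bsub>P Quot I\<^esub> Y) = \<Theta> X \<oplus>\<^bsub>S\<^esub> \<Theta> Y"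
      using p q by (simp_all add: FactRing_def I.rcoset_mult_add I.a_rcos_sum eq)
  qed (simp add: FactRing_def eq)
  then show ?thesis using eq by blast
qed

section \<open>Homomorphisms from monoid rings and free algebras\<close>

definition monoid_ring_eval :: "('c, 'f) ring_scheme \<Rightarrow> ('s, 'n) ring_scheme \<Rightarrow> ('c \<Rightarrow> 's) \<Rightarrow> ('w \<Rightarrow> 's) \<Rightarrow> ('w \<Rightarrow> 'c) \<Rightarrow> 's" where
  "monoid_ring_eval F S \<kappa> \<rho> p = (\<Oplus>\<^bsub>S\<^esub>m\<in>{m. p m \<noteq> \<zero>\<^bsub>F\<^esub>}. \<kappa> (p m) \<otimes>\<^bsub>S\<^esub> \<rho> m)"

locale monoid_ring_evaluation = monoid_ring_context F M + S: ring S + \<kappa>: ring_hom_ring F S \<kappa>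
  for F (structure) and M (structure) and S (structure) and \<kappa> +
  fixes \<rho> :: "_ \<Rightarrow> _"
  assumes \<rho>_closed: "m \<in> carrier M \<Longrightarrow> \<rho> m \<in> carrier S"
    and \<rho>_one: "\<rho> \<one>\<^bsub>M\<^esub> = \<one>\<^bsub>S\<^esub>"
    and \<rho>_mult: "m \<in> carrier M \<Longrightarrow> n \<in> carrier M \<Longrightarrow> \<rho> (m \<otimes>\<^bsub>M\<^esub> n) = \<rho> m \<otimes>\<^bsub>S\<^esub> \<rho> n"
    and \<kappa>_commute: "c \<in> carrier F \<Longrightarrow> m \<in> carrier M \<Longrightarrow> \<kappa> c \<otimes>\<^bsub>S\<^esub> \<rho> m = \<rho> m \<otimes>\<^bsub>S\<^esub> \<kappa> c"
begin

abbreviation "ev \<equiv> monoid_ring_eval F S \<kappa> \<rho>"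

lemma ev_alt:
  assumes "p \<in> carrier P" "finite A" "{m. p m \<noteq> \<zero>\<^bsub>F\<^esub>} \<subseteq> A" "A \<subseteq> carrier M"
  shows "ev p = (\<Oplus>\<^bsub>S\<^esub>m\<in>A. \<kappa> (p m) \<otimes>\<^bsub>S\<^esub> \<rho> m)"
  unfolding monoid_ring_eval_def
  by (rule S.add.finprod_mono_neutral_cong_left) (use assms \<rho>_closed in auto)

lemma ev_monomial:
  assumes "c \<in> carrier F" "m \<in> carrier M"
  shows "ev (monomial F c m) = \<kappa> c \<otimes>\<^bsub>S\<^esub> \<rho> m"
proof -
  have "ev (monomial F c m) = (\<Oplus>\<^bsub>S\<^esub>n\<in>{m}. \<kappa> (monomial F c m n) \<otimes>\<^bsub>S\<^esub> \<rho> n)"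
    using assms by (intro ev_alt monomial_closed) (auto simp: monomial_def)
  then show ?thesis using assms \<rho>_closed by (simp add: monomial_def)
qed

lemma ev_hom: "ev \<in> ring_hom P S"
proof (rule ring_hom_memI)
  fix p assume p: "p \<in> carrier P"
  define A where "A = {m. p m \<noteq> \<zero>\<^bsub>F\<^esub>}"
  have A: "finite A" "A \<subseteq> carrier M" using mr_finite[OF p] mr_supp[OF p] by (auto simp: A_def)
  have evp: "ev p = (\<Oplus>\<^bsub>S\<^esub>m\<in>A. \<kappa> (p m) \<otimes>\<^bsub>S\<^esub> \<rho> m)" by (rule ev_alt) (use p A in \<open>auto simp: A_def\<close>)
  show "ev p \<in> carrier S" unfolding evp using A p \<rho>_closed by (intro S.finsum_closed) auto
  fix q assume q: "q \<in> carrier P"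
  define B where "B = {m. q m \<noteq> \<zero>\<^bsub>F\<^esub>}"
  have B: "finite B" "B \<subseteq> carrier M" using mr_finite[OF q] mr_supp[OF q] by (auto simp: B_def)
  have evq: "ev q = (\<Oplus>\<^bsub>S\<^esub>m\<in>B. \<kappa> (q m) \<otimes>\<^bsub>S\<^esub> \<rho> m)" by (rule ev_alt) (use q B in \<open>auto simp: B_def\<close>)
  show "ev (p \<oplus>\<^bsub>P\<^esub> q) = ev p \<oplus>\<^bsub>S\<^esub> ev q"
  proof -
    let ?C = "A \<union> B"
    have "ev (p \<oplus>\<^bsub>P\<^esub> q) = (\<Oplus>\<^bsub>S\<^esub>m\<in>?C. \<kappa> ((p \<oplus>\<^bsub>P\<^esub> q) m) \<otimes>\<^bsub>S\<^esub> \<rho> m)"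
      using A B p q by (intro ev_alt add_closed) (auto simp: A_def B_def add_simp)
    also have "\<dots> = (\<Oplus>\<^bsub>S\<^esub>m\<in>?C. \<kappa> (p m) \<otimes>\<^bsub>S\<^esub> \<rho> m \<oplus>\<^bsub>S\<^esub> \<kappa> (q m) \<otimes>\<^bsub>S\<^esub> \<rho> m)"
      using A B p q \<rho>_closed by (intro S.finsum_cong') (auto simp: add_simp S.l_distr)
    also have "\<dots> = (\<Oplus>\<^bsub>S\<^esub>m\<in>?C. \<kappa> (p m) \<otimes>\<^bsub>S\<^esub> \<rho> m) \<oplus>\<^bsub>S\<^esub> (\<Oplus>\<^bsub>S\<^esub>m\<in>?C. \<kappa> (q m) \<otimes>\<^bsub>S\<^esub> \<rho> m)"
      using A B p q \<rho>_closed by (intro S.finsum_addf) auto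
    also have "\<dots> = ev p \<oplus>\<^bsub>S\<^esub> ev q"
      using A B p q by (subst (1 2) ev_alt[where A = ?C]) (auto simp: A_def B_def)
    finally show ?thesis .
  qed
  show "ev (p \<otimes>\<^bsub>P\<^esub> q) = ev p \<otimes>\<^bsub>S\<^esub> ev q"
  proof -
    define C where "C = (\<lambda>(u, v). u \<otimes>\<^bsub>M\<^esub> v) ` (A \<times> B) \<union> {m. (p \<otimes>\<^bsub>P\<^esub> q) m \<noteq> \<zero>\<^bsub>F\<^esub>}"
    have C: "finite C" "C \<subseteq> carrier M"
      using A B mr_finite[OF mult_closed[OF p q]] mr_supp[OF mult_closed[OF p q]] by (auto simp: C_def)
    let ?t = "\<lambda>u v. (\<kappa> (p u) \<otimes>\<^bsub>S\<^esub> \<rho> u) \<otimes>\<^bsub>S\<^esub> (\<kappa> (q v) \<otimes>\<^bsub>S\<^esub> \<rho> v)"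
    have t: "?t u v \<in> carrier S" if "u \<in> A" "v \<in> B" for u v
      using that A B p q \<rho>_closed by (intro S.m_closed) auto
    have "ev (p \<otimes>\<^bsub>P\<^esub> q) = (\<Oplus>\<^bsub>S\<^esub>m\<in>C. \<kappa> ((p \<otimes>\<^bsub>P\<^esub> q) m) \<otimes>\<^bsub>S\<^esub> \<rho> m)"
      using C p q by (intro ev_alt mult_closed) (auto simp: C_def)
    also have "\<dots> = (\<Oplus>\<^bsub>S\<^esub>m\<in>C. \<Oplus>\<^bsub>S\<^esub>u\<in>A. \<Oplus>\<^bsub>S\<^esub>v\<in>B. if m = u \<otimes>\<^bsub>M\<^esub> v then ?t u v else \<zero>\<^bsub>S\<^esub>)"
    proof (rule S.finsum_cong'[OF refl])
      fix m assume m: "m \<in> C"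
      have "(p \<otimes>\<^bsub>P\<^esub> q) m = (\<Oplus>\<^bsub>F\<^esub>u\<in>A. \<Oplus>\<^bsub>F\<^esub>v\<in>B. if u \<otimes>\<^bsub>M\<^esub> v = m then p u \<otimes>\<^bsub>F\<^esub> q v else \<zero>\<^bsub>F\<^esub>)"
        by (rule mult_alt) (use A B p q in \<open>auto simp: A_def B_def\<close>)
      then have "\<kappa> ((p \<otimes>\<^bsub>P\<^esub> q) m) = \<kappa> (\<Oplus>\<^bsub>F\<^esub>u\<in>A. \<Oplus>\<^bsub>F\<^esub>v\<in>B. if u \<otimes>\<^bsub>M\<^esub> v = m then p u \<otimes>\<^bsub>F\<^esub> q v else \<zero>\<^bsub>F\<^esub>)"
        by simp
      also have "\<dots> = (\<Oplus>\<^bsub>S\<^esub>u\<in>A. \<kappa> (\<Oplus>\<^bsub>F\<^esub>v\<in>B. if u \<otimes>\<^bsub>M\<^esub> v = m then p u \<otimes>\<^bsub>F\<^esub> q v else \<zero>\<^bsub>F\<^esub>))"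
        by (subst \<kappa>.hom_finsum) (use p q in \<open>auto simp: comp_def intro!: F.finsum_closed\<close>)
      also have "\<dots> = (\<Oplus>\<^bsub>S\<^esub>u\<in>A. \<Oplus>\<^bsub>S\<^esub>v\<in>B. \<kappa> (if u \<otimes>\<^bsub>M\<^esub> v = m then p u \<otimes>\<^bsub>F\<^esub> q v else \<zero>\<^bsub>F\<^esub>))"
      proof (rule S.finsum_cong'[OF refl])
        show "\<kappa> (\<Oplus>\<^bsub>F\<^esub>v\<in>B. if u \<otimes>\<^bsub>M\<^esub> v = m then p u \<otimes>\<^bsub>F\<^esub> q v else \<zero>\<^bsub>F\<^esub>)
          = (\<Oplus>\<^bsub>S\<^esub>v\<in>B. \<kappa> (if u \<otimes>\<^bsub>M\<^esub> v = m then p u \<otimes>\<^bsub>F\<^esub> q v else \<zero>\<^bsub>F\<^esub>))" for u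
          by (subst \<kappa>.hom_finsum) (use p q in \<open>auto simp: comp_def\<close>)
      qed (use p q in \<open>auto intro!: S.finsum_closed\<close>)
      finally have "\<kappa> ((p \<otimes>\<^bsub>P\<^esub> q) m) \<otimes>\<^bsub>S\<^esub> \<rho> m
         = (\<Oplus>\<^bsub>S\<^esub>u\<in>A. \<Oplus>\<^bsub>S\<^esub>v\<in>B. \<kappa> (if u \<otimes>\<^bsub>M\<^esub> v = m then p u \<otimes>\<^bsub>F\<^esub> q v else \<zero>\<^bsub>F\<^esub>)) \<otimes>\<^bsub>S\<^esub> \<rho> m"
        by simp
      also have "\<dots> = (\<Oplus>\<^bsub>S\<^esub>u\<in>A. \<Oplus>\<^bsub>S\<^esub>v\<in>B. \<kappa> (if u \<otimes>\<^bsub>M\<^esub> v = m then p u \<otimes>\<^bsub>F\<^esub> q v else \<zero>\<^bsub>F\<^esub>) \<otimes>\<^bsub>S\<^esub> \<rho> m)"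
        using A B C m p q \<rho>_closed by (intro S.finsum_distr2) auto
      also have "\<dots> = (\<Oplus>\<^bsub>S\<^esub>u\<in>A. \<Oplus>\<^bsub>S\<^esub>v\<in>B. if m = u \<otimes>\<^bsub>M\<^esub> v then ?t u v else \<zero>\<^bsub>S\<^esub>)"
      proof (rule S.finsum_cong2)
        fix u v assume uv: "u \<in> A" "v \<in> B"
        have c: "u \<in> carrier M" "v \<in> carrier M" using uv A B by auto
        note r = c[THEN \<rho>_closed]
        have k: "\<kappa> (p u) \<in> carrier S" "\<kappa> (q v) \<in> carrier S" using p q by auto
        have "(\<kappa> (p u) \<otimes>\<^bsub>S\<^esub> \<kappa> (q v)) \<otimes>\<^bsub>S\<^esub> (\<rho> u \<otimes>\<^bsub>S\<^esub> \<rho> v) = \<kappa> (p u) \<otimes>\<^bsub>S\<^esub> (\<kappa> (q v) \<otimes>\<^bsub>S\<^esub> \<rho> u) \<otimes>\<^bsub>S\<^esub> \<rho> v"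
          using k r by (simp add: S.m_assoc)
        also have "\<dots> = ?t u v" unfolding \<kappa>_commute[OF mr_closed[OF q] c(1)] using k r by (simp add: S.m_assoc)
        finally have "(\<kappa> (p u) \<otimes>\<^bsub>S\<^esub> \<kappa> (q v)) \<otimes>\<^bsub>S\<^esub> (\<rho> u \<otimes>\<^bsub>S\<^esub> \<rho> v) = ?t u v" .
        then show "\<kappa> (if u \<otimes>\<^bsub>M\<^esub> v = m then p u \<otimes>\<^bsub>F\<^esub> q v else \<zero>\<^bsub>F\<^esub>) \<otimes>\<^bsub>S\<^esub> \<rho> m
           = (if m = u \<otimes>\<^bsub>M\<^esub> v then ?t u v else \<zero>\<^bsub>S\<^esub>)"
          using p q c C m \<rho>_closed[of m] by (auto simp: \<rho>_mult)
      qed (use t in auto)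
      finally show "\<kappa> ((p \<otimes>\<^bsub>P\<^esub> q) m) \<otimes>\<^bsub>S\<^esub> \<rho> m
          = (\<Oplus>\<^bsub>S\<^esub>u\<in>A. \<Oplus>\<^bsub>S\<^esub>v\<in>B. if m = u \<otimes>\<^bsub>M\<^esub> v then ?t u v else \<zero>\<^bsub>S\<^esub>)" .
    qed (use t in \<open>auto intro!: S.finsum_closed\<close>)
    also have "\<dots> = (\<Oplus>\<^bsub>S\<^esub>u\<in>A. \<Oplus>\<^bsub>S\<^esub>v\<in>B. \<Oplus>\<^bsub>S\<^esub>m\<in>C. if m = u \<otimes>\<^bsub>M\<^esub> v then ?t u v else \<zero>\<^bsub>S\<^esub>)"
      using A B C t by (intro S.finsum_swap3) auto
    also have "\<dots> = (\<Oplus>\<^bsub>S\<^esub>u\<in>A. \<Oplus>\<^bsub>S\<^esub>v\<in>B. ?t u v)"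
    proof (rule S.finsum_cong2)
      fix u v assume "u \<in> A" "v \<in> B"
      then show "(\<Oplus>\<^bsub>S\<^esub>m\<in>C. if m = u \<otimes>\<^bsub>M\<^esub> v then ?t u v else \<zero>\<^bsub>S\<^esub>) = ?t u v"
        using C t by (intro S.add.finprod_singleton_swap) (auto simp: C_def)
    qed (use t in auto)
    also have "\<dots> = (\<Oplus>\<^bsub>S\<^esub>u\<in>A. \<kappa> (p u) \<otimes>\<^bsub>S\<^esub> \<rho> u \<otimes>\<^bsub>S\<^esub> ev q)"
    proof (rule S.finsum_cong'[OF refl])
      show "(\<Oplus>\<^bsub>S\<^esub>v\<in>B. ?t u v) = \<kappa> (p u) \<otimes>\<^bsub>S\<^esub> \<rho> u \<otimes>\<^bsub>S\<^esub> ev q" if "u \<in> A" for u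
        unfolding evq using that A B p q \<rho>_closed by (intro S.finsum_rdistr[symmetric]) auto
    next
      have "ev q \<in> carrier S" unfolding evq using B q \<rho>_closed by (intro S.finsum_closed) auto
      then show "(\<lambda>u. \<kappa> (p u) \<otimes>\<^bsub>S\<^esub> \<rho> u \<otimes>\<^bsub>S\<^esub> ev q) \<in> A \<rightarrow> carrier S"
        using A p \<rho>_closed by auto
    qed
    also have "\<dots> = ev p \<otimes>\<^bsub>S\<^esub> ev q"
    proof -
      have "ev q \<in> carrier S" unfolding evq using B q \<rho>_closed by (intro S.finsum_closed) auto
      then show ?thesis unfolding evp using A p \<rho>_closed by (intro S.finsum_ldistr[symmetric]) auto
    qed
    finally show ?thesis .
  qed
next
  show "ev \<one>\<^bsub>P\<^esub> = \<one>\<^bsub>S\<^esub>" by (simp add: one_eq ev_monomial \<rho>_one)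
qed

end

lemma (in monoid_ring_context) sum_of_monomials:
  assumes p: "p \<in> carrier P"
  shows "p = (\<Oplus>\<^bsub>P\<^esub>m\<in>{m. p m \<noteq> \<zero>\<^bsub>F\<^esub>}. monomial F (p m) m)"
proof
  interpret P: ring P by (rule monoid_ring_ring)
  let ?A = "{m. p m \<noteq> \<zero>\<^bsub>F\<^esub>}"
  have fin: "finite ?A" and sub: "?A \<subseteq> carrier M" using mr_finite[OF p] mr_supp[OF p] by auto
  fix n
  have "(\<Oplus>\<^bsub>P\<^esub>m\<in>A. monomial F (p m) m) n = (\<Oplus>\<^bsub>F\<^esub>m\<in>A. monomial F (p m) m n)"
    if "finite A" "A \<subseteq> carrier M" for A
    using that
  proof (induction A rule: finite_induct)
    case (insert a A)
    have c: "monomial F (p m) m \<in> carrier P" if "m \<in> carrier M" for m using p that by (intro monomial_closed) auto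
    have c': "monomial F (p m) m n \<in> carrier F" for m using p by (auto simp: monomial_def)
    have s: "(\<Oplus>\<^bsub>P\<^esub>m\<in>insert a A. monomial F (p m) m) = monomial F (p a) a \<oplus>\<^bsub>P\<^esub> (\<Oplus>\<^bsub>P\<^esub>m\<in>A. monomial F (p m) m)"
      using insert c by (intro P.finsum_insert) auto
    have "(\<Oplus>\<^bsub>F\<^esub>m\<in>insert a A. monomial F (p m) m n) = monomial F (p a) a n \<oplus>\<^bsub>F\<^esub> (\<Oplus>\<^bsub>F\<^esub>m\<in>A. monomial F (p m) m n)"
      using insert c' by (intro F.finsum_insert) auto
    then show ?case using insert unfolding s by (simp add: add_simp)
  qed (simp add: zero_simp)
  from this[OF fin sub] have "(\<Oplus>\<^bsub>P\<^esub>m\<in>?A. monomial F (p m) m) n = (\<Oplus>\<^bsub>F\<^esub>m\<in>?A. if n = m then p m else \<zero>\<^bsub>F\<^esub>)"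
    by (simp add: monomial_def)
  also have "\<dots> = p n"
  proof (cases "p n = \<zero>\<^bsub>F\<^esub>")
    case True
    then show ?thesis by (intro F.add.finprod_one_eqI[THEN trans]) auto
  next
    case False
    then show ?thesis using fin p by (intro F.add.finprod_singleton) auto
  qed
  finally show "p n = (\<Oplus>\<^bsub>P\<^esub>m\<in>?A. monomial F (p m) m) n" ..
qed

lemma (in monoid_ring_context) monoid_ring_hom_eqI:
  assumes S: "ring S" and h: "h \<in> ring_hom P S" and h': "h' \<in> ring_hom P S"
    and eq: "\<And>c m. c \<in> carrier F \<Longrightarrow> m \<in> carrier M \<Longrightarrow> h (monomial F c m) = h' (monomial F c m)"
    and p: "p \<in> carrier P"
  shows "h p = h' p"
proof -
  interpret P: ring P by (rule monoid_ring_ring)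
  interpret h: ring_hom_ring P S h by (intro ring_hom_ringI2 P.ring_axioms S h)
  interpret h': ring_hom_ring P S h' by (intro ring_hom_ringI2 P.ring_axioms S h')
  let ?A = "{m. p m \<noteq> \<zero>\<^bsub>F\<^esub>}"
  have c: "monomial F (p m) m \<in> carrier P" if "m \<in> ?A" for m
    using mr_supp[OF p] that p by (intro monomial_closed) auto
  have hs: "h p = (\<Oplus>\<^bsub>S\<^esub>m\<in>?A. h (monomial F (p m) m))"
    by (subst sum_of_monomials[OF p], subst h.hom_finsum) (use c in \<open>auto simp: comp_def\<close>)
  have hs': "h' p = (\<Oplus>\<^bsub>S\<^esub>m\<in>?A. h' (monomial F (p m) m))"
    by (subst sum_of_monomials[OF p], subst h'.hom_finsum) (use c in \<open>auto simp: comp_def\<close>)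
  show ?thesis unfolding hs hs'
    using mr_supp[OF p] p c by (intro h.S.finsum_cong' refl eq) auto
qed

lemma word_monoid_simps [simp]:
  "carrier (word_monoid X) = lists X" "u \<otimes>\<^bsub>word_monoid X\<^esub> v = u @ v" "\<one>\<^bsub>word_monoid X\<^esub> = []"
  by (simp_all add: word_monoid_def)

lemma word_monoid_context: "ring F \<Longrightarrow> monoid_ring_context F (word_monoid X)"
  by (intro monoid_ring_context.intro monoidI) auto

lemma free_algebra_hom_eqI:
  assumes F: "ring F" and S: "ring S"
    and h: "h \<in> ring_hom (free_algebra F X) S" and h': "h' \<in> ring_hom (free_algebra F X) S"
    and const: "\<And>c. c \<in> carrier F \<Longrightarrow> h (free_algebra_const F c) = h' (free_algebra_const F c)"
    and gen: "\<And>a. a \<in> X \<Longrightarrow> h (monomial F \<one>\<^bsub>F\<^esub> [a]) = h' (monomial F \<one>\<^bsub>F\<^esub> [a])"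
    and p: "p \<in> carrier (free_algebra F X)"
  shows "h p = h' p"
proof -
  interpret monoid_ring_context F "word_monoid X" by (rule word_monoid_context[OF F])
  have word: "h (monomial F \<one>\<^bsub>F\<^esub> w) = h' (monomial F \<one>\<^bsub>F\<^esub> w)" if "w \<in> lists X" for w
    using that
  proof (induction w)
    case Nil
    then show ?case using const[of "\<one>\<^bsub>F\<^esub>"] by (simp add: free_algebra_const_def)
  next
    case (Cons a w)
    have "monomial F \<one>\<^bsub>F\<^esub> (a # w) = monomial F \<one>\<^bsub>F\<^esub> [a] \<otimes>\<^bsub>P\<^esub> monomial F \<one>\<^bsub>F\<^esub> w"
      using Cons by (subst monomial_mult) auto
    then show ?case
      using Cons gen h h' unfolding free_algebra_def by (simp add: ring_hom_mult monomial_closed)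
  qed
  show ?thesis
  proof (rule monoid_ring_hom_eqI[OF S])
    fix c w assume cw: "c \<in> carrier F" "w \<in> carrier (word_monoid X)"
    have "monomial F c w = free_algebra_const F c \<otimes>\<^bsub>P\<^esub> monomial F \<one>\<^bsub>F\<^esub> w"
      using cw unfolding free_algebra_const_def by (subst monomial_mult) auto
    then show "h (monomial F c w) = h' (monomial F c w)"
      using cw const[OF cw(1)] word[of w] h h' monomial_closed[of c "[]"]
      unfolding free_algebra_def by (simp add: ring_hom_mult monomial_closed free_algebra_const_def)
  qed (use h h' p in \<open>simp_all add: free_algebra_def\<close>)
qed

lemma free_algebra_hom_exists:
  assumes F: "ring F" and S: "ring S" and \<kappa>: "\<kappa> \<in> ring_hom F S"
    and g: "\<And>a. a \<in> X \<Longrightarrow> g a \<in> carrier S"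
    and comm: "\<And>c a. c \<in> carrier F \<Longrightarrow> a \<in> X \<Longrightarrow> \<kappa> c \<otimes>\<^bsub>S\<^esub> g a = g a \<otimes>\<^bsub>S\<^esub> \<kappa> c"
  shows "\<exists>j\<in>ring_hom (free_algebra F X) S. (\<forall>c\<in>carrier F. j (free_algebra_const F c) = \<kappa> c)
           \<and> (\<forall>a\<in>X. j (monomial F \<one>\<^bsub>F\<^esub> [a]) = g a)"
proof -
  interpret S: ring S by fact
  interpret \<kappa>: ring_hom_ring F S \<kappa> by (intro ring_hom_ringI2 F S \<kappa>)
  define \<rho> where "\<rho> w = foldr (\<lambda>a s. g a \<otimes>\<^bsub>S\<^esub> s) w \<one>\<^bsub>S\<^esub>" for w
  have \<rho>_Nil: "\<rho> [] = \<one>\<^bsub>S\<^esub>" and \<rho>_Cons: "\<rho> (a # w) = g a \<otimes>\<^bsub>S\<^esub> \<rho> w" for a w by (simp_all add: \<rho>_def)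
  have closed: "\<rho> w \<in> carrier S" if "w \<in> lists X" for w
    using that by (induction w) (auto simp: \<rho>_Nil \<rho>_Cons g)
  interpret monoid_ring_evaluation F "word_monoid X" S \<kappa> \<rho>
  proof (intro monoid_ring_evaluation.intro monoid_ring_evaluation_axioms.intro word_monoid_context F S \<kappa>.ring_hom_ring_axioms)
    show "\<rho> (u \<otimes>\<^bsub>word_monoid X\<^esub> v) = \<rho> u \<otimes>\<^bsub>S\<^esub> \<rho> v"
      if "u \<in> carrier (word_monoid X)" "v \<in> carrier (word_monoid X)" for u v
    proof -
      have "u \<in> lists X" "v \<in> lists X" using that by simp_all
      then show ?thesis by (induction u) (auto simp: \<rho>_Nil \<rho>_Cons closed g S.m_assoc)
    qed
    show "\<kappa> c \<otimes>\<^bsub>S\<^esub> \<rho> u = \<rho> u \<otimes>\<^bsub>S\<^esub> \<kappa> c" if c: "c \<in> carrier F" and u: "u \<in> carrier (word_monoid X)" for c u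
    proof -
      have "u \<in> lists X" using u by simp
      then show ?thesis
      proof (induction u)
        case (Cons a w)
        have cl: "\<kappa> c \<in> carrier S" "g a \<in> carrier S" "\<rho> w \<in> carrier S" using c Cons g closed by auto
        have "\<kappa> c \<otimes>\<^bsub>S\<^esub> (g a \<otimes>\<^bsub>S\<^esub> \<rho> w) = g a \<otimes>\<^bsub>S\<^esub> (\<kappa> c \<otimes>\<^bsub>S\<^esub> \<rho> w)"
          using cl comm[OF c Cons.hyps(1)] by (simp add: S.m_assoc[symmetric])
        also have "\<dots> = g a \<otimes>\<^bsub>S\<^esub> \<rho> w \<otimes>\<^bsub>S\<^esub> \<kappa> c" using Cons.IH cl by (simp add: S.m_assoc)
        finally show ?case by (simp add: \<rho>_Cons)
      qed (use c in \<open>simp add: \<rho>_Nil\<close>)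
    qed
  qed (use closed in \<open>auto simp: \<rho>_Nil\<close>)
  show ?thesis
  proof (intro bexI[of _ ev] conjI ballI)
    show "ev \<in> ring_hom (free_algebra F X) S" using ev_hom by (simp add: free_algebra_def)
    show "ev (free_algebra_const F c) = \<kappa> c" if "c \<in> carrier F" for c
      using that by (simp add: free_algebra_const_def ev_monomial \<rho>_Nil)
    show "ev (monomial F \<one>\<^bsub>F\<^esub> [a]) = g a" if "a \<in> X" for a
      using that g by (simp add: ev_monomial \<rho>_Nil \<rho>_Cons)
  qed
qed

lemma free_algebra_infinite:
  assumes F: "ring F" "\<one>\<^bsub>F\<^esub> \<noteq> \<zero>\<^bsub>F\<^esub>" and a: "a \<in> X"
  shows "infinite (carrier (free_algebra F X))"
proof -
  interpret monoid_ring_context F "word_monoid X" by (rule word_monoid_context[OF F(1)])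
  let ?m = "\<lambda>n. monomial F \<one>\<^bsub>F\<^esub> (replicate n a)"
  have "inj ?m"
  proof (rule injI)
    fix m n assume "?m m = ?m n"
    then have "?m m (replicate m a) = ?m n (replicate m a)" by simp
    then show "m = n" using F(2) by (auto simp: monomial_def split: if_splits dest: arg_cong[where f = length])
  qed
  moreover have "range ?m \<subseteq> carrier (free_algebra F X)"
    unfolding free_algebra_def using a by (auto intro!: monomial_closed)
  ultimately show ?thesis by (meson finite_subset range_inj_infinite)
qed

section \<open>Endomorphism rings and linear maps\<close>

definition endo_ring :: "('v, 'm) ring_scheme \<Rightarrow> ('v \<Rightarrow> 'v) ring" where
  "endo_ring V =
     \<lparr>carrier = {h \<in> carrier V \<rightarrow>\<^sub>E carrier V.
                    \<forall>u\<in>carrier V. \<forall>v\<in>carrier V. h (u \<oplus>\<^bsub>V\<^esub> v) = h u \<oplus>\<^bsub>V\<^esub> h v},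
      mult = (\<lambda>g h. \<lambda>v\<in>carrier V. g (h v)),
      one = (\<lambda>v\<in>carrier V. v),
      zero = (\<lambda>v\<in>carrier V. \<zero>\<^bsub>V\<^esub>),
      add = (\<lambda>g h. \<lambda>v\<in>carrier V. g v \<oplus>\<^bsub>V\<^esub> h v)\<rparr>"

lemma endo_ring_ring:
  assumes "abelian_group V"
  shows "ring (endo_ring V)"
proof -
  interpret V: abelian_group V by fact
  show ?thesis
  proof (rule ringI)
    show "abelian_group (endo_ring V)"
    proof (rule abelian_groupI)
      fix h assume h: "h \<in> carrier (endo_ring V)"
      have "(\<lambda>v\<in>carrier V. \<ominus>\<^bsub>V\<^esub> h v) \<in> carrier (endo_ring V)"
        using h by (auto simp: endo_ring_def PiE_iff V.minus_add)
      moreover have "(\<lambda>v\<in>carrier V. \<ominus>\<^bsub>V\<^esub> h v) \<oplus>\<^bsub>endo_ring V\<^esub> h = \<zero>\<^bsub>endo_ring V\<^esub>"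
        using h by (auto simp: endo_ring_def PiE_iff V.l_neg intro!: restrict_ext)
      ultimately show "\<exists>g\<in>carrier (endo_ring V). g \<oplus>\<^bsub>endo_ring V\<^esub> h = \<zero>\<^bsub>endo_ring V\<^esub>" by blast
    qed (auto simp: endo_ring_def V.a_ac PiE_iff fun_eq_iff extensional_def)
    show "monoid (endo_ring V)"
      by (rule monoidI) (auto simp: endo_ring_def PiE_iff fun_eq_iff extensional_def)
  qed (auto simp: endo_ring_def PiE_iff fun_eq_iff extensional_def)
qed

lemma endo_simps:
  "v \<in> carrier V \<Longrightarrow> (g \<otimes>\<^bsub>endo_ring V\<^esub> h) v = g (h v)"
  "v \<in> carrier V \<Longrightarrow> (g \<oplus>\<^bsub>endo_ring V\<^esub> h) v = g v \<oplus>\<^bsub>V\<^esub> h v"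
  "v \<in> carrier V \<Longrightarrow> \<one>\<^bsub>endo_ring V\<^esub> v = v"
  "v \<in> carrier V \<Longrightarrow> \<zero>\<^bsub>endo_ring V\<^esub> v = \<zero>\<^bsub>V\<^esub>"
  "h \<in> carrier (endo_ring V) \<Longrightarrow> v \<in> carrier V \<Longrightarrow> h v \<in> carrier V"
  "h \<in> carrier (endo_ring V) \<Longrightarrow> u \<in> carrier V \<Longrightarrow> v \<in> carrier V \<Longrightarrow> h (u \<oplus>\<^bsub>V\<^esub> v) = h u \<oplus>\<^bsub>V\<^esub> h v"
  by (auto simp: endo_ring_def)

lemma endo_eqI:
  assumes "g \<in> carrier (endo_ring V)" "h \<in> carrier (endo_ring V)" "\<And>v. v \<in> carrier V \<Longrightarrow> g v = h v"
  shows "g = h"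
  using assms by (auto simp: endo_ring_def intro: PiE_ext)

definition linear_maps :: "'a set \<Rightarrow> ('a, 'm) ring_scheme \<Rightarrow> ('a \<Rightarrow> 'a) set" where
  "linear_maps E D = {g \<in> carrier D \<rightarrow>\<^sub>E carrier D.
     (\<forall>u\<in>carrier D. \<forall>v\<in>carrier D. g (u \<oplus>\<^bsub>D\<^esub> v) = g u \<oplus>\<^bsub>D\<^esub> g v) \<and>
     (\<forall>e\<in>E. \<forall>v\<in>carrier D. g (e \<otimes>\<^bsub>D\<^esub> v) = e \<otimes>\<^bsub>D\<^esub> g v)}"

text \<open>By Zorn's lemma there is a left $E$-subspace \<open>H\<close> that is maximal among those containing \<open>d\<close> but not
  \<open>1\<close>; the line $E d$ is one of them because $d \notin E$. Maximality makes \<open>H\<close> a complement of $E$,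
  and \<open>g\<close> is the projection to $E$ along \<open>H\<close>.\<close>

lemma (in skew_field) linear_functional_separating:
  assumes E: "skew_subfield E R" and d: "d \<in> carrier R" "d \<notin> E"
  shows "\<exists>g\<in>linear_maps E R. g \<one> = \<one> \<and> g d = \<zero>"
proof -
  have Esub: "E \<subseteq> carrier R" "\<zero> \<in> E" "\<one> \<in> E" "\<And>a. a \<in> E \<Longrightarrow> \<ominus> a \<in> E"
    "\<And>a b. a \<in> E \<Longrightarrow> b \<in> E \<Longrightarrow> a \<otimes> b \<in> E" "\<And>a b. a \<in> E \<Longrightarrow> b \<in> E \<Longrightarrow> a \<oplus> b \<in> E"
    "\<And>a. a \<in> E \<Longrightarrow> a \<noteq> \<zero> \<Longrightarrow> inv a \<in> E"
    using E subringE[of E R] by (auto simp: skew_subfield_def)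
  define \<A> where "\<A> = {H. H \<subseteq> carrier R \<and> d \<in> H \<and> \<one> \<notin> H \<and> (\<forall>u\<in>H. \<forall>v\<in>H. u \<oplus> v \<in> H)
     \<and> (\<forall>e\<in>E. \<forall>v\<in>H. e \<otimes> v \<in> H)}"
  have "(\<lambda>e. e \<otimes> d) ` E \<in> \<A>"
  proof -
    have "d \<in> (\<lambda>e. e \<otimes> d) ` E" using d Esub by (intro image_eqI[of _ _ \<one>]) auto
    moreover have "\<one> \<noteq> e \<otimes> d" if e: "e \<in> E" for e
    proof
      assume eq: "\<one> = e \<otimes> d"
      then have "e \<noteq> \<zero>" using d one_not_zero by auto
      moreover have eR: "e \<in> carrier R" using e Esub by auto
      ultimately have "inv e = d" using inv_nonzero[of e] eq d by (metis m_assoc l_one r_one)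
      then show False using d Esub e \<open>e \<noteq> \<zero>\<close> by auto
    qed
    moreover have "\<exists>e''\<in>E. e \<otimes> d \<oplus> e' \<otimes> d = e'' \<otimes> d" if "e \<in> E" "e' \<in> E" for e e'
      using that d Esub by (intro bexI[of _ "e \<oplus> e'"]) (auto simp: l_distr subset_iff)
    moreover have "\<exists>e''\<in>E. e \<otimes> (e' \<otimes> d) = e'' \<otimes> d" if "e \<in> E" "e' \<in> E" for e e'
      using that d Esub by (intro bexI[of _ "e \<otimes> e'"]) (auto simp: m_assoc subset_iff)
    ultimately show ?thesis using d Esub(1) unfolding \<A>_def by (auto simp: image_iff)
  qed
  then have ne: "\<A> \<noteq> {}" by auto
  have "\<exists>H\<in>\<A>. \<forall>X\<in>\<A>. H \<subseteq> X \<longrightarrow> X = H"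
  proof (rule subset_Zorn_nonempty[OF ne])
    fix \<C> assume C: "\<C> \<noteq> {}" "subset.chain \<A> \<C>"
    have CA: "\<C> \<subseteq> \<A>" and tot: "\<And>X Y. X \<in> \<C> \<Longrightarrow> Y \<in> \<C> \<Longrightarrow> X \<subseteq> Y \<or> Y \<subseteq> X"
      using C(2) by (auto simp: subset_chain_def)
    have "u \<oplus> v \<in> \<Union>\<C>" if uv: "u \<in> \<Union>\<C>" "v \<in> \<Union>\<C>" for u v
    proof -
      obtain X Y where XY: "X \<in> \<C>" "Y \<in> \<C>" "u \<in> X" "v \<in> Y" using uv by auto
      then obtain Z where "Z \<in> \<C>" "u \<in> Z" "v \<in> Z" using tot[of X Y] by blast
      then show ?thesis using CA unfolding \<A>_def by blast
    qed
    moreover have "\<Union>\<C> \<subseteq> carrier R" "d \<in> \<Union>\<C>" "\<one> \<notin> \<Union>\<C>" "\<And>e v. e \<in> E \<Longrightarrow> v \<in> \<Union>\<C> \<Longrightarrow> e \<otimes> v \<in> \<Union>\<C>"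
      using C(1) CA unfolding \<A>_def by blast+
    ultimately show "\<Union>\<C> \<in> \<A>" unfolding \<A>_def by blast
  qed
  then obtain H where HA: "H \<in> \<A>" and max: "\<And>X. X \<in> \<A> \<Longrightarrow> H \<subseteq> X \<Longrightarrow> X = H" by blast
  have H: "H \<subseteq> carrier R" "d \<in> H" "\<one> \<notin> H" "\<And>u v. u \<in> H \<Longrightarrow> v \<in> H \<Longrightarrow> u \<oplus> v \<in> H"
    "\<And>e v. e \<in> E \<Longrightarrow> v \<in> H \<Longrightarrow> e \<otimes> v \<in> H"
    using HA by (auto simp: \<A>_def)
  have H0: "\<zero> \<in> H" using H(5)[OF Esub(2) H(2)] d by simp
  have Hneg: "\<ominus> v \<in> H" if "v \<in> H" for v
    using H(5)[OF Esub(4)[OF Esub(3)] that] that H(1) by (auto simp: l_minus)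
  have ex: "\<exists>e\<in>E. v \<ominus> e \<in> H" if v: "v \<in> carrier R" for v
  proof (cases "v \<in> H")
    case True
    then show ?thesis using Esub(2) v by (intro bexI[of _ \<zero>]) (auto simp: minus_eq)
  next
    case False
    define X where "X = {h \<oplus> e \<otimes> v | h e. h \<in> H \<and> e \<in> E}"
    have XI: "h \<oplus> e \<otimes> v \<in> X" if "h \<in> H" "e \<in> E" for h e using that by (auto simp: X_def)
    have "H \<subseteq> X"
    proof
      fix h assume "h \<in> H"
      then show "h \<in> X" unfolding X_def using H(1) Esub(2) v by (intro CollectI exI[of _ h] exI[of _ \<zero>]) auto
    qed
    moreover have "v \<in> X"
      unfolding X_def using H0 Esub(3) v by (intro CollectI exI[of _ \<zero>] exI[of _ \<one>]) auto
    ultimately have "X \<notin> \<A>" using max False by blast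
    moreover have "X \<subseteq> carrier R" using H(1) Esub(1) v by (auto simp: X_def)
    moreover have "d \<in> X" using \<open>H \<subseteq> X\<close> H(2) by auto
    moreover have "x \<oplus> y \<in> X" if xy: "x \<in> X" "y \<in> X" for x y
    proof -
      obtain h e h' e' where e: "x = h \<oplus> e \<otimes> v" "y = h' \<oplus> e' \<otimes> v" "h \<in> H" "e \<in> E" "h' \<in> H" "e' \<in> E"
        using xy by (auto simp: X_def)
      then have c: "h \<in> carrier R" "h' \<in> carrier R" "e \<in> carrier R" "e' \<in> carrier R"
        using H(1) Esub(1) by auto
      have "x \<oplus> y = (h \<oplus> h') \<oplus> (e \<oplus> e') \<otimes> v" using c v by (simp add: e l_distr a_ac)
      then show ?thesis using e XI[OF H(4) Esub(6), of h h' e e'] by metis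
    qed
    moreover have "a \<otimes> x \<in> X" if ax: "a \<in> E" "x \<in> X" for a x
    proof -
      obtain h e where e: "x = h \<oplus> e \<otimes> v" "h \<in> H" "e \<in> E" using ax by (auto simp: X_def)
      then have c: "h \<in> carrier R" "a \<in> carrier R" "e \<in> carrier R" using H(1) Esub(1) ax by auto
      have "a \<otimes> x = a \<otimes> h \<oplus> (a \<otimes> e) \<otimes> v" using c v by (simp add: e r_distr m_assoc)
      then show ?thesis using e XI[OF H(5) Esub(5), of a h a e] ax by metis
    qed
    ultimately have "\<one> \<in> X" unfolding \<A>_def by blast
    \<comment> \<open>Solve $1 = h + e v$ for \<open>v\<close>; here $e \neq 0$ since $1 \notin H$.\<close>
    then obtain h e where e: "\<one> = h \<oplus> e \<otimes> v" "h \<in> H" "e \<in> E" by (auto simp: X_def)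
    then have c: "h \<in> carrier R" "e \<in> carrier R" using H(1) Esub(1) by auto
    have "e \<noteq> \<zero>" using e c v H(3) by auto
    note ie = inv_nonzero[OF c(2) this]
    have iE: "inv e \<in> E" using Esub(7) e \<open>e \<noteq> \<zero>\<close> by auto
    have "inv e = inv e \<otimes> (h \<oplus> e \<otimes> v)" using e(1) ie(1) by (metis r_one)
    also have "\<dots> = inv e \<otimes> h \<oplus> v" using c v ie by (simp add: r_distr m_assoc[symmetric])
    finally have eq: "inv e = inv e \<otimes> h \<oplus> v" .
    have "v \<ominus> (w \<oplus> v) = \<ominus> w" if "w \<in> carrier R" for w
      using that v by (simp add: minus_eq minus_add a_lcomm[of v "\<ominus> w" "\<ominus> v"] r_neg)
    from this[of "inv e \<otimes> h"] have "v \<ominus> inv e = \<ominus> (inv e \<otimes> h)"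
      using eq c ie by simp
    then show ?thesis using Hneg[OF H(5)[OF iE e(2)]] iE by (intro bexI[of _ "inv e"]) auto
  qed
  have uniq: "e = e'" if e: "e \<in> E" "e' \<in> E" "v \<ominus> e \<in> H" "v \<ominus> e' \<in> H" and v: "v \<in> carrier R" for e e' v
  proof (rule ccontr)
    assume ne: "e \<noteq> e'"
    have c: "e \<in> carrier R" "e' \<in> carrier R" using e Esub(1) by auto
    define f where "f = e' \<ominus> e"
    have fE: "f \<in> E" using e Esub(4,6) by (simp add: f_def minus_eq)
    have "f \<noteq> \<zero>" using ne c by (metis f_def c r_right_minus_eq)
    have "(v \<ominus> e) \<oplus> \<ominus> (v \<ominus> e') = f"
      using c v a_lcomm[of v "\<ominus> e" "\<ominus> v"] by (simp add: f_def minus_eq minus_add a_ac r_neg)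
    then have "f \<in> H" using H(4)[OF e(3) Hneg[OF e(4)]] by simp
    then have "inv f \<otimes> f \<in> H" using H(5) Esub(7) fE \<open>f \<noteq> \<zero>\<close> by auto
    then show False using H(3) inv_nonzero(2)[of f] fE Esub(1) \<open>f \<noteq> \<zero>\<close> by auto
  qed
  define g where "g = (\<lambda>v\<in>carrier R. THE e. e \<in> E \<and> v \<ominus> e \<in> H)"
  have gI: "g v = e" if "e \<in> E" "v \<ominus> e \<in> H" "v \<in> carrier R" for v e
    using that uniq by (auto simp: g_def intro!: the_equality)
  have gE: "g v \<in> E" "v \<ominus> g v \<in> H" if v: "v \<in> carrier R" for v
    using ex[OF v] gI[OF _ _ v] by auto
  have gc: "g v \<in> carrier R" if "v \<in> carrier R" for v using gE(1)[OF that] Esub(1) by auto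
  have "g \<in> linear_maps E R" unfolding linear_maps_def
  proof (intro CollectI conjI ballI)
    show "g \<in> carrier R \<rightarrow>\<^sub>E carrier R" using gc by (auto simp: g_def)
    fix v assume v: "v \<in> carrier R"
    show "g (u \<oplus> v) = g u \<oplus> g v" if u: "u \<in> carrier R" for u
    proof (rule gI)
      have "u \<oplus> v \<ominus> (g u \<oplus> g v) = (u \<ominus> g u) \<oplus> (v \<ominus> g v)"
        using u v gc by (simp add: minus_eq minus_add a_ac)
      then show "u \<oplus> v \<ominus> (g u \<oplus> g v) \<in> H" using H(4) gE(2) u v by simp
    qed (use gE u v Esub in auto)
    show "g (e \<otimes> v) = e \<otimes> g v" if e: "e \<in> E" for e
    proof (rule gI)
      have "e \<otimes> v \<ominus> e \<otimes> g v = e \<otimes> (v \<ominus> g v)"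
        using e v gc Esub(1) by (simp add: minus_eq r_distr r_minus subset_iff)
      then show "e \<otimes> v \<ominus> e \<otimes> g v \<in> H" using H(5) gE(2) e v by simp
    qed (use gE e v Esub in auto)
  qed
  moreover have "g \<one> = \<one>" "g d = \<zero>"
    using gI[of \<one> \<one>] gI[of \<zero> d] Esub H0 H(2) d by (simp_all add: minus_eq r_neg)
  ultimately show ?thesis by blast
qed

section \<open>Skew subfields and left ideals of the tensor product\<close>

text \<open>The $k$-linear maps as an abelian group; it is a ring record because abelian groups are a predicate on
  these.\<close>

definition linear_map_group :: "'a set \<Rightarrow> ('a, 'm) ring_scheme \<Rightarrow> ('a \<Rightarrow> 'a) ring" where
  "linear_map_group k D =
     \<lparr>carrier = linear_maps k D, mult = undefined, one = undefined,
      zero = (\<lambda>v\<in>carrier D. \<zero>\<^bsub>D\<^esub>), add = (\<lambda>g h. \<lambda>v\<in>carrier D. g v \<oplus>\<^bsub>D\<^esub> h v)\<rparr>"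

text \<open>The operator by which the pure tensor $a \otimes b$ acts on linear maps.\<close>

definition bimult :: "'a set \<Rightarrow> ('a, 'm) ring_scheme \<Rightarrow> 'a \<times> 'a \<Rightarrow> ('a \<Rightarrow> 'a) \<Rightarrow> ('a \<Rightarrow> 'a)" where
  "bimult k D = (\<lambda>(a, b). \<lambda>g\<in>linear_maps k D. \<lambda>v\<in>carrier D. a \<otimes>\<^bsub>D\<^esub> g (b \<otimes>\<^bsub>D\<^esub> v))"

locale skew_field_algebra = skew_field D for D (structure) +
  fixes k :: "'a set"
  assumes central: "central_subfield k D"
begin

lemma k_subset: "c \<in> k \<Longrightarrow> c \<in> carrier D"
  using central subfieldE(3)[of k D] by (auto simp: central_subfield_def)

lemma k_subring: "subring k D"
  using central subfieldE(1) by (auto simp: central_subfield_def)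

lemma k_commute: "c \<in> k \<Longrightarrow> d \<in> carrier D \<Longrightarrow> c \<otimes> d = d \<otimes> c"
  using central by (auto simp: central_subfield_def)

abbreviation F where "F \<equiv> D\<lparr>carrier := k\<rparr>"
abbreviation V where "V \<equiv> linear_map_group k D"

lemma F_ring: "ring F"
  using k_subring subring_iff[OF subringE(1)[OF k_subring]] by blast

lemma linear_mapsD:
  assumes "g \<in> linear_maps E D" "u \<in> carrier D" "v \<in> carrier D"
  shows "g u \<in> carrier D" "g (u \<oplus> v) = g u \<oplus> g v" "e \<in> E \<Longrightarrow> g (e \<otimes> v) = e \<otimes> g v"
  using assms by (auto simp: linear_maps_def PiE_iff)

lemma V_group: "abelian_group V"
proof (rule abelian_groupI)
  show "\<zero>\<^bsub>V\<^esub> \<in> carrier V"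
    using k_subset by (auto simp: linear_map_group_def linear_maps_def)
  fix g assume g: "g \<in> carrier V"
  have "(\<lambda>v\<in>carrier D. \<ominus> g v) \<in> carrier V"
    using g k_subset by (auto simp: linear_map_group_def linear_maps_def PiE_iff minus_add r_minus)
  moreover have "(\<lambda>v\<in>carrier D. \<ominus> g v) \<oplus>\<^bsub>V\<^esub> g = \<zero>\<^bsub>V\<^esub>"
    using g by (auto simp: linear_map_group_def linear_maps_def PiE_iff l_neg)
  ultimately show "\<exists>h\<in>carrier V. h \<oplus>\<^bsub>V\<^esub> g = \<zero>\<^bsub>V\<^esub>" by blast
  show "\<zero>\<^bsub>V\<^esub> \<oplus>\<^bsub>V\<^esub> g = g"
    using g by (auto simp: linear_map_group_def linear_maps_def PiE_iff extensional_def)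
  fix h assume h: "h \<in> carrier V"
  show "g \<oplus>\<^bsub>V\<^esub> h \<in> carrier V"
    using g h k_subset by (auto simp: linear_map_group_def linear_maps_def PiE_iff r_distr a_ac)
  show "g \<oplus>\<^bsub>V\<^esub> h = h \<oplus>\<^bsub>V\<^esub> g"
    using g h by (auto simp: linear_map_group_def linear_maps_def PiE_iff a_comm)
  fix f assume f: "f \<in> carrier V"
  show "g \<oplus>\<^bsub>V\<^esub> h \<oplus>\<^bsub>V\<^esub> f = g \<oplus>\<^bsub>V\<^esub> (h \<oplus>\<^bsub>V\<^esub> f)"
    using f g h by (auto simp: linear_map_group_def linear_maps_def PiE_iff a_assoc)
qed

lemma V_simps:
  "carrier V = linear_maps k D" "v \<in> carrier D \<Longrightarrow> (g \<oplus>\<^bsub>V\<^esub> h) v = g v \<oplus> h v"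
  "v \<in> carrier D \<Longrightarrow> \<zero>\<^bsub>V\<^esub> v = \<zero>"
  by (simp_all add: linear_map_group_def)

lemma V_eqI: "g \<in> linear_maps k D \<Longrightarrow> h \<in> linear_maps k D \<Longrightarrow> (\<And>v. v \<in> carrier D \<Longrightarrow> g v = h v) \<Longrightarrow> g = h"
  by (auto simp: linear_maps_def intro: PiE_ext)

sublocale V: abelian_group V by (rule V_group)
sublocale End: ring "endo_ring V" by (rule endo_ring_ring[OF V_group])

lemma bimult_apply:
  "g \<in> linear_maps k D \<Longrightarrow> v \<in> carrier D \<Longrightarrow> bimult k D (a, b) g v = a \<otimes> g (b \<otimes> v)"
  by (simp add: bimult_def)

lemma bimult_linear:
  assumes a: "a \<in> carrier D" and b: "b \<in> carrier D" and g: "g \<in> linear_maps k D"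
  shows "bimult k D (a, b) g \<in> linear_maps k D"
proof -
  have "a \<otimes> g (b \<otimes> (c \<otimes> v)) = c \<otimes> (a \<otimes> g (b \<otimes> v))" if "c \<in> k" "v \<in> carrier D" for c v
  proof -
    note c = k_subset[OF that(1)]
    have "b \<otimes> (c \<otimes> v) = c \<otimes> (b \<otimes> v)" using that a b c by (simp add: m_assoc[symmetric] k_commute)
    then have "a \<otimes> g (b \<otimes> (c \<otimes> v)) = a \<otimes> (c \<otimes> g (b \<otimes> v))" using linear_mapsD(3)[OF g, of _ "b \<otimes> v" c] that b by simp
    also have "\<dots> = c \<otimes> (a \<otimes> g (b \<otimes> v))" using that a b c linear_mapsD(1)[OF g] by (simp add: m_assoc[symmetric] k_commute)
    finally show ?thesis .
  qed
  then show ?thesis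
    using g k_subset a b linear_mapsD(1,2)[OF g]
    by (subst linear_maps_def) (auto simp: bimult_def r_distr)
qed

lemma bimult_closed:
  assumes "a \<in> carrier D" "b \<in> carrier D"
  shows "bimult k D (a, b) \<in> carrier (endo_ring V)"
proof -
  have "bimult k D (a, b) (g \<oplus>\<^bsub>V\<^esub> h) = bimult k D (a, b) g \<oplus>\<^bsub>V\<^esub> bimult k D (a, b) h"
    if g: "g \<in> linear_maps k D" "h \<in> linear_maps k D" for g h
  proof (rule V_eqI)
    have gh: "g \<oplus>\<^bsub>V\<^esub> h \<in> linear_maps k D" using V.a_closed[of g h] that by (simp add: V_simps(1))
    then show "bimult k D (a, b) (g \<oplus>\<^bsub>V\<^esub> h) \<in> linear_maps k D" using assms by (intro bimult_linear)
    show "bimult k D (a, b) g \<oplus>\<^bsub>V\<^esub> bimult k D (a, b) h \<in> linear_maps k D"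
      using V.a_closed[of "bimult k D (a, b) g" "bimult k D (a, b) h"] that assms bimult_linear by (simp add: V_simps(1))
    show "bimult k D (a, b) (g \<oplus>\<^bsub>V\<^esub> h) v = (bimult k D (a, b) g \<oplus>\<^bsub>V\<^esub> bimult k D (a, b) h) v"
      if v: "v \<in> carrier D" for v
      using v assms linear_mapsD(1)[OF g(1)] linear_mapsD(1)[OF g(2)]
      by (simp add: bimult_apply g gh V_simps r_distr)
  qed
  moreover have "bimult k D (a, b) \<in> extensional (linear_maps k D)" by (simp add: bimult_def)
  ultimately show ?thesis using bimult_linear[OF assms]
    by (auto simp: endo_ring_def V_simps(1) PiE_iff)
qed

lemma endo_eqI_pointwise:
  assumes "s \<in> carrier (endo_ring V)" "t \<in> carrier (endo_ring V)"
    "\<And>g v. g \<in> linear_maps k D \<Longrightarrow> v \<in> carrier D \<Longrightarrow> s g v = t g v"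
  shows "s = t"
  by (rule endo_eqI[OF assms(1,2)], rule V_eqI)
    (use assms(3) endo_simps(5)[OF assms(1)] endo_simps(5)[OF assms(2)] in \<open>auto simp: V_simps(1)\<close>)

lemma bimult_mult:
  assumes "a \<in> carrier D" "b \<in> carrier D" "a' \<in> carrier D" "b' \<in> carrier D"
  shows "bimult k D (a \<otimes> a', b' \<otimes> b) = bimult k D (a, b) \<otimes>\<^bsub>endo_ring V\<^esub> bimult k D (a', b')"
  by (rule endo_eqI_pointwise)
    (use assms in \<open>auto simp: bimult_closed endo_simps V_simps(1) bimult_apply bimult_linear m_assoc linear_mapsD(1)\<close>)

lemma bimult_one: "bimult k D (\<one>, \<one>) = \<one>\<^bsub>endo_ring V\<^esub>"
  by (rule endo_eqI_pointwise) (auto simp: bimult_closed endo_simps V_simps(1) bimult_apply linear_mapsD(1))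

lemma bimult_add_left:
  assumes "a \<in> carrier D" "a' \<in> carrier D" "b \<in> carrier D"
  shows "bimult k D (a \<oplus> a', b) = bimult k D (a, b) \<oplus>\<^bsub>endo_ring V\<^esub> bimult k D (a', b)"
  by (rule endo_eqI_pointwise)
    (use assms in \<open>auto simp: bimult_closed endo_simps V_simps bimult_apply bimult_linear l_distr linear_mapsD(1)\<close>)

lemma bimult_add_right:
  assumes "a \<in> carrier D" "b \<in> carrier D" "b' \<in> carrier D"
  shows "bimult k D (a, b \<oplus> b') = bimult k D (a, b) \<oplus>\<^bsub>endo_ring V\<^esub> bimult k D (a, b')"
  by (rule endo_eqI_pointwise)
    (use assms in \<open>auto simp: bimult_closed endo_simps V_simps bimult_apply bimult_linear l_distr r_distr linear_mapsD\<close>)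

text \<open>Balancedness over $k$, the one bilinearity relation that needs the maps to be $k$-linear.\<close>

lemma bimult_scalar:
  assumes "c \<in> k" "a \<in> carrier D" "b \<in> carrier D"
  shows "bimult k D (a, b \<otimes> c) = bimult k D (c \<otimes> a, b)"
proof (rule endo_eqI_pointwise)
  fix g v assume g: "g \<in> linear_maps k D" and v: "v \<in> carrier D"
  note c = k_subset[OF assms(1)]
  have gb: "g (b \<otimes> v) \<in> carrier D" using linear_mapsD(1)[OF g] v assms by auto
  have "a \<otimes> g (b \<otimes> c \<otimes> v) = a \<otimes> (c \<otimes> g (b \<otimes> v))"
    using linear_mapsD(3)[OF g, of "b \<otimes> v" "b \<otimes> v" c] v assms c
    by (simp add: k_commute[symmetric, of c b] m_assoc)
  also have "\<dots> = c \<otimes> a \<otimes> g (b \<otimes> v)"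
    using gb assms c by (simp add: k_commute[of c a] m_assoc)
  finally show "bimult k D (a, b \<otimes> c) g v = bimult k D (c \<otimes> a, b) g v"
    using g v by (simp add: bimult_apply)
qed (use assms k_subset in \<open>auto intro: bimult_closed\<close>)

abbreviation M where "M \<equiv> D \<times>\<times> opposite D"
abbreviation T where "T \<equiv> tensor_algebra F id D id (opposite D)"

lemma M_simps: "carrier M = carrier D \<times> carrier D" "\<one>\<^bsub>M\<^esub> = (\<one>, \<one>)"
  "(a, b) \<otimes>\<^bsub>M\<^esub> (a', b') = (a \<otimes> a', b' \<otimes> b)"
  by (simp_all add: DirProd_def)

sublocale ME: monoid_ring_evaluation F M "endo_ring V" "\<lambda>c. bimult k D (c, \<one>)" "bimult k D"
proof (intro monoid_ring_evaluation.intro monoid_ring_context.intro monoid_ring_evaluation_axioms.intro)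
  show "ring F" by (rule F_ring)
  show "monoid M" by (intro DirProd_monoid monoid_axioms ring.is_monoid opposite_ring ring_axioms)
  show "ring (endo_ring V)" by (rule End.ring_axioms)
  show "ring_hom_ring F (endo_ring V) (\<lambda>c. bimult k D (c, \<one>))"
  proof (rule ring_hom_ringI2[OF F_ring End.ring_axioms], rule ring_hom_memI)
    show "bimult k D (c \<otimes>\<^bsub>F\<^esub> d, \<one>) = bimult k D (c, \<one>) \<otimes>\<^bsub>endo_ring V\<^esub> bimult k D (d, \<one>)"
      if "c \<in> carrier F" "d \<in> carrier F" for c d
      using bimult_mult[of c \<one> d \<one>] that k_subset by simp
  qed (use k_subset in \<open>auto simp: bimult_closed bimult_one bimult_add_left\<close>)
  show "bimult k D (c, \<one>) \<otimes>\<^bsub>endo_ring V\<^esub> bimult k D m = bimult k D m \<otimes>\<^bsub>endo_ring V\<^esub> bimult k D (c, \<one>)"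
    if "c \<in> carrier F" "m \<in> carrier M" for c m
    using that k_subset by (cases m) (auto simp: M_simps bimult_mult[symmetric] k_commute)
qed (auto simp: M_simps bimult_closed bimult_one bimult_mult[symmetric])

lemma tensor_ring: "ring T"
  by (rule tensor_algebra_ring) (use F_ring ring_axioms opposite_ring k_subset in auto)

text \<open>The evaluation of the monoid ring of $D \times D^{op}$ at \<open>bimult\<close> kills the bilinearity relations,
  hence factors through the tensor product.\<close>

lemma tensor_action:
  "\<exists>\<Theta>\<in>ring_hom T (endo_ring V). \<forall>a\<in>carrier D. \<forall>b\<in>carrier D. \<exists>t\<in>carrier T. \<Theta> t = bimult k D (a, b)"
proof -
  interpret P: ring ME.P by (rule ME.monoid_ring_ring)
  interpret evh: ring_hom_ring ME.P "endo_ring V" ME.ev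
    by (intro ring_hom_ringI2 P.ring_axioms End.ring_axioms ME.ev_hom)
  let ?B = "bilinear_relations F id D id (opposite D)"
  let ?I = "Idl\<^bsub>ME.P\<^esub> ?B"
  have m: "monomial F c (a, b) \<in> carrier ME.P"
    if "c \<in> k" "a \<in> carrier D" "b \<in> carrier D" for a b c
    using that by (intro ME.monomial_closed) (auto simp: M_simps)
  have one: "\<one> \<in> k" using subringE(3)[OF k_subring] .
  have evm: "ME.ev (monomial F c (a, b)) = bimult k D (c \<otimes> a, b)" if "c \<in> k" "a \<in> carrier D" "b \<in> carrier D" for a b c
    using that k_subset bimult_mult[of c \<one> a b] by (subst ME.ev_monomial) (auto simp: M_simps)
  have B: "?B \<subseteq> carrier ME.P"
    using k_subset one by (auto simp: bilinear_relations_def Let_def intro!: m P.minus_closed P.a_closed)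
  have "?B \<subseteq> a_kernel ME.P (endo_ring V) ME.ev"
  proof
    fix p assume p: "p \<in> ?B"
    have sub: "ME.ev (p \<ominus>\<^bsub>ME.P\<^esub> q) = ME.ev p \<ominus>\<^bsub>endo_ring V\<^esub> ME.ev q"
      if "p \<in> carrier ME.P" "q \<in> carrier ME.P" for p q
      using that by (simp add: P.minus_eq End.minus_eq)
    have z: "s \<ominus>\<^bsub>endo_ring V\<^esub> t = \<zero>\<^bsub>endo_ring V\<^esub>" if "s = t" "t \<in> carrier (endo_ring V)" for s t
      using that by (simp add: End.minus_eq End.r_neg)
    have "ME.ev p = \<zero>\<^bsub>endo_ring V\<^esub>"
      using p k_subset one unfolding bilinear_relations_def Let_def
      by (auto simp: sub m evm bimult_add_left bimult_add_right bimult_scalar P.a_closed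
        intro!: z bimult_closed)
    moreover have "p \<in> carrier ME.P" using B p by blast
    ultimately show "p \<in> a_kernel ME.P (endo_ring V) ME.ev" unfolding a_kernel_def' by blast
  qed
  then have ker: "?I \<subseteq> a_kernel ME.P (endo_ring V) ME.ev"
    by (intro P.genideal_minimal evh.kernel_is_ideal)
  have "ME.ev p = \<zero>\<^bsub>endo_ring V\<^esub>" if "p \<in> ?I" for p
    using ker that unfolding a_kernel_def' by blast
  from ring_hom_quotient[OF evh.ring_hom_ring_axioms P.genideal_ideal[OF B] this]
  obtain \<Theta> where \<Theta>: "\<Theta> \<in> ring_hom T (endo_ring V)" "\<And>p. p \<in> carrier ME.P \<Longrightarrow> \<Theta> (?I +>\<^bsub>ME.P\<^esub> p) = ME.ev p"
    unfolding tensor_algebra_def by blast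
  have "\<exists>t\<in>carrier T. \<Theta> t = bimult k D (a, b)" if "a \<in> carrier D" "b \<in> carrier D" for a b
  proof (rule bexI)
    show "\<Theta> (?I +>\<^bsub>ME.P\<^esub> monomial F \<one> (a, b)) = bimult k D (a, b)"
      using \<Theta>(2)[OF m[OF one that]] evm[OF one that] that by simp
    show "?I +>\<^bsub>ME.P\<^esub> monomial F \<one> (a, b) \<in> carrier T"
      using m[OF one that] unfolding tensor_algebra_def FactRing_def A_RCOSETS_def' by auto
  qed
  then show ?thesis using \<Theta>(1) by blast
qed

text \<open>The left ideals are the annihilators of the left $E_n$-linear maps. For $d \in E_{n+1} - E_n$, the
  element $d \otimes 1 - 1 \otimes d$ belongs to the annihilator for $n + 1$ and not to that for $n$.\<close>

theorem tensor_not_noetherian: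
  assumes E: "\<And>n. skew_subfield (E n) D" "\<And>n. k \<subseteq> E n" "\<And>n. E n \<subset> E (Suc n)"
  shows "\<not> left_noetherian T"
proof
  assume noeth: "left_noetherian T"
  interpret T: ring T by (rule tensor_ring)
  obtain \<Theta> where \<Theta>: "\<Theta> \<in> ring_hom T (endo_ring V)"
    and pure: "\<And>a b. a \<in> carrier D \<Longrightarrow> b \<in> carrier D \<Longrightarrow> \<exists>t\<in>carrier T. \<Theta> t = bimult k D (a, b)"
    using tensor_action by blast
  interpret \<Theta>: ring_hom_ring T "endo_ring V" \<Theta> by (intro ring_hom_ringI2 T.ring_axioms End.ring_axioms \<Theta>)
  define J where "J n = {t \<in> carrier T. \<forall>g\<in>linear_maps (E n) D. \<Theta> t g = \<zero>\<^bsub>V\<^esub>}" for n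
  have lin: "g \<in> carrier V" if "g \<in> linear_maps (E n) D" for g n
    using that E(2)[of n] by (auto simp: V_simps(1) linear_maps_def)
  have z: "h \<zero>\<^bsub>V\<^esub> = \<zero>\<^bsub>V\<^esub>" if "h \<in> carrier (endo_ring V)" for h
  proof -
    have c: "h \<zero>\<^bsub>V\<^esub> \<in> carrier V" using endo_simps(5)[OF that] by simp
    have "h (\<zero>\<^bsub>V\<^esub> \<oplus>\<^bsub>V\<^esub> \<zero>\<^bsub>V\<^esub>) = h \<zero>\<^bsub>V\<^esub> \<oplus>\<^bsub>V\<^esub> h \<zero>\<^bsub>V\<^esub>"
      using endo_simps(6)[OF that V.zero_closed V.zero_closed] .
    then have "h \<zero>\<^bsub>V\<^esub> = h \<zero>\<^bsub>V\<^esub> \<oplus>\<^bsub>V\<^esub> h \<zero>\<^bsub>V\<^esub>" by simp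
    then show ?thesis using c by (metis V.add.r_cancel_one')
  qed
  have "left_ideal (J n) T" for n
  proof (rule left_idealI[OF T.ring_axioms])
    show "s \<otimes>\<^bsub>T\<^esub> t \<in> J n" if "t \<in> J n" "s \<in> carrier T" for s t
      using that lin z by (auto simp: J_def endo_simps)
  qed (auto simp: J_def endo_simps lin)
  moreover have asc: "J n \<subseteq> J (Suc n)" for n
  proof -
    have "linear_maps (E (Suc n)) D \<subseteq> linear_maps (E n) D" using E(3)[of n] by (auto simp: linear_maps_def)
    then show ?thesis by (auto simp: J_def)
  qed
  ultimately obtain n where n: "J (Suc n) = J n"
    using left_noetherian_ascending_chain[OF T.ring_axioms noeth] by blast
  obtain d where d: "d \<in> E (Suc n)" "d \<notin> E n" using E(3)[of n] by auto
  have "E (Suc n) \<subseteq> carrier D" using E(1)[of "Suc n"] subringE(1) by (auto simp: skew_subfield_def)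
  then have dD: "d \<in> carrier D" using d by auto
  obtain s t where st: "s \<in> carrier T" "t \<in> carrier T" "\<Theta> s = bimult k D (d, \<one>)" "\<Theta> t = bimult k D (\<one>, d)"
    using pure dD by (meson one_closed)
  have val: "\<Theta> (s \<ominus>\<^bsub>T\<^esub> t) g v = d \<otimes> g v \<ominus> g (d \<otimes> v)" if g: "g \<in> carrier V" and v: "v \<in> carrier D" for g v
  proof -
    have gl: "g \<in> linear_maps k D" using g by (simp add: V_simps(1))
    note gc = linear_mapsD(1)[OF gl]
    have c: "\<Theta> (s \<ominus>\<^bsub>T\<^esub> t) g \<in> linear_maps k D"
      using endo_simps(5)[of "\<Theta> (s \<ominus>\<^bsub>T\<^esub> t)" V g] g st by (simp add: V_simps(1))
    have "s = (s \<ominus>\<^bsub>T\<^esub> t) \<oplus>\<^bsub>T\<^esub> t" using st by (simp add: T.minus_eq T.a_assoc T.l_neg)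
    then have "\<Theta> s g v = (\<Theta> (s \<ominus>\<^bsub>T\<^esub> t) \<oplus>\<^bsub>endo_ring V\<^esub> \<Theta> t) g v" using st by (metis T.minus_closed \<Theta>.hom_add)
    also have "\<dots> = \<Theta> (s \<ominus>\<^bsub>T\<^esub> t) g v \<oplus> \<Theta> t g v" using g v by (simp add: endo_simps V_simps)
    finally have "d \<otimes> g v = \<Theta> (s \<ominus>\<^bsub>T\<^esub> t) g v \<oplus> g (d \<otimes> v)"
      using gl v gc dD by (simp add: st bimult_apply)
    then show ?thesis using linear_mapsD(1)[OF c v v] gc dD v by (simp add: minus_eq a_assoc r_neg)
  qed
  have "s \<ominus>\<^bsub>T\<^esub> t \<in> J (Suc n)"
  proof -
    have "\<Theta> (s \<ominus>\<^bsub>T\<^esub> t) g = \<zero>\<^bsub>V\<^esub>" if g: "g \<in> linear_maps (E (Suc n)) D" for g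
    proof (rule V_eqI)
      show "\<Theta> (s \<ominus>\<^bsub>T\<^esub> t) g \<in> linear_maps k D"
        using endo_simps(5)[of "\<Theta> (s \<ominus>\<^bsub>T\<^esub> t)" V g] lin[OF g] st by (simp add: V_simps(1))
      show "\<zero>\<^bsub>V\<^esub> \<in> linear_maps k D" using V.zero_closed by (simp add: V_simps(1))
      show "\<Theta> (s \<ominus>\<^bsub>T\<^esub> t) g v = \<zero>\<^bsub>V\<^esub> v" if v: "v \<in> carrier D" for v
        using val[OF lin[OF g] v] linear_mapsD[OF g v v] d dD v by (simp add: V_simps minus_eq r_neg)
    qed
    then show ?thesis using st by (simp add: J_def)
  qed
  moreover have "s \<ominus>\<^bsub>T\<^esub> t \<notin> J n"
  proof -
    obtain g where g: "g \<in> linear_maps (E n) D" "g \<one> = \<one>" "g d = \<zero>"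
      using linear_functional_separating[OF E(1) dD d(2)] by blast
    have "\<Theta> (s \<ominus>\<^bsub>T\<^esub> t) g \<one> = d" using val[OF lin[OF g(1)], of \<one>] g dD by (simp add: minus_eq)
    moreover have "d \<noteq> \<zero>" using d E(1)[of n] subringE(2)[of "E n" D] by (auto simp: skew_subfield_def)
    ultimately have "\<Theta> (s \<ominus>\<^bsub>T\<^esub> t) g \<noteq> \<zero>\<^bsub>V\<^esub>" using V_simps(3)[of \<one>] by auto
    then show ?thesis using g(1) unfolding J_def by blast
  qed
  ultimately show False using n by simp
qed

end

section \<open>Extending homomorphisms to the universal field\<close>

text \<open>The generated skew field is reached by countably many rounds of applying the field operations, and a
  round does not increase the cardinality of an infinite set.\<close>

lemma generate_field_card:
  includes cardinal_syntax
  assumes A: "infinite A" and H: "H = j ` A"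
  shows "\<exists>f. inj_on f (generate_field R H) \<and> f ` generate_field R H \<subseteq> A"
proof -
  \<comment> \<open>The last case of \<open>?op\<close> returns its argument, so that the rounds increase.\<close>
  let ?op = "\<lambda>(b :: nat, x, y). if b = 0 then \<ominus>\<^bsub>R\<^esub> x else if b = 1 then inv\<^bsub>R\<^esub> x
     else if b = 2 then x \<oplus>\<^bsub>R\<^esub> y else if b = 3 then x \<otimes>\<^bsub>R\<^esub> y else x"
  define S where "S = rec_nat (insert \<one>\<^bsub>R\<^esub> H) (\<lambda>n X. ?op ` (UNIV \<times> X \<times> X))"
  have S0: "S 0 = insert \<one>\<^bsub>R\<^esub> H" and SS: "S (Suc n) = ?op ` (UNIV \<times> S n \<times> S n)" for n
    by (simp_all add: S_def)
  have op: "?op (b, x, y) \<in> S (Suc n)" if "x \<in> S n" "y \<in> S n" for b x y n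
    unfolding SS using that by (intro imageI) auto
  have mono: "S m \<subseteq> S n" if "m \<le> n" for m n
  proof (rule lift_Suc_mono_le[OF _ that])
    show "S n \<subseteq> S (Suc n)" for n using op[of _ n _ 4] by auto
  qed
  have "x \<in> (\<Union>n. S n)" if "x \<in> generate_field R H" for x
    using that
  proof (induction rule: generate_field.induct)
    case one
    then show ?case using S0 by blast
  next
    case (incl h)
    then show ?case using S0 by blast
  next
    case (a_inv h)
    then obtain n where "h \<in> S n" by auto
    then have "\<ominus>\<^bsub>R\<^esub> h \<in> S (Suc n)" using op[of h n h 0] by simp
    then show ?case by blast
  next
    case (m_inv h)
    then obtain n where "h \<in> S n" by auto
    then have "inv\<^bsub>R\<^esub> h \<in> S (Suc n)" using op[of h n h 1] by simp
    then show ?case by blast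
  next
    case (eng_add h1 h2)
    then obtain m n where "h1 \<in> S m" "h2 \<in> S n" by auto
    then have "h1 \<in> S (max m n)" "h2 \<in> S (max m n)" using mono[of m "max m n"] mono[of n "max m n"] by auto
    then have "h1 \<oplus>\<^bsub>R\<^esub> h2 \<in> S (Suc (max m n))" using op[of h1 "max m n" h2 2] by simp
    then show ?case by blast
  next
    case (eng_mult h1 h2)
    then obtain m n where "h1 \<in> S m" "h2 \<in> S n" by auto
    then have "h1 \<in> S (max m n)" "h2 \<in> S (max m n)" using mono[of m "max m n"] mono[of n "max m n"] by auto
    then have "h1 \<otimes>\<^bsub>R\<^esub> h2 \<in> S (Suc (max m n))" using op[of h1 "max m n" h2 3] by simp
    then show ?case by blast
  qed
  then have sub: "generate_field R H \<subseteq> (\<Union>n. S n)" by blast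
  have nat: "|UNIV :: nat set| \<le>o |A|"
    using A infinite_iff_card_of_nat by blast
  have "|S n| \<le>o |A|" for n
  proof (induction n)
    case 0
    have "|H| \<le>o |A|" unfolding H by (rule card_of_image)
    moreover have "|{\<one>\<^bsub>R\<^esub>}| \<le>o |A|"
      using A by (intro card_of_singl_ordLeq) auto
    ultimately have "|{\<one>\<^bsub>R\<^esub>} \<union> H| \<le>o |A|"
      using A by (intro card_of_Un_ordLeq_infinite_Field) (simp_all add: Field_card_of card_of_card_order_on)
    then show ?case by (simp add: S0)
  next
    case (Suc n)
    have "|UNIV \<times> S n \<times> S n :: (nat \<times> _ \<times> _) set| \<le>o |A|"
      using A nat Suc by (intro card_of_Times_ordLeq_infinite_Field) (simp_all add: Field_card_of card_of_card_order_on)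
    then show ?case unfolding SS using card_of_image ordLeq_transitive by blast
  qed
  then have "|\<Union>n. S n| \<le>o |A|"
    using A nat by (intro card_of_UNION_ordLeq_infinite) auto
  then have "|generate_field R H| \<le>o |A|"
    using sub card_of_mono1 ordLeq_transitive by blast
  then show ?thesis by (simp add: card_of_ordLeq)
qed

text \<open>The universal property quantifies over fields on the type of the elements of \<open>R\<close> only. Any field $L$
  over an infinite \<open>R\<close> can still be tested: the skew field generated by the image of \<open>R\<close> is
  small enough to be copied into that type.\<close>

lemma epic_copy:
  fixes R :: "('r, 'c) ring_scheme"
  assumes L: "skew_field L" and j: "j \<in> ring_hom R L" and inf: "infinite (carrier R)"
  shows "\<exists>(K :: 'r ring) h. h \<in> ring_iso (L\<lparr>carrier := generate_field L (j ` carrier R)\<rparr>) K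
           \<and> epic_field_over R K (h \<circ> j)"
proof -
  interpret L: skew_field L by fact
  let ?G = "generate_field L (j ` carrier R)"
  have jL: "j ` carrier R \<subseteq> carrier L" using j by (auto simp: ring_hom_def)
  have G: "skew_subfield ?G L" by (rule L.generate_field_skew_subfield[OF jL])
  let ?L = "L\<lparr>carrier := ?G\<rparr>"
  have L': "skew_field ?L" by (rule L.skew_subfield_imp_skew_field[OF G])
  interpret L': skew_field ?L by (rule L')
  obtain h :: "_ \<Rightarrow> 'r" where h: "inj_on h ?G"
    using generate_field_card[OF inf refl, of L j] by blast
  define K where "K = image_ring h ?L"
  have iso: "h \<in> ring_iso ?L K" unfolding K_def by (rule inj_imp_image_ring_iso) (use h in simp)
  have "ring K" unfolding K_def by (rule L'.inj_imp_image_ring_is_ring) (use h in simp)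
  then have K: "skew_field K" by (rule skew_field_ring_iso[OF L' _ iso])
  interpret K: skew_field K by (rule K)
  have jG: "j r \<in> ?G" if "r \<in> carrier R" for r by (rule generate_field.incl[OF imageI[OF that]])
  have hom: "h \<in> ring_hom ?L K" and im: "h ` ?G = carrier K" using iso by (auto simp: ring_iso_def bij_betw_def)
  interpret h: ring_hom_ring ?L K h by (intro ring_hom_ringI2 hom L'.ring_axioms K.ring_axioms)
  have "j \<in> ring_hom R ?L"
    using j jG unfolding ring_hom_def by simp
  then have hj: "h \<circ> j \<in> ring_hom R K" using hom by (rule ring_hom_trans)
  let ?H = "(h \<circ> j) ` carrier R"
  have sub: "skew_subfield (generate_field K ?H) K"
    by (rule K.generate_field_skew_subfield) (use ring_hom_closed[OF hj] in blast)
  have "h x \<in> generate_field K ?H" if "x \<in> ?G" for x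
    using that
  proof (induction rule: generate_field.induct)
    case one
    then show ?case using h.hom_one generate_field.one[of K ?H] by simp
  next
    case (incl x)
    then have "h x \<in> ?H" by (auto simp: image_iff)
    then show ?case by (rule generate_field.incl)
  next
    case (a_inv x)
    have xL: "x \<in> carrier L" using a_inv.hyps skew_subfieldD(1)[OF G] by auto
    have "\<ominus>\<^bsub>?L\<^esub> x = \<ominus>\<^bsub>L\<^esub> x"
      using a_inv.hyps xL skew_subfieldD(4)[OF G]
      by (intro L'.minus_equality) (auto simp: L.l_neg)
    then have "h (\<ominus>\<^bsub>L\<^esub> x) = \<ominus>\<^bsub>K\<^esub> h x" using h.hom_a_inv[of x] a_inv.hyps by simp
    then show ?case using a_inv.IH by (simp add: generate_field.a_inv)
  next
    case (m_inv x)
    have xL: "x \<in> carrier L" using m_inv.hyps skew_subfieldD(1)[OF G] by auto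
    have "inv\<^bsub>?L\<^esub> x = inv\<^bsub>L\<^esub> x"
      using m_inv.hyps xL skew_subfieldD(7)[OF G] L.inv_nonzero[OF xL]
      by (intro L'.inv_eqI) auto
    then have "h (inv\<^bsub>L\<^esub> x) = inv\<^bsub>K\<^esub> h x" "h x \<noteq> \<zero>\<^bsub>K\<^esub>"
      using ring_hom_skew_field_inv[OF L' K hom, of x] m_inv.hyps by simp_all
    then show ?case using m_inv.IH by (simp add: generate_field.m_inv)
  next
    case (eng_add x y)
    then show ?case using h.hom_add[of x y] by (simp add: generate_field.eng_add)
  next
    case (eng_mult x y)
    then show ?case using h.hom_mult[of x y] by (simp add: generate_field.eng_mult)
  qed
  then have "carrier K \<subseteq> generate_field K ?H" unfolding im[symmetric] by blast
  then have "generate_field K ?H = carrier K" using skew_subfieldD(1)[OF sub] by blast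
  then have "epic_field_over R K (h \<circ> j)"
    using K hj unfolding epic_field_over_def field_over_def by blast
  then show ?thesis using iso by blast
qed

text \<open>A local homomorphism without reference to a base ring, so that such maps compose.\<close>

definition place :: "('k, 'd) ring_scheme \<Rightarrow> ('l, 'e) ring_scheme \<Rightarrow> 'k set \<Rightarrow> ('k \<Rightarrow> 'l) \<Rightarrow> bool" where
  "place K L A \<alpha> \<longleftrightarrow> subring A K \<and> \<alpha> \<in> ring_hom (K\<lparr>carrier := A\<rparr>) L
     \<and> (\<forall>a\<in>A. \<alpha> a \<noteq> \<zero>\<^bsub>L\<^esub> \<longrightarrow> a \<in> Units (K\<lparr>carrier := A\<rparr>))"

lemma local_homs_place:
  "(A, \<alpha>) \<in> local_homs R K i L j \<longleftrightarrow>
     place K L A \<alpha> \<and> i ` carrier R \<subseteq> A \<and> (\<forall>r\<in>carrier R. \<alpha> (i r) = j r)"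
  by (auto simp: local_homs_def place_def)

lemma placeD:
  assumes "place K L A \<alpha>"
  shows "\<And>a. a \<in> A \<Longrightarrow> a \<in> carrier K" "\<zero>\<^bsub>K\<^esub> \<in> A" "\<one>\<^bsub>K\<^esub> \<in> A"
    "\<And>a. a \<in> A \<Longrightarrow> \<ominus>\<^bsub>K\<^esub> a \<in> A" "\<And>a b. a \<in> A \<Longrightarrow> b \<in> A \<Longrightarrow> a \<otimes>\<^bsub>K\<^esub> b \<in> A"
    "\<And>a b. a \<in> A \<Longrightarrow> b \<in> A \<Longrightarrow> a \<oplus>\<^bsub>K\<^esub> b \<in> A" "\<And>a. a \<in> A \<Longrightarrow> \<alpha> a \<in> carrier L"
    "\<alpha> \<one>\<^bsub>K\<^esub> = \<one>\<^bsub>L\<^esub>" "\<And>a b. a \<in> A \<Longrightarrow> b \<in> A \<Longrightarrow> \<alpha> (a \<otimes>\<^bsub>K\<^esub> b) = \<alpha> a \<otimes>\<^bsub>L\<^esub> \<alpha> b"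
    "\<And>a b. a \<in> A \<Longrightarrow> b \<in> A \<Longrightarrow> \<alpha> (a \<oplus>\<^bsub>K\<^esub> b) = \<alpha> a \<oplus>\<^bsub>L\<^esub> \<alpha> b"
    "\<And>a. a \<in> A \<Longrightarrow> \<alpha> a \<noteq> \<zero>\<^bsub>L\<^esub> \<Longrightarrow> a \<in> Units (K\<lparr>carrier := A\<rparr>)"
  using assms subringE[of A K] by (auto simp: place_def ring_hom_def)

lemma place_uminus:
  assumes "ring K" "ring L" "place K L A \<alpha>" "a \<in> A"
  shows "\<alpha> (\<ominus>\<^bsub>K\<^esub> a) = \<ominus>\<^bsub>L\<^esub> \<alpha> a" "\<alpha> \<zero>\<^bsub>K\<^esub> = \<zero>\<^bsub>L\<^esub>"
proof -
  interpret K: ring K by fact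
  interpret L: ring L by fact
  note p = placeD[OF assms(3)]
  have "\<alpha> \<zero>\<^bsub>K\<^esub> \<oplus>\<^bsub>L\<^esub> \<alpha> \<zero>\<^bsub>K\<^esub> = \<alpha> \<zero>\<^bsub>K\<^esub>" using p(10)[OF p(2,2)] by simp
  then show z: "\<alpha> \<zero>\<^bsub>K\<^esub> = \<zero>\<^bsub>L\<^esub>" using p(7)[OF p(2)] by simp
  have "\<alpha> (\<ominus>\<^bsub>K\<^esub> a) \<oplus>\<^bsub>L\<^esub> \<alpha> a = \<zero>\<^bsub>L\<^esub>"
    using p(10)[OF p(4)[OF assms(4)] assms(4)] p(1)[OF assms(4)] z by (simp add: K.l_neg)
  then show "\<alpha> (\<ominus>\<^bsub>K\<^esub> a) = \<ominus>\<^bsub>L\<^esub> \<alpha> a"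
    using p(7)[OF assms(4)] p(7)[OF p(4)[OF assms(4)]] by (metis L.minus_equality)
qed

lemma place_comp:
  assumes K: "skew_field K" and L: "skew_field L" and N: "ring N"
    and \<alpha>: "place K L A \<alpha>" and \<beta>: "place L N B \<beta>"
  shows "place K N {a \<in> A. \<alpha> a \<in> B} (\<beta> \<circ> \<alpha>)"
proof -
  interpret K: skew_field K by fact
  interpret L: skew_field L by fact
  interpret N: ring N by fact
  note a = placeD[OF \<alpha>] and b = placeD[OF \<beta>]
  note neg = place_uminus[OF K.ring_axioms L.ring_axioms \<alpha>] 
  let ?C = "{a \<in> A. \<alpha> a \<in> B}"
  have "subring ?C K"
    by (rule K.subringI) (use a b neg in auto)
  moreover have "\<beta> \<circ> \<alpha> \<in> ring_hom (K\<lparr>carrier := ?C\<rparr>) N"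
    by (rule ring_hom_memI) (use a b in auto)
  moreover have "u \<in> Units (K\<lparr>carrier := ?C\<rparr>)" if u: "u \<in> A" "\<alpha> u \<in> B" "\<beta> (\<alpha> u) \<noteq> \<zero>\<^bsub>N\<^esub>" for u
  proof -
    obtain v where v: "v \<in> B" "\<alpha> u \<otimes>\<^bsub>L\<^esub> v = \<one>\<^bsub>L\<^esub>" using b(11)[OF u(2,3)] by (auto simp: Units_def)
    have c: "v \<in> carrier L" "\<alpha> u \<in> carrier L" using v u a b by auto
    have "\<alpha> u \<noteq> \<zero>\<^bsub>L\<^esub>" using v c L.one_not_zero by auto
    then obtain w where w: "w \<in> A" "u \<otimes>\<^bsub>K\<^esub> w = \<one>\<^bsub>K\<^esub>" "w \<otimes>\<^bsub>K\<^esub> u = \<one>\<^bsub>K\<^esub>"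
      using a(11)[OF u(1)] by (auto simp: Units_def)
    have "\<alpha> u \<otimes>\<^bsub>L\<^esub> \<alpha> w = \<one>\<^bsub>L\<^esub>" using a(9)[OF u(1) w(1)] w a(8) by simp
    then have "\<alpha> w = v" using L.inv_eqI[OF c(2) c(1) v(2)] L.inv_eqI[OF c(2) a(7)[OF w(1)]] by simp
    then show ?thesis using u v w by (auto simp: Units_def)
  qed
  ultimately show ?thesis by (auto simp: place_def)
qed

text \<open>The universal property yields a specialization \<open>\<beta>'\<close> from \<open>U\<close> to \<open>L\<close>, defined on a subring \<open>K0\<close>.
  Its composition \<open>\<gamma>\<close> with \<open>\<alpha>\<close> is a specialization from \<open>U\<close> to \<open>U\<close> and must agree with the identity on
  some subring that is the domain of a local homomorphism. On that subring nothing but \<open>0\<close> is sent to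
  \<open>0\<close>, so it is a skew subfield, and being generated by \<open>R\<close> the field \<open>U\<close> has no proper one over \<open>R\<close>.\<close>

lemma universal_field_extension:
  fixes R :: "('r, 'c) ring_scheme"
  assumes univ: "universal_field_over R U \<iota>" and inf: "infinite (carrier R)"
    and L: "skew_field L" and \<alpha>: "place L U A \<alpha>"
    and j: "j \<in> ring_hom R L" "j ` carrier R \<subseteq> A" and \<alpha>j: "\<And>r. r \<in> carrier R \<Longrightarrow> \<alpha> (j r) = \<iota> r"
  shows "\<exists>f\<in>ring_hom U L. f ` carrier U \<subseteq> A \<and> (\<forall>r\<in>carrier R. f (\<iota> r) = j r)"
proof -
  have U: "skew_field U" and \<iota>: "\<iota> \<in> ring_hom R U" and gen: "generate_field U (\<iota> ` carrier R) = carrier U"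
    using univ by (auto simp: universal_field_over_def epic_field_over_def field_over_def)
  interpret U: skew_field U by (rule U)
  interpret L: skew_field L by (rule L)
  let ?G = "generate_field L (j ` carrier R)"
  have G: "skew_subfield ?G L" by (rule L.generate_field_skew_subfield) (use j in \<open>auto simp: ring_hom_def\<close>)
  have jG: "j r \<in> ?G" if "r \<in> carrier R" for r by (rule generate_field.incl[OF imageI[OF that]])
  obtain K :: "'r ring" and h where h: "h \<in> ring_iso (L\<lparr>carrier := ?G\<rparr>) K" and epK: "epic_field_over R K (h \<circ> j)"
    using epic_copy[OF L j(1) inf] by blast
  have K: "skew_field K" using epK by (auto simp: epic_field_over_def field_over_def)
  have L': "ring (L\<lparr>carrier := ?G\<rparr>)" by (rule skew_field.axioms(1)[OF L.skew_subfield_imp_skew_field[OF G]])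
  define g where "g = inv_into ?G h"
  have gh: "g (h x) = x" if "x \<in> ?G" for x
    using h that by (auto simp: ring_iso_def bij_betw_def g_def)
  have "g \<in> ring_iso K (L\<lparr>carrier := ?G\<rparr>)" using ring_iso_set_sym[OF L' h] by (simp add: g_def)
  then have gL: "g \<in> ring_hom K L"
    using skew_subfieldD(1)[OF G] by (auto simp: ring_iso_def ring_hom_def)
  obtain K0 \<beta> where K0: "(K0, \<beta>) \<in> local_homs R U \<iota> K (h \<circ> j)"
  proof -
    have "\<exists>s. s \<in> specializations R U \<iota> K (h \<circ> j)"
      using univ epK unfolding universal_field_over_def by blast
    then show ?thesis using that unfolding specializations_def quotient_def by auto
  qed
  have pl: "place U K K0 \<beta>" and \<iota>K0: "\<iota> ` carrier R \<subseteq> K0" and \<beta>\<iota>: "\<And>r. r \<in> carrier R \<Longrightarrow> \<beta> (\<iota> r) = h (j r)"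
    using K0 by (auto simp: local_homs_place)
  have plg: "place K L (carrier K) g"
  proof -
    interpret K: skew_field K by (rule K)
    show ?thesis
      unfolding place_def using gL K.carrier_is_subring K.skew_field_Units
        ring_hom_zero[OF gL K.ring_axioms L.ring_axioms] by auto
  qed
  define \<beta>' where "\<beta>' = g \<circ> \<beta>"
  have pl': "place U L K0 \<beta>'"
    using place_comp[OF U K L.ring_axioms pl plg] placeD(7)[OF pl] unfolding \<beta>'_def
    by (metis (no_types, lifting) Collect_cong Collect_mem_eq)
  have \<beta>'\<iota>: "\<beta>' (\<iota> r) = j r" if "r \<in> carrier R" for r using that jG by (simp add: \<beta>'_def \<beta>\<iota> gh)
  \<comment> \<open>The composition of \<open>\<beta>'\<close> and \<open>\<alpha>\<close>, on the largest subring where it makes sense\<close>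
  define K1 where "K1 = {u \<in> K0. \<beta>' u \<in> A}"
  define \<gamma> where "\<gamma> = \<alpha> \<circ> \<beta>'"
  have pl1: "place U U K1 \<gamma>"
    unfolding K1_def \<gamma>_def by (rule place_comp[OF U L U.ring_axioms pl' \<alpha>])
  have \<gamma>\<iota>: "\<gamma> (\<iota> r) = \<iota> r" "\<iota> r \<in> K1" if "r \<in> carrier R" for r
    using that j \<iota>K0 by (auto simp: \<gamma>_def K1_def \<beta>'\<iota> \<alpha>j)
  \<comment> \<open>To invoke uniqueness, the target \<open>U\<close> also needs a copy \<open>Q\<close> on the type of the elements of \<open>R\<close>.\<close>
  obtain Q :: "'r ring" and h' where h'iso: "h' \<in> ring_iso U Q" and epQ: "epic_field_over R Q (h' \<circ> \<iota>)"
    using epic_copy[OF U \<iota> inf] by (auto simp: gen)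
  have Q: "skew_field Q" using epQ by (auto simp: epic_field_over_def field_over_def)
  have h': "h' \<in> ring_hom U Q" "inj_on h' (carrier U)" using h'iso by (auto simp: ring_iso_def bij_betw_def)
  interpret h': ring_hom_ring U Q h' using Q by (intro ring_hom_ringI2 U.ring_axioms h') (auto simp: skew_field_def)
  have h'z: "h' u = \<zero>\<^bsub>Q\<^esub> \<longleftrightarrow> u = \<zero>\<^bsub>U\<^esub>" if "u \<in> carrier U" for u
    using that inj_onD[OF h'(2), of u "\<zero>\<^bsub>U\<^esub>"] by auto
  have plh: "place U Q (carrier U) h'"
    unfolding place_def using U.carrier_is_subring h' U.skew_field_Units h'z by auto
  have "{a \<in> K1. \<gamma> a \<in> carrier U} = K1" using placeD(7)[OF pl1] by blast
  then have plQ: "place U Q K1 (h' \<circ> \<gamma>)"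
    using place_comp[OF U U h'.S.ring_axioms pl1 plh] by simp
  have l1: "(K1, h' \<circ> \<gamma>) \<in> local_homs R U \<iota> Q (h' \<circ> \<iota>)"
    unfolding local_homs_place using plQ \<gamma>\<iota> by auto
  have l2: "(carrier U, h') \<in> local_homs R U \<iota> Q (h' \<circ> \<iota>)"
    unfolding local_homs_place using plh \<iota> by (auto simp: ring_hom_def)
  let ?rel = "local_hom_rel R U \<iota> Q (h' \<circ> \<iota>)"
  \<comment> \<open>Both \<open>\<gamma>\<close> and the identity represent the only specialization from \<open>U\<close> to \<open>Q\<close>.\<close>
  have "?rel `` {(K1, h' \<circ> \<gamma>)} = ?rel `` {(carrier U, h')}"
    using univ epQ quotientI[OF l1, of ?rel] quotientI[OF l2, of ?rel]
    unfolding universal_field_over_def specializations_def by blast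
  then have "((K1, h' \<circ> \<gamma>), (carrier U, h')) \<in> ?rel"
    using eq_equiv_class[OF _ local_hom_rel_equiv[OF U] l2] by blast
  then obtain S where S: "S \<subseteq> K1" "\<And>a. a \<in> S \<Longrightarrow> h' (\<gamma> a) = h' a" "(S, h' \<circ> \<gamma>) \<in> local_homs R U \<iota> Q (h' \<circ> \<iota>)"
    unfolding local_hom_rel_def by auto
  have plS: "place U Q S (h' \<circ> \<gamma>)" and \<iota>S: "\<iota> ` carrier R \<subseteq> S"
    using S(3) by (auto simp: local_homs_place)
  have Sc: "S \<subseteq> carrier U" using placeD(1)[OF plS] by blast
  have "skew_subfield S U"
    unfolding skew_subfield_def
  proof (intro conjI ballI impI)
    show "subring S U" using plS by (simp add: place_def)
    fix a assume a: "a \<in> S" "a \<noteq> \<zero>\<^bsub>U\<^esub>"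
    then have "(h' \<circ> \<gamma>) a \<noteq> \<zero>\<^bsub>Q\<^esub>" using S(2) h'z Sc by auto
    then obtain b where b: "b \<in> S" "a \<otimes>\<^bsub>U\<^esub> b = \<one>\<^bsub>U\<^esub>" using placeD(11)[OF plS a(1)] by (auto simp: Units_def)
    have "inv\<^bsub>U\<^esub> a = b" using U.inv_eqI[OF _ _ b(2)] a b Sc by auto
    then show "inv\<^bsub>U\<^esub> a \<in> S" using b by simp
  qed
  then have "carrier U \<subseteq> S" using generate_field_least[OF _ \<iota>S] gen by auto
  then have K1U: "K1 = carrier U" using S(1) placeD(1)[OF pl1] by auto
  have K0U: "K0 = carrier U" using K1U placeD(1)[OF pl] by (auto simp: K1_def)
  have 1: "\<beta>' \<in> ring_hom U L" using pl' unfolding place_def K0U by simp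
  have 2: "\<beta>' ` carrier U \<subseteq> A" using K1U unfolding K1_def by blast
  show ?thesis by (intro bexI[OF _ 1] conjI ballI 2 \<beta>'\<iota>)
qed

section \<open>Skew Laurent series\<close>

text \<open>The series $\sum_i f_i t^i$, with finitely many terms of negative degree, are multiplied by the rule
  $t^i a = S_i(a)\, t^i$. The twist is given as a family indexed by the integers, so that the inverse of
  the automorphism $S_1$ is at hand as $S_{-1}$.\<close>

definition laurent :: "('f, 'm) ring_scheme \<Rightarrow> (int \<Rightarrow> 'f \<Rightarrow> 'f) \<Rightarrow> (int \<Rightarrow> 'f) ring" where
  "laurent F S =
     \<lparr>carrier = {f. (\<forall>i. f i \<in> carrier F) \<and> (\<exists>N. \<forall>i<N. f i = \<zero>\<^bsub>F\<^esub>)},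
      mult = (\<lambda>f g n. finsum F (\<lambda>i. f i \<otimes>\<^bsub>F\<^esub> S i (g (n - i)))
                {i. f i \<noteq> \<zero>\<^bsub>F\<^esub> \<and> g (n - i) \<noteq> \<zero>\<^bsub>F\<^esub>}),
      one = monomial F \<one>\<^bsub>F\<^esub> 0,
      zero = (\<lambda>i. \<zero>\<^bsub>F\<^esub>),
      add = (\<lambda>f g i. f i \<oplus>\<^bsub>F\<^esub> g i)\<rparr>"

definition power_series :: "('f, 'm) ring_scheme \<Rightarrow> (int \<Rightarrow> 'f \<Rightarrow> 'f) \<Rightarrow> (int \<Rightarrow> 'f) set" where
  "power_series F S = {f \<in> carrier (laurent F S). \<forall>i<0. f i = \<zero>\<^bsub>F\<^esub>}"

lemma (in ring) finsum_mono_neutral: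
  assumes "finite A" "B \<subseteq> A" "\<And>i. i \<in> A \<Longrightarrow> f i \<in> carrier R" "\<And>i. i \<in> A - B \<Longrightarrow> f i = \<zero>"
  shows "finsum R f A = finsum R f B"
  by (rule add.finprod_mono_neutral_cong_right) (use assms in auto)

locale skew_laurent = F: skew_field F for F (structure) +
  fixes S :: "int \<Rightarrow> 'a \<Rightarrow> 'a"
  assumes S_hom: "S i \<in> ring_hom F F"
    and S_zero: "a \<in> carrier F \<Longrightarrow> S 0 a = a"
    and S_add: "a \<in> carrier F \<Longrightarrow> S (i + j) a = S i (S j a)"
begin

abbreviation L where "L \<equiv> laurent F S"

lemma S_closed [simp]: "a \<in> carrier F \<Longrightarrow> S i a \<in> carrier F"
  using S_hom[of i] by (auto simp: ring_hom_def)

lemma S_0 [simp]: "S i \<zero> = \<zero>"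
proof -
  interpret ring_hom_ring F F "S i" by (intro ring_hom_ringI2 F.ring_axioms S_hom)
  show ?thesis by simp
qed

lemma S_1 [simp]: "S i \<one> = \<one>"
  using S_hom[of i] by (auto simp: ring_hom_def)

lemma S_mult: "a \<in> carrier F \<Longrightarrow> b \<in> carrier F \<Longrightarrow> S i (a \<otimes> b) = S i a \<otimes> S i b"
  using S_hom[of i] by (auto simp: ring_hom_def)

lemma S_plus: "a \<in> carrier F \<Longrightarrow> b \<in> carrier F \<Longrightarrow> S i (a \<oplus> b) = S i a \<oplus> S i b"
  using S_hom[of i] by (auto simp: ring_hom_def)

lemma S_finsum: 
  assumes "finite A" "\<And>j. j \<in> A \<Longrightarrow> f j \<in> carrier F"
  shows "S i (finsum F f A) = (\<Oplus>j\<in>A. S i (f j))"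
proof -
  interpret ring_hom_ring F F "S i" by (intro ring_hom_ringI2 F.ring_axioms S_hom)
  show ?thesis using assms by (subst hom_finsum) (auto simp: comp_def)
qed

lemma coeff_closed [simp]: "f \<in> carrier L \<Longrightarrow> f i \<in> carrier F"
  by (simp add: laurent_def)

lemma lower_bound: "f \<in> carrier L \<Longrightarrow> \<exists>N. \<forall>i<N. f i = \<zero>"
  by (simp add: laurent_def del: coeff_closed)

lemma laurentI: "(\<And>i. f i \<in> carrier F) \<Longrightarrow> (\<And>i. i < N \<Longrightarrow> f i = \<zero>) \<Longrightarrow> f \<in> carrier L"
  by (auto simp: laurent_def simp del: coeff_closed)

lemma add_coeff: "(f \<oplus>\<^bsub>L\<^esub> g) i = f i \<oplus> g i"
  by (simp add: laurent_def del: coeff_closed)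

lemma zero_coeff: "\<zero>\<^bsub>L\<^esub> i = \<zero>"
  by (simp add: laurent_def del: coeff_closed)

lemma one_eq: "\<one>\<^bsub>L\<^esub> = monomial F \<one> 0"
  by (simp add: laurent_def del: coeff_closed)

lemma mult_coeff:
  assumes f: "\<And>i. f i \<in> carrier F" and g: "\<And>i. g i \<in> carrier F" and A: "finite A"
    and sub: "\<And>i. f i \<noteq> \<zero> \<Longrightarrow> g (n - i) \<noteq> \<zero> \<Longrightarrow> i \<in> A"
  shows "(f \<otimes>\<^bsub>L\<^esub> g) n = (\<Oplus>i\<in>A. f i \<otimes> S i (g (n - i)))"
proof -
  have "(f \<otimes>\<^bsub>L\<^esub> g) n = (\<Oplus>i\<in>{i. f i \<noteq> \<zero> \<and> g (n - i) \<noteq> \<zero>}. f i \<otimes> S i (g (n - i)))"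
    by (simp add: laurent_def del: coeff_closed)
  also have "\<dots> = (\<Oplus>i\<in>A. f i \<otimes> S i (g (n - i)))"
  proof (rule F.finsum_mono_neutral[symmetric])
    show "f i \<otimes> S i (g (n - i)) = \<zero>" if "i \<in> A - {i. f i \<noteq> \<zero> \<and> g (n - i) \<noteq> \<zero>}" for i
    proof -
      from that have "f i = \<zero> \<or> g (n - i) = \<zero>" by auto
      then show ?thesis using f[of i] g[of "n - i"] by auto
    qed
  qed (use f g A sub in auto)
  finally show ?thesis .
qed

lemma mult_coeff_interval:
  assumes f: "f \<in> carrier L" and g: "g \<in> carrier L"
    and a: "\<And>i. i < a \<Longrightarrow> f i = \<zero>" and b: "\<And>i. i < b \<Longrightarrow> g i = \<zero>"
  shows "(f \<otimes>\<^bsub>L\<^esub> g) n = (\<Oplus>i\<in>{a..n - b}. f i \<otimes> S i (g (n - i)))"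
proof (rule mult_coeff)
  fix i assume "f i \<noteq> \<zero>" "g (n - i) \<noteq> \<zero>"
  then have "\<not> i < a" "\<not> n - i < b" using a b by blast+
  then show "i \<in> {a..n-b}" by auto
qed (use f g in auto)

lemma mult_below:
  assumes "f \<in> carrier L" "g \<in> carrier L"
    and "\<And>i. i < a \<Longrightarrow> f i = \<zero>" "\<And>i. i < b \<Longrightarrow> g i = \<zero>" "n < a + b"
  shows "(f \<otimes>\<^bsub>L\<^esub> g) n = \<zero>"
  using assms by (subst mult_coeff_interval[of _ _ a b]) auto

lemma mult_lowest:
  assumes "f \<in> carrier L" "g \<in> carrier L"
    and "\<And>i. i < a \<Longrightarrow> f i = \<zero>" "\<And>i. i < b \<Longrightarrow> g i = \<zero>"
  shows "(f \<otimes>\<^bsub>L\<^esub> g) (a + b) = f a \<otimes> S a (g b)"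
  using assms by (subst mult_coeff_interval[of _ _ a b]) auto

lemma mult_closed [simp]:
  assumes f: "f \<in> carrier L" and g: "g \<in> carrier L"
  shows "f \<otimes>\<^bsub>L\<^esub> g \<in> carrier L"
proof -
  obtain a b where ab: "\<forall>i<a. f i = \<zero>" "\<forall>i<b. g i = \<zero>" using lower_bound f g by metis
  show ?thesis
  proof (rule laurentI)
    show "(f \<otimes>\<^bsub>L\<^esub> g) n \<in> carrier F" for n
      using f g ab by (subst mult_coeff_interval[of _ _ a b]) (auto intro!: F.finsum_closed)
    show "(f \<otimes>\<^bsub>L\<^esub> g) n = \<zero>" if "n < a + b" for n
      using ab that by (intro mult_below[OF f g, of a b]) auto
  qed
qed

lemma add_closed [simp]:
  assumes f: "f \<in> carrier L" and g: "g \<in> carrier L"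
  shows "f \<oplus>\<^bsub>L\<^esub> g \<in> carrier L"
proof -
  obtain a b where ab: "\<forall>i<a. f i = \<zero>" "\<forall>i<b. g i = \<zero>" using lower_bound f g by metis
  show ?thesis
    by (rule laurentI[where N = "min a b"]) (use f g ab in \<open>auto simp: add_coeff\<close>)
qed

lemma monomial_closed [simp]: "c \<in> carrier F \<Longrightarrow> monomial F c n \<in> carrier L"
  by (rule laurentI[where N = n]) (auto simp: monomial_def)

lemma mult_monomial:
  assumes f: "f \<in> carrier L" and c: "c \<in> carrier F"
  shows "(f \<otimes>\<^bsub>L\<^esub> monomial F c m) n = f (n - m) \<otimes> S (n - m) c"
proof -
  have "(f \<otimes>\<^bsub>L\<^esub> monomial F c m) n
      = (\<Oplus>i\<in>{n - m}. f i \<otimes> S i (monomial F c m (n - i)))"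
    by (rule mult_coeff) (use f c in \<open>auto simp: monomial_def split: if_splits\<close>)
  then show ?thesis using f c by (simp add: monomial_def)
qed

lemma monomial_mult:
  assumes f: "f \<in> carrier L" and c: "c \<in> carrier F"
  shows "(monomial F c m \<otimes>\<^bsub>L\<^esub> f) n = c \<otimes> S m (f (n - m))"
proof -
  have "(monomial F c m \<otimes>\<^bsub>L\<^esub> f) n
      = (\<Oplus>i\<in>{m}. monomial F c m i \<otimes> S i (f (n - i)))"
    by (rule mult_coeff) (use f c in \<open>auto simp: monomial_def split: if_splits\<close>)
  then show ?thesis using f c by (simp add: monomial_def)
qed

text \<open>With the lower bounds \<open>a\<close>, \<open>b\<close>, \<open>c\<close> of the supports, one pair of index ranges serves both bracketings of
  the coefficient of $t^n$: \<open>i\<close> is the degree taken from \<open>f\<close>, and \<open>p\<close> the total degree taken from \<open>f\<close> and \<open>g\<close>.\<close>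

lemma mult_assoc:
  assumes f: "f \<in> carrier L" and g: "g \<in> carrier L" and h: "h \<in> carrier L"
  shows "f \<otimes>\<^bsub>L\<^esub> g \<otimes>\<^bsub>L\<^esub> h = f \<otimes>\<^bsub>L\<^esub> (g \<otimes>\<^bsub>L\<^esub> h)"
proof
  fix n
  obtain a b c where "\<forall>i<a. f i = \<zero>" "\<forall>i<b. g i = \<zero>" "\<forall>i<c. h i = \<zero>"
    using lower_bound f g h by metis
  then have low: "f i \<noteq> \<zero> \<Longrightarrow> a \<le> i" "g i \<noteq> \<zero> \<Longrightarrow> b \<le> i" "h i \<noteq> \<zero> \<Longrightarrow> c \<le> i" for i
    by (meson not_less)+
  then have low2: "(f \<otimes>\<^bsub>L\<^esub> g) i \<noteq> \<zero> \<Longrightarrow> a + b \<le> i" "(g \<otimes>\<^bsub>L\<^esub> h) i \<noteq> \<zero> \<Longrightarrow> b + c \<le> i" for i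
    using mult_below[OF f g, of a b i] mult_below[OF g h, of b c i] by (meson not_less)+
  define A where "A = {a..n - b - c}"
  define P where "P = {a + b..n - c}"
  have fin: "finite A" "finite P" by (simp_all add: A_def P_def)
  let ?t = "\<lambda>i p. f i \<otimes> S i (g (p - i)) \<otimes> S p (h (n - p))"
  have "(f \<otimes>\<^bsub>L\<^esub> g \<otimes>\<^bsub>L\<^esub> h) n = (\<Oplus>p\<in>P. (f \<otimes>\<^bsub>L\<^esub> g) p \<otimes> S p (h (n - p)))"
  proof (rule mult_coeff)
    fix p assume "(f \<otimes>\<^bsub>L\<^esub> g) p \<noteq> \<zero>" "h (n - p) \<noteq> \<zero>"
    then show "p \<in> P" using low2(1)[of p] low(3)[of "n - p"] by (auto simp: P_def)
  qed (use f g h fin in auto)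
  also have "\<dots> = (\<Oplus>p\<in>P. \<Oplus>i\<in>A. ?t i p)"
  proof (rule F.finsum_cong'[OF refl])
    fix p assume p: "p \<in> P"
    have "(f \<otimes>\<^bsub>L\<^esub> g) p = (\<Oplus>i\<in>A. f i \<otimes> S i (g (p - i)))"
    proof (rule mult_coeff)
      fix i assume "f i \<noteq> \<zero>" "g (p - i) \<noteq> \<zero>"
      then show "i \<in> A" using low(1)[of i] low(2)[of "p - i"] p by (auto simp: A_def P_def)
    qed (use f g fin in auto)
    then show "(f \<otimes>\<^bsub>L\<^esub> g) p \<otimes> S p (h (n - p)) = (\<Oplus>i\<in>A. ?t i p)"
      using f g h fin by (simp add: F.finsum_ldistr Pi_iff)
  qed (use f g h in \<open>auto intro!: F.finsum_closed\<close>)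
  also have "\<dots> = (\<Oplus>i\<in>A. \<Oplus>p\<in>P. ?t i p)"
    using fin f g h by (intro F.finsum_swap) auto
  also have "\<dots> = (\<Oplus>i\<in>A. f i \<otimes> S i ((g \<otimes>\<^bsub>L\<^esub> h) (n - i)))"
  proof (rule F.finsum_cong'[OF refl])
    fix i assume i: "i \<in> A"
    have "(g \<otimes>\<^bsub>L\<^esub> h) (n - i) = (\<Oplus>q\<in>(\<lambda>p. p - i) ` P. g q \<otimes> S q (h (n - i - q)))"
    proof (rule mult_coeff)
      fix q assume "g q \<noteq> \<zero>" "h (n - i - q) \<noteq> \<zero>"
      then have "q + i \<in> P" using low(2)[of q] low(3)[of "n - i - q"] i by (auto simp: A_def P_def)
      then show "q \<in> (\<lambda>p. p - i) ` P" by force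
    qed (use g h fin in auto)
    also have "\<dots> = (\<Oplus>p\<in>P. g (p - i) \<otimes> S (p - i) (h (n - p)))"
      using g h by (subst F.finsum_reindex) (auto simp: inj_on_def)
    finally have eq: "(g \<otimes>\<^bsub>L\<^esub> h) (n - i) = \<dots>" .
    have "f i \<otimes> S i ((g \<otimes>\<^bsub>L\<^esub> h) (n - i))
        = (\<Oplus>p\<in>P. f i \<otimes> S i (g (p - i) \<otimes> S (p - i) (h (n - p))))"
      unfolding eq using fin f g h by (simp add: S_finsum F.finsum_rdistr Pi_iff)
    also have "\<dots> = (\<Oplus>p\<in>P. ?t i p)"
    proof (rule F.finsum_cong'[OF refl])
      show "f i \<otimes> S i (g (p - i) \<otimes> S (p - i) (h (n - p))) = ?t i p" for p
        using f g h S_add[of "h (n - p)" i "p - i"] by (simp add: S_mult F.m_assoc)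
    qed (use f g h in auto)
    finally show "(\<Oplus>p\<in>P. ?t i p) = f i \<otimes> S i ((g \<otimes>\<^bsub>L\<^esub> h) (n - i))" by simp
  qed (use f g h in auto)
  also have "\<dots> = (f \<otimes>\<^bsub>L\<^esub> (g \<otimes>\<^bsub>L\<^esub> h)) n"
  proof (rule mult_coeff[symmetric])
    fix i assume "f i \<noteq> \<zero>" "(g \<otimes>\<^bsub>L\<^esub> h) (n - i) \<noteq> \<zero>"
    then show "i \<in> A" using low(1)[of i] low2(2)[of "n - i"] by (auto simp: A_def)
  qed (use f g h fin in auto)
  finally show "(f \<otimes>\<^bsub>L\<^esub> g \<otimes>\<^bsub>L\<^esub> h) n = (f \<otimes>\<^bsub>L\<^esub> (g \<otimes>\<^bsub>L\<^esub> h)) n" .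
qed

lemma mult_distr:
  assumes f: "f \<in> carrier L" and g: "g \<in> carrier L" and h: "h \<in> carrier L"
  shows "(f \<oplus>\<^bsub>L\<^esub> g) \<otimes>\<^bsub>L\<^esub> h = f \<otimes>\<^bsub>L\<^esub> h \<oplus>\<^bsub>L\<^esub> g \<otimes>\<^bsub>L\<^esub> h"
    and "h \<otimes>\<^bsub>L\<^esub> (f \<oplus>\<^bsub>L\<^esub> g) = h \<otimes>\<^bsub>L\<^esub> f \<oplus>\<^bsub>L\<^esub> h \<otimes>\<^bsub>L\<^esub> g"
proof -
  obtain a b c where abc: "\<forall>i<a. f i = \<zero>" "\<forall>i<b. g i = \<zero>" "\<forall>i<c. h i = \<zero>"
    using lower_bound f g h by metis
  define e where "e = min a b"
  have e: "\<forall>i<e. f i = \<zero>" "\<forall>i<e. g i = \<zero>" "\<forall>i<e. (f \<oplus>\<^bsub>L\<^esub> g) i = \<zero>"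
    using abc by (auto simp: e_def add_coeff)
  have fg: "f \<oplus>\<^bsub>L\<^esub> g \<in> carrier L" using f g by simp
  show "(f \<oplus>\<^bsub>L\<^esub> g) \<otimes>\<^bsub>L\<^esub> h = f \<otimes>\<^bsub>L\<^esub> h \<oplus>\<^bsub>L\<^esub> g \<otimes>\<^bsub>L\<^esub> h"
  proof
    fix n
    have m: "(u \<otimes>\<^bsub>L\<^esub> h) n = (\<Oplus>i\<in>{e..n - c}. u i \<otimes> S i (h (n - i)))"
      if "u \<in> carrier L" "\<forall>i<e. u i = \<zero>" for u
      using that abc by (intro mult_coeff_interval h) auto
    show "((f \<oplus>\<^bsub>L\<^esub> g) \<otimes>\<^bsub>L\<^esub> h) n = (f \<otimes>\<^bsub>L\<^esub> h \<oplus>\<^bsub>L\<^esub> g \<otimes>\<^bsub>L\<^esub> h) n"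
      unfolding add_coeff m[OF f e(1)] m[OF g e(2)] m[OF fg e(3)]
      using f g h by (subst F.finsum_addf[symmetric]) (auto simp: F.l_distr)
  qed
  show "h \<otimes>\<^bsub>L\<^esub> (f \<oplus>\<^bsub>L\<^esub> g) = h \<otimes>\<^bsub>L\<^esub> f \<oplus>\<^bsub>L\<^esub> h \<otimes>\<^bsub>L\<^esub> g"
  proof
    fix n
    have m: "(h \<otimes>\<^bsub>L\<^esub> u) n = (\<Oplus>i\<in>{c..n - e}. h i \<otimes> S i (u (n - i)))"
      if "u \<in> carrier L" "\<forall>i<e. u i = \<zero>" for u
      using that abc by (intro mult_coeff_interval h) auto
    show "(h \<otimes>\<^bsub>L\<^esub> (f \<oplus>\<^bsub>L\<^esub> g)) n = (h \<otimes>\<^bsub>L\<^esub> f \<oplus>\<^bsub>L\<^esub> h \<otimes>\<^bsub>L\<^esub> g) n"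
      unfolding add_coeff m[OF f e(1)] m[OF g e(2)] m[OF fg e(3)]
      using f g h by (subst F.finsum_addf[symmetric]) (auto simp: F.r_distr S_plus)
  qed
qed

lemma uminus_closed: "f \<in> carrier L \<Longrightarrow> (\<lambda>i. \<ominus> f i) \<in> carrier L"
proof -
  assume f: "f \<in> carrier L"
  obtain N where "\<forall>i<N. f i = \<zero>" using lower_bound f by metis
  then show ?thesis using f by (intro laurentI[where N = N]) auto
qed

lemma laurent_ring: "ring L"
proof (rule ringI)
  show "abelian_group L"
  proof (rule abelian_groupI)
    fix f assume f: "f \<in> carrier L"
    show "\<exists>g\<in>carrier L. g \<oplus>\<^bsub>L\<^esub> f = \<zero>\<^bsub>L\<^esub>"
      using uminus_closed[OF f] f
      by (intro bexI[of _ "\<lambda>i. \<ominus> f i"]) (auto simp: fun_eq_iff add_coeff zero_coeff F.l_neg)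
  qed (auto simp: fun_eq_iff add_coeff zero_coeff F.a_ac intro: laurentI[where N = 0])
  show "monoid L"
    by (rule monoidI) (auto simp: mult_assoc one_eq monomial_mult mult_monomial fun_eq_iff S_zero)
qed (auto simp: mult_distr)

sublocale L: ring L by (rule laurent_ring)

lemma uminus_coeff: "f \<in> carrier L \<Longrightarrow> (\<ominus>\<^bsub>L\<^esub> f) i = \<ominus> f i"
proof -
  assume f: "f \<in> carrier L"
  have "(\<lambda>i. \<ominus> f i) = \<ominus>\<^bsub>L\<^esub> f"
    using f uminus_closed[OF f] 
    by (intro L.minus_equality[symmetric]) (auto simp: fun_eq_iff add_coeff zero_coeff F.l_neg)
  then show ?thesis by metis
qed

text \<open>The coefficients of the inverse are found one after the other: that of $t^{n+1}$ is determined by the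
  earlier ones. The function \<open>h n\<close> holds those up to degree \<open>n\<close> and vanishes above.\<close>

lemma right_inverse_unipotent:
  assumes f: "f \<in> carrier L" and neg: "\<And>i. i < 0 \<Longrightarrow> f i = \<zero>" and f0: "f 0 = \<one>"
  shows "\<exists>g\<in>power_series F S. f \<otimes>\<^bsub>L\<^esub> g = \<one>\<^bsub>L\<^esub>"
proof -
  define h where "h = rec_nat (monomial F \<one> 0 :: int \<Rightarrow> 'a)
     (\<lambda>n h. h(int (Suc n) := \<ominus> (\<Oplus>i\<in>{1..int (Suc n)}. f i \<otimes> S i (h (int (Suc n) - i)))))"
  have h0: "h 0 = monomial F \<one> 0"
    and hS: "h (Suc n) = (h n)(int (Suc n) := \<ominus> (\<Oplus>i\<in>{1..int (Suc n)}. f i \<otimes> S i (h n (int (Suc n) - i))))" for n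
    by (simp_all add: h_def)
  have hc: "h n i \<in> carrier F" for n i
    by (induction n arbitrary: i) (auto simp: h0 hS monomial_def f intro!: F.finsum_closed)
  have stable: "h m i = h n i" if "n \<le> m" "i \<le> int n" for m n i
    using that by (induction m rule: dec_induct) (auto simp: hS)
  have hneg: "h n i = \<zero>" if "i < 0" for n i
    using that by (induction n) (auto simp: h0 hS monomial_def)
  define g where "g i = h (nat i) i" for i
  have gh: "g i = h n i" if "i \<le> int n" for i n
    using that stable[of "nat i" n i] by (cases "i < 0") (simp_all add: g_def hneg nat_le_iff)
  have gneg: "g i = \<zero>" if "i < 0" for i using that by (simp add: g_def hneg)
  have g: "g \<in> carrier L" by (rule laurentI[where N = 0]) (auto simp: g_def hc hneg)
  have "(f \<otimes>\<^bsub>L\<^esub> g) n = \<one>\<^bsub>L\<^esub> n" for n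
  proof -
    consider "n < 0" | "n = 0" | m where "n = int (Suc m)"
      by (cases n rule: int_cases3) (auto, metis Suc_pred of_nat_Suc)
    then show ?thesis
    proof cases
      case 1
      then show ?thesis using mult_below[OF f g, of 0 0 n] neg gneg by (simp add: one_eq monomial_def)
    next
      case 2
      then show ?thesis using mult_lowest[OF f g, of 0 0] neg gneg gh[of 0 0]
        by (simp add: f0 one_eq monomial_def h0 S_zero)
    next
      case 3
      have "(f \<otimes>\<^bsub>L\<^esub> g) n = (\<Oplus>i\<in>{0..n}. f i \<otimes> S i (g (n - i)))"
        using mult_coeff_interval[OF f g, of 0 0 n] neg gneg by simp
      also have "{0..n} = insert 0 {1..n}" using 3 by auto
      also have "(\<Oplus>i\<in>insert 0 {1..n}. f i \<otimes> S i (g (n - i))) = g n \<oplus> (\<Oplus>i\<in>{1..n}. f i \<otimes> S i (g (n - i)))"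
        using f g by (subst F.finsum_insert) (auto simp: f0 S_zero)
      also have "(\<Oplus>i\<in>{1..n}. f i \<otimes> S i (g (n - i))) = (\<Oplus>i\<in>{1..n}. f i \<otimes> S i (h m (n - i)))"
      proof (rule F.finsum_cong'[OF refl])
        show "f i \<otimes> S i (g (n - i)) = f i \<otimes> S i (h m (n - i))" if "i \<in> {1..n}" for i
          using gh[of "n - i" m] that 3 by simp
      qed (use f hc in auto)
      also have "g n = \<ominus> \<dots>"
        using gh[of n "Suc m"] unfolding 3 by (simp add: hS)
      also have "\<dots> \<oplus> (\<Oplus>i\<in>{1..n}. f i \<otimes> S i (h m (n - i))) = \<zero>"
        using f hc by (intro F.l_neg F.finsum_closed) auto
      finally show ?thesis using 3 by (simp add: one_eq monomial_def)
    qed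
  qed
  then show ?thesis using g gneg by (intro bexI[of _ g]) (auto simp: power_series_def)
qed

text \<open>Multiplication with a monomial moves the lowest term to the constant term \<open>1\<close>.\<close>

lemma right_inverse:
  assumes f: "f \<in> carrier L" and low: "\<And>i. i < v \<Longrightarrow> f i = \<zero>" and nz: "f v \<noteq> \<zero>"
  shows "\<exists>g\<in>carrier L. f \<otimes>\<^bsub>L\<^esub> g = \<one>\<^bsub>L\<^esub> \<and> (\<forall>i< - v. g i = \<zero>)"
proof -
  define c where "c = S (- v) (inv (f v))"
  have inv: "inv (f v) \<in> carrier F" using F.inv_nonzero f nz by simp
  then have c: "c \<in> carrier F" by (simp add: c_def)
  have Sc: "S v c = inv (f v)" using S_add[OF inv, of v "- v"] S_zero[OF inv] by (simp add: c_def)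
  let ?m = "monomial F c (- v)"
  have m: "?m \<in> carrier L" using c by simp
  have "(f \<otimes>\<^bsub>L\<^esub> ?m) 0 = \<one>" "\<And>i. i < 0 \<Longrightarrow> (f \<otimes>\<^bsub>L\<^esub> ?m) i = \<zero>"
    using f c low F.inv_nonzero(3)[of "f v"] nz by (simp_all add: mult_monomial Sc)
  then obtain g where g: "g \<in> power_series F S" "f \<otimes>\<^bsub>L\<^esub> ?m \<otimes>\<^bsub>L\<^esub> g = \<one>\<^bsub>L\<^esub>"
    using right_inverse_unipotent[of "f \<otimes>\<^bsub>L\<^esub> ?m"] f m by auto
  then have gL: "g \<in> carrier L" by (simp add: power_series_def)
  have "(?m \<otimes>\<^bsub>L\<^esub> g) i = \<zero>" if "i < - v" for i
    using that g c by (subst monomial_mult) (auto simp: power_series_def)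
  then show ?thesis using g gL f m by (intro bexI[of _ "?m \<otimes>\<^bsub>L\<^esub> g"]) (auto simp: mult_assoc)
qed

text \<open>A nonzero series has a lowest term, so it has a right inverse, and in a ring where that holds for all
  nonzero elements the right inverses are two-sided.\<close>

theorem laurent_skew_field: "skew_field L"
proof (rule skew_fieldI_right_inverse[OF laurent_ring])
  show "\<one>\<^bsub>L\<^esub> \<noteq> \<zero>\<^bsub>L\<^esub>"
    using F.one_not_zero by (auto simp: one_eq fun_eq_iff monomial_def zero_coeff)
  fix f assume f: "f \<in> carrier L" "f \<noteq> \<zero>\<^bsub>L\<^esub>"
  then obtain j where j: "f j \<noteq> \<zero>" by (auto simp: fun_eq_iff zero_coeff)
  obtain N where N: "\<forall>i<N. f i = \<zero>" using lower_bound f by metis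
  define v where "v = (LEAST n. f (N + int n) \<noteq> \<zero>)"
  have ex: "f (N + int (nat (j - N))) \<noteq> \<zero>" 
  proof -
    have "\<not> j < N" using j N by blast
    then show ?thesis using j by simp
  qed
  have "f (N + int v) \<noteq> \<zero>" unfolding v_def by (rule LeastI) (rule ex)
  moreover have "f i = \<zero>" if "i < N + int v" for i
  proof (cases "i < N")
    case False
    then have "nat (i - N) < v" using that by auto
    then have "\<not> f (N + int (nat (i - N))) \<noteq> \<zero>" unfolding v_def by (rule not_less_Least)
    then show ?thesis using False by simp
  qed (use N in auto)
  ultimately show "\<exists>g\<in>carrier L. f \<otimes>\<^bsub>L\<^esub> g = \<one>\<^bsub>L\<^esub>"
    using right_inverse[OF f(1), of "N + int v"] by blast
qed

sublocale L: skew_field L by (rule laurent_skew_field)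

lemma power_series_carrier: "f \<in> power_series F S \<Longrightarrow> f \<in> carrier L"
  and power_series_neg: "f \<in> power_series F S \<Longrightarrow> i < 0 \<Longrightarrow> f i = \<zero>"
  by (auto simp: power_series_def)

lemma power_seriesI: "(\<And>i. f i \<in> carrier F) \<Longrightarrow> (\<And>i. i < 0 \<Longrightarrow> f i = \<zero>) \<Longrightarrow> f \<in> power_series F S"
  by (auto simp: power_series_def intro: laurentI)

lemma power_series_subring: "subring (power_series F S) L"
proof (rule L.subringI)
  show "power_series F S \<subseteq> carrier L" by (auto simp: power_series_def)
  show "\<one>\<^bsub>L\<^esub> \<in> power_series F S" by (auto simp: one_eq monomial_def intro!: power_seriesI)
next
  fix f g assume fg: "f \<in> power_series F S" "g \<in> power_series F S"
  note c = fg[THEN power_series_carrier]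
  show "f \<otimes>\<^bsub>L\<^esub> g \<in> power_series F S"
    using c fg mult_below[OF c, of 0 0] by (auto simp: power_series_def)
  show "f \<oplus>\<^bsub>L\<^esub> g \<in> power_series F S"
    using c fg by (auto simp: power_series_def add_coeff)
  show "\<ominus>\<^bsub>L\<^esub> f \<in> power_series F S"
    using c fg by (auto simp: power_series_def uminus_coeff)
qed

lemma constant_term_hom: "(\<lambda>f. f 0) \<in> ring_hom (L\<lparr>carrier := power_series F S\<rparr>) F"
  using mult_lowest[of _ _ 0 0]
  by (intro ring_hom_memI) (auto simp: power_series_def add_coeff one_eq monomial_def S_zero)

lemma constant_term_local:
  assumes f: "f \<in> power_series F S" and nz: "f 0 \<noteq> \<zero>"
  shows "f \<in> Units (L\<lparr>carrier := power_series F S\<rparr>)"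
proof -
  have fL: "f \<in> carrier L" "\<And>i. i < 0 \<Longrightarrow> f i = \<zero>" using f by (auto simp: power_series_def)
  obtain g where g: "g \<in> carrier L" "f \<otimes>\<^bsub>L\<^esub> g = \<one>\<^bsub>L\<^esub>" "\<forall>i<0. g i = \<zero>"
    using right_inverse[OF fL nz] by auto
  have "f \<noteq> \<zero>\<^bsub>L\<^esub>" using nz by (auto simp: zero_coeff)
  note fi = L.inv_nonzero[OF fL(1) this]
  have "g = inv\<^bsub>L\<^esub> f" using fi g fL by (metis L.m_assoc L.l_one L.r_one)
  then show ?thesis using fi g f by (auto simp: Units_def power_series_def)
qed

lemma constant_hom: "(\<lambda>a. monomial F a 0) \<in> ring_hom F L"
  by (rule ring_hom_memI)
    (auto simp: fun_eq_iff monomial_mult add_coeff one_eq S_zero, auto simp: monomial_def)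

end

context skew_laurent begin

lemma mult_const:
  assumes "f \<in> carrier L" "g \<in> carrier L" "\<And>i. i < 0 \<Longrightarrow> f i = \<zero>" "\<And>i. i < 0 \<Longrightarrow> g i = \<zero>"
  shows "(f \<otimes>\<^bsub>L\<^esub> g) 0 = f 0 \<otimes> g 0"
  using mult_lowest[of f g 0 0] assms by (simp add: S_zero)

lemma mult_linear_coeff:
  assumes f: "f \<in> power_series F S" and g: "g \<in> power_series F S"
  shows "(f \<otimes>\<^bsub>L\<^esub> g) 1 = f 0 \<otimes> g 1 \<oplus> f 1 \<otimes> S 1 (g 0)"
proof -
  have "(f \<otimes>\<^bsub>L\<^esub> g) 1 = (\<Oplus>i\<in>{0..1}. f i \<otimes> S i (g (1 - i)))"
    using mult_coeff_interval[OF f[THEN power_series_carrier] g[THEN power_series_carrier], of 0 0 1]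
      power_series_neg[OF f] power_series_neg[OF g] by simp
  also have "{0..1::int} = {0, 1}" by auto
  also have "(\<Oplus>i\<in>{0,1}. f i \<otimes> S i (g (1 - i))) = f 0 \<otimes> g 1 \<oplus> f 1 \<otimes> S 1 (g 0)"
    using f g by (subst F.finsum_insert) (auto simp: S_zero dest!: power_series_carrier)
  finally show ?thesis .
qed

lemma place_constant_term: "place L F (power_series F S) (\<lambda>f. f 0)"
  unfolding place_def using power_series_subring constant_term_hom constant_term_local by blast

end

text \<open>The trivial twist: the indeterminate commutes with the coefficients.\<close>

definition untwisted :: "int \<Rightarrow> 'a \<Rightarrow> 'a" where
  "untwisted i a = a"

lemma (in skew_field) skew_laurent_untwisted: "skew_laurent R untwisted"
  by (intro skew_laurent.intro skew_laurent_axioms.intro skew_field_axioms)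
    (auto simp: untwisted_def intro: ring_hom_memI)

section \<open>The q-exponential series\<close>

text \<open>The field \<open>F\<close> stands for $U((a))$ and \<open>q i\<close> for $a^i$, where $a$ is central and not a root of unity. The
  letter $b$ is the indeterminate of the field \<open>B\<close> below, and $s$ that of \<open>L\<close>.\<close>

locale q_laurent = F: skew_field F for F (structure) +
  fixes q :: "int \<Rightarrow> 'a"
  assumes q_closed [simp]: "q i \<in> carrier F"
    and q_central: "a \<in> carrier F \<Longrightarrow> a \<otimes> q i = q i \<otimes> a"
    and q_zero [simp]: "q 0 = \<one>"
    and q_add: "q (i + j) = q i \<otimes> q j"
    and q_ne_one: "i > 0 \<Longrightarrow> q i \<noteq> \<one>"
begin

abbreviation B where "B \<equiv> laurent F untwisted"

sublocale B: skew_laurent F untwisted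
  by (rule F.skew_laurent_untwisted)

text \<open>The $i$-th power of the automorphism $\sigma$ that fixes the coefficients and sends $b$ to $a b$.\<close>

definition scale :: "int \<Rightarrow> (int \<Rightarrow> 'a) \<Rightarrow> (int \<Rightarrow> 'a)" where
  "scale i f = (\<lambda>j. f j \<otimes> q (i * j))"

lemma scale_closed: "f \<in> carrier B \<Longrightarrow> scale i f \<in> carrier B"
proof -
  assume f: "f \<in> carrier B"
  obtain N where "\<forall>i<N. f i = \<zero>" using B.lower_bound f by metis
  then show ?thesis using f by (intro B.laurentI[where N = N]) (auto simp: scale_def)
qed

lemma scale_mult:
  assumes f: "f \<in> carrier B" and g: "g \<in> carrier B"
  shows "scale i (f \<otimes>\<^bsub>B\<^esub> g) = scale i f \<otimes>\<^bsub>B\<^esub> scale i g"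
proof
  fix n
  obtain a b where ab: "\<forall>i<a. f i = \<zero>" "\<forall>i<b. g i = \<zero>" using B.lower_bound f g by metis
  have "scale i (f \<otimes>\<^bsub>B\<^esub> g) n = (\<Oplus>p\<in>{a..n-b}. f p \<otimes> g (n - p)) \<otimes> q (i * n)"
    using ab by (simp add: scale_def untwisted_def B.mult_coeff_interval[OF f g, of a b])
  also have "\<dots> = (\<Oplus>p\<in>{a..n-b}. f p \<otimes> g (n - p) \<otimes> q (i * n))"
    using f g by (intro F.finsum_ldistr) auto
  also have "\<dots> = (\<Oplus>p\<in>{a..n-b}. scale i f p \<otimes> scale i g (n - p))"
  proof (rule F.finsum_cong'[OF refl])
    show "f p \<otimes> g (n - p) \<otimes> q (i * n) = scale i f p \<otimes> scale i g (n - p)" for p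
    proof -
      have c: "f p \<in> carrier F" "g (n - p) \<in> carrier F" using f g by auto
      have "q (i * n) = q (i * p) \<otimes> q (i * (n - p))" by (simp add: q_add[symmetric] algebra_simps)
      then have "f p \<otimes> g (n - p) \<otimes> q (i * n) = f p \<otimes> (g (n - p) \<otimes> q (i * p)) \<otimes> q (i * (n - p))"
        using c by (simp add: F.m_assoc)
      also have "\<dots> = f p \<otimes> (q (i * p) \<otimes> g (n - p)) \<otimes> q (i * (n - p))" using c by (simp add: q_central)
      finally show ?thesis using c by (simp add: scale_def F.m_assoc)
    qed
  qed (use f g scale_closed[of _ i] in auto)
  also have "\<dots> = (scale i f \<otimes>\<^bsub>B\<^esub> scale i g) n"
    using ab f g B.mult_coeff_interval[of "scale i f" "scale i g" a b n]
    by (simp add: scale_closed untwisted_def) (simp add: scale_def)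
  finally show "scale i (f \<otimes>\<^bsub>B\<^esub> g) n = (scale i f \<otimes>\<^bsub>B\<^esub> scale i g) n" .
qed

lemma scale_const: "a \<in> carrier F \<Longrightarrow> scale i (monomial F a 0) = monomial F a 0"
  by (auto simp: scale_def monomial_def)

lemma scale_skew_laurent: "skew_laurent B scale"
proof (intro skew_laurent.intro skew_laurent_axioms.intro B.laurent_skew_field)
  show "scale i \<in> ring_hom B B" for i
  proof (rule ring_hom_memI)
    show "scale i (f \<oplus>\<^bsub>B\<^esub> g) = scale i f \<oplus>\<^bsub>B\<^esub> scale i g" if "f \<in> carrier B" "g \<in> carrier B" for f g
      using that by (auto simp: scale_def fun_eq_iff B.add_coeff F.l_distr)
  qed (auto simp: scale_closed scale_mult B.one_eq scale_const)
  show "scale 0 f = f" if "f \<in> carrier B" for f using that by (auto simp: scale_def)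
  show "scale (i + j) f = scale i (scale j f)" if "f \<in> carrier B" for f i j
    using that by (auto simp: scale_def F.m_assoc q_add[symmetric] algebra_simps)
qed

abbreviation L where "L \<equiv> laurent B scale"

sublocale L: skew_laurent B scale
  by (rule scale_skew_laurent)

text \<open>The coefficients of the $q$-exponential series, forced by the functional equation $\sigma(z) = z (1 + b)$: comparing
  coefficients of $b^{n+1}$ gives $a^{n+1} z_{n+1} = z_{n+1} + z_n$.\<close>

primrec qexp_coeff :: "nat \<Rightarrow> 'a" where
  "qexp_coeff 0 = \<one>"
| "qexp_coeff (Suc n) = qexp_coeff n \<otimes> inv (q (int (Suc n)) \<ominus> \<one>)"

definition qexp :: "int \<Rightarrow> 'a" where
  "qexp j = (if j < 0 then \<zero> else qexp_coeff (nat j))"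

abbreviation p where "p \<equiv> \<one>\<^bsub>B\<^esub> \<oplus>\<^bsub>B\<^esub> monomial F \<one> 1"

lemma q_minus_one:
  "q (int (Suc n)) \<ominus> \<one> \<in> carrier F" "q (int (Suc n)) \<ominus> \<one> \<noteq> \<zero>"
  using q_ne_one[of "int (Suc n)"] by auto

lemma qexp_coeff_closed [simp]: "qexp_coeff n \<in> carrier F"
  by (induction n) (use F.inv_nonzero(1)[OF q_minus_one] in auto)

lemma inv_central:
  assumes "a \<in> carrier F" "b \<in> carrier F" "b \<noteq> \<zero>" "a \<otimes> b = b \<otimes> a"
  shows "a \<otimes> inv b = inv b \<otimes> a"
proof -
  note i = F.inv_nonzero[OF assms(2,3)]
  have "inv b \<otimes> (a \<otimes> b) \<otimes> inv b = inv b \<otimes> (b \<otimes> a) \<otimes> inv b" by (simp add: assms)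
  then show ?thesis using assms(1,2) i by (metis F.m_assoc F.m_closed F.l_one F.r_one)
qed

lemma qexp_coeff_central: "a \<in> carrier F \<Longrightarrow> a \<otimes> qexp_coeff n = qexp_coeff n \<otimes> a"
proof (induction n)
  case (Suc n)
  have "a \<otimes> (q (int (Suc n)) \<ominus> \<one>) = (q (int (Suc n)) \<ominus> \<one>) \<otimes> a"
    using Suc.prems by (simp add: F.minus_eq F.r_distr F.l_distr F.r_minus F.l_minus q_central)
  note ic = inv_central[OF Suc.prems q_minus_one this]
  have "a \<otimes> qexp_coeff (Suc n) = qexp_coeff n \<otimes> (a \<otimes> inv (q (int (Suc n)) \<ominus> \<one>))"
    using Suc F.inv_nonzero(1)[OF q_minus_one, of n] by (simp add: F.m_assoc[symmetric])
  then show ?case using ic Suc.prems F.inv_nonzero(1)[OF q_minus_one, of n] by (simp add: F.m_assoc)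
qed simp

lemma qexp_closed [simp]: "qexp \<in> carrier B"
  by (rule B.laurentI[where N = 0]) (auto simp: qexp_def)

lemma b_commute: "f \<in> carrier B \<Longrightarrow> f \<otimes>\<^bsub>B\<^esub> monomial F \<one> 1 = monomial F \<one> 1 \<otimes>\<^bsub>B\<^esub> f"
  by (rule ext) (simp add: B.mult_monomial B.monomial_mult untwisted_def)

text \<open>So that $1 + b$ can be moved past $y z$ in the computation of $d(x_i)$.\<close>

lemma p_commute: "f \<in> carrier B \<Longrightarrow> f \<otimes>\<^bsub>B\<^esub> p = p \<otimes>\<^bsub>B\<^esub> f"
  by (simp add: B.L.r_distr B.L.l_distr b_commute)

lemma qexp_commute: "a \<in> carrier F \<Longrightarrow> qexp \<otimes>\<^bsub>B\<^esub> monomial F a 0 = monomial F a 0 \<otimes>\<^bsub>B\<^esub> qexp"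
  by (rule ext) (simp add: B.mult_monomial B.monomial_mult untwisted_def, simp add: qexp_def qexp_coeff_central)

lemma mult_p_coeff: "f \<in> carrier B \<Longrightarrow> (f \<otimes>\<^bsub>B\<^esub> p) j = f j \<oplus> f (j - 1)"
  by (simp add: B.L.r_distr B.add_coeff B.mult_monomial untwisted_def)

lemma scale_qexp: "scale 1 qexp = qexp \<otimes>\<^bsub>B\<^esub> p"
proof
  fix j
  consider "j < 0" | "j = 0" | n where "j = int (Suc n)"
    by (cases j rule: int_cases3) (auto, metis Suc_pred of_nat_Suc)
  then show "scale 1 qexp j = (qexp \<otimes>\<^bsub>B\<^esub> p) j"
  proof cases
    case 3
    let ?d = "q (int (Suc n)) \<ominus> \<one>" and ?c = "qexp_coeff n"
    note i = F.inv_nonzero[OF q_minus_one, of n]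
    have "?c \<otimes> inv ?d \<otimes> ?d = ?c" using i q_minus_one(1)[of n] by (simp add: F.m_assoc)
    moreover have "?c \<otimes> inv ?d \<otimes> ?d = ?c \<otimes> inv ?d \<otimes> q (int (Suc n)) \<ominus> ?c \<otimes> inv ?d"
      using i by (simp add: F.minus_eq F.r_distr F.r_minus)
    ultimately have "?c \<otimes> inv ?d \<otimes> q (int (Suc n)) \<ominus> ?c \<otimes> inv ?d = ?c" by simp
    moreover have "u = v \<oplus> w" if "u \<ominus> v = w" "u \<in> carrier F" "v \<in> carrier F" for u v w
      using that by (metis F.add.m_comm F.minus_eq F.add.inv_solve_right' F.minus_closed)
    ultimately have "?c \<otimes> inv ?d \<otimes> q (int (Suc n)) = ?c \<otimes> inv ?d \<oplus> ?c"
      using i by (metis F.m_closed q_closed qexp_coeff_closed)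
    then show ?thesis using 3 by (simp add: mult_p_coeff) (simp add: scale_def qexp_def nat_add_distrib)
  qed (simp_all add: mult_p_coeff, simp_all add: scale_def qexp_def)
qed

lemma qexp_zero [simp]: "qexp 0 = \<one>" and qexp_neg: "j < 0 \<Longrightarrow> qexp j = \<zero>"
  by (simp_all add: qexp_def)

lemma p_power: "(p [^]\<^bsub>B\<^esub> n) (int n) = \<one> \<and> (\<forall>j>int n. (p [^]\<^bsub>B\<^esub> (n::nat)) j = \<zero>)"
proof (induction n)
  case 0
  show ?case by (simp add: B.one_eq monomial_def)
next
  case (Suc n)
  have c: "p [^]\<^bsub>B\<^esub> n \<in> carrier B" by simp
  show ?case using Suc.IH by (auto simp: mult_p_coeff[OF c])
qed

end

text \<open>The powers of the indeterminate of $U((a))$ provide the parameters \<open>q i\<close>.\<close>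

lemma (in skew_field) q_laurent_monomials: "q_laurent (laurent R untwisted) (\<lambda>i. monomial R \<one> i)"
proof -
  interpret L: skew_laurent R untwisted by (rule skew_laurent_untwisted)
  show ?thesis
  proof (intro q_laurent.intro q_laurent_axioms.intro L.laurent_skew_field)
    show "monomial R \<one> i \<noteq> \<one>\<^bsub>laurent R untwisted\<^esub>" if "i > 0" for i
    proof
      assume "monomial R \<one> i = \<one>\<^bsub>laurent R untwisted\<^esub>"
      then have "monomial R \<one> i 0 = \<one>\<^bsub>laurent R untwisted\<^esub> 0" by simp
      then show False using that one_not_zero by (simp add: L.one_eq monomial_def)
    qed
    show "f \<otimes>\<^bsub>laurent R untwisted\<^esub> monomial R \<one> i = monomial R \<one> i \<otimes>\<^bsub>laurent R untwisted\<^esub> f"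
      if "f \<in> carrier (laurent R untwisted)" for f i
      using that by (auto simp: fun_eq_iff L.mult_monomial L.monomial_mult untwisted_def)
    show "monomial R \<one> (i + j) = monomial R \<one> i \<otimes>\<^bsub>laurent R untwisted\<^esub> monomial R \<one> j" for i j
      by (auto simp: fun_eq_iff L.monomial_mult untwisted_def, auto simp: monomial_def)
  qed (auto simp: L.one_eq)
qed

section \<open>A twisted derivation and its filtration\<close>

text \<open>The field \<open>F\<close> is an extension of \<open>U\<close> via \<open>c\<close>, and \<open>f\<close> is a homomorphism with $f(x) = x + s$ and $f(y) = y z$. Its
  coefficients $f(u)_0$ and $f(u)_1$ with respect to $s$ are the homomorphism $f_0$ and the twisted derivation $d$.\<close>

locale q_derivation = q_laurent F q + U: skew_field U
  for F (structure) and q and U :: "('u, 'n) ring_scheme" +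
  fixes c :: "'u \<Rightarrow> 'a" and f :: "'u \<Rightarrow> int \<Rightarrow> int \<Rightarrow> 'a" and x y :: 'u
  assumes c_hom: "c \<in> ring_hom U F"
    and f_hom: "f \<in> ring_hom U L" and f_power_series: "f ` carrier U \<subseteq> power_series B scale"
    and x [simp]: "x \<in> carrier U" and y [simp]: "y \<in> carrier U" "y \<noteq> \<zero>\<^bsub>U\<^esub>"
    and fx: "f x = monomial B (monomial F (c x) 0) 0 \<oplus>\<^bsub>L\<^esub> monomial B \<one>\<^bsub>B\<^esub> 1"
    and fy: "f y = monomial B (monomial F (c y) 0 \<otimes>\<^bsub>B\<^esub> qexp) 0"
begin

definition e :: "'u \<Rightarrow> int \<Rightarrow> 'a" where "e u = monomial F (c u) 0"

lemma c_closed [simp]: "u \<in> carrier U \<Longrightarrow> c u \<in> carrier F"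
  using c_hom by (rule ring_hom_closed)

lemma e_hom: "e \<in> ring_hom U B"
  using ring_hom_trans[OF c_hom B.constant_hom] by (simp add: e_def[abs_def] comp_def)

sublocale e: ring_hom_ring U B e by (intro ring_hom_ringI2 U.ring_axioms B.L.ring_axioms e_hom)
sublocale f: ring_hom_ring U L f by (intro ring_hom_ringI2 U.ring_axioms L.L.ring_axioms f_hom)

lemma f_in: "u \<in> carrier U \<Longrightarrow> f u \<in> power_series B scale"
  using f_power_series by blast

lemma f_coeff_closed [simp]: "u \<in> carrier U \<Longrightarrow> f u i \<in> carrier B"
  using L.power_series_carrier[OF f_in] by simp

lemma f_mult_0: "u \<in> carrier U \<Longrightarrow> v \<in> carrier U \<Longrightarrow> f (u \<otimes>\<^bsub>U\<^esub> v) 0 = f u 0 \<otimes>\<^bsub>B\<^esub> f v 0"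
  using L.mult_const[of "f u" "f v"] L.power_series_neg[OF f_in] by simp

text \<open>The product rule for the twisted derivation $d$.\<close>

lemma f_mult_1:
  "u \<in> carrier U \<Longrightarrow> v \<in> carrier U \<Longrightarrow>
    f (u \<otimes>\<^bsub>U\<^esub> v) 1 = f u 0 \<otimes>\<^bsub>B\<^esub> f v 1 \<oplus>\<^bsub>B\<^esub> f u 1 \<otimes>\<^bsub>B\<^esub> scale 1 (f v 0)"
  using L.mult_linear_coeff[OF f_in f_in, of u v] by simp

lemma scale_e: "u \<in> carrier U \<Longrightarrow> scale i (e u) = e u"
  by (simp add: e_def scale_const)

lemma e_mult_coeff: "u \<in> carrier U \<Longrightarrow> m \<in> carrier B \<Longrightarrow> (e u \<otimes>\<^bsub>B\<^esub> m) j = c u \<otimes> m j"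
  and mult_e_coeff: "u \<in> carrier U \<Longrightarrow> m \<in> carrier B \<Longrightarrow> (m \<otimes>\<^bsub>B\<^esub> e u) j = m j \<otimes> c u"
  by (simp_all add: e_def B.mult_monomial B.monomial_mult untwisted_def)

definition E :: "nat \<Rightarrow> 'u set" where
  "E n = {u \<in> carrier U. f u 0 = e u \<and> (\<forall>j>int n. f u 1 j = \<zero>)}"

text \<open>On elements with $f_0(u) = u$ the product rule reads $d(u v) = u\, d(v) + d(u)\, v$, because $\sigma$ fixes the constants, and
  multiplication with constants does not raise the degree in $b$. For inverses, $0 = d(1) = u\, d(u^{-1}) + d(u)\, u^{-1}$.\<close>

lemma E_skew_subfield: "skew_subfield (E n) U"
  unfolding skew_subfield_def
proof (intro conjI ballI impI U.subringI)
  show "E n \<subseteq> carrier U" by (auto simp: E_def)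
  show "\<one>\<^bsub>U\<^esub> \<in> E n"
    by (auto simp: E_def L.one_eq) (auto simp: monomial_def B.zero_coeff)
next
  fix u assume u: "u \<in> E n"
  then show "\<ominus>\<^bsub>U\<^esub> u \<in> E n"
    using L.power_series_carrier[OF f_in, of u] by (auto simp: E_def L.uminus_coeff B.uminus_coeff)
  assume nz: "u \<noteq> \<zero>\<^bsub>U\<^esub>"
  have uU: "u \<in> carrier U" "f u 0 = e u" "\<And>j. j > int n \<Longrightarrow> f u 1 j = \<zero>" using u by (auto simp: E_def)
  let ?v = "inv\<^bsub>U\<^esub> u"
  note i = U.inv_nonzero[OF uU(1) nz]
  have "f u 0 \<otimes>\<^bsub>B\<^esub> f ?v 0 = \<one>\<^bsub>B\<^esub>"
    using f_mult_0[OF uU(1) i(1)] i by (simp add: L.one_eq monomial_def)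
  then have "inv\<^bsub>B\<^esub> (e u) = f ?v 0" using uU i by (intro B.L.inv_eqI) auto
  then have v0: "f ?v 0 = e ?v"
    using ring_hom_skew_field_inv(1)[OF U.skew_field_axioms B.laurent_skew_field e_hom uU(1) nz] by simp
  have "e u \<otimes>\<^bsub>B\<^esub> f ?v 1 \<oplus>\<^bsub>B\<^esub> f u 1 \<otimes>\<^bsub>B\<^esub> e ?v = \<zero>\<^bsub>B\<^esub>"
    using f_mult_1[OF uU(1) i(1)] i uU(2) v0 by (simp add: L.one_eq monomial_def scale_e)
  then have "(e u \<otimes>\<^bsub>B\<^esub> f ?v 1 \<oplus>\<^bsub>B\<^esub> f u 1 \<otimes>\<^bsub>B\<^esub> e ?v) j = \<zero>" for j by (simp add: B.zero_coeff)
  then have eq: "c u \<otimes> f ?v 1 j \<oplus> f u 1 j \<otimes> c ?v = \<zero>" for j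
    using uU i by (simp add: B.add_coeff e_mult_coeff mult_e_coeff)
  have cu: "c u \<noteq> \<zero>"
    using ring_hom_skew_field_inv(2)[OF U.skew_field_axioms F.skew_field_axioms c_hom uU(1) nz] .
  have "f ?v 1 j = \<zero>" if "j > int n" for j
    using eq[of j] uU(1) uU(3)[OF that] i F.integral[of "c u" "f ?v 1 j"] cu by simp
  then show "?v \<in> E n" using v0 i by (simp add: E_def)
next
  fix u v assume "u \<in> E n" "v \<in> E n"
  then have uv: "u \<in> carrier U" "f u 0 = e u" "\<And>j. j > int n \<Longrightarrow> f u 1 j = \<zero>"
    "v \<in> carrier U" "f v 0 = e v" "\<And>j. j > int n \<Longrightarrow> f v 1 j = \<zero>" by (auto simp: E_def)
  show "u \<oplus>\<^bsub>U\<^esub> v \<in> E n" using uv by (simp add: E_def L.add_coeff B.add_coeff)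
  show "u \<otimes>\<^bsub>U\<^esub> v \<in> E n"
    unfolding E_def
  proof (intro CollectI conjI allI impI)
    show "f (u \<otimes>\<^bsub>U\<^esub> v) 0 = e (u \<otimes>\<^bsub>U\<^esub> v)" using uv by (subst f_mult_0) auto
    show "f (u \<otimes>\<^bsub>U\<^esub> v) 1 j = \<zero>" if "j > int n" for j
      using uv that by (subst f_mult_1) (auto simp: B.add_coeff e_mult_coeff mult_e_coeff scale_e)
  qed (use uv in auto)
qed

primrec conj_x :: "nat \<Rightarrow> 'u" where
  "conj_x 0 = x"
| "conj_x (Suc n) = inv\<^bsub>U\<^esub> y \<otimes>\<^bsub>U\<^esub> conj_x n \<otimes>\<^bsub>U\<^esub> y"

lemma conj_x_closed [simp]: "conj_x n \<in> carrier U"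
  by (induction n) (use U.inv_nonzero(1)[of y] in auto)

lemma y_conj_x: "y \<otimes>\<^bsub>U\<^esub> conj_x (Suc n) = conj_x n \<otimes>\<^bsub>U\<^esub> y"
  using U.inv_nonzero[of y] by (simp add: U.m_assoc[symmetric])

lemma e_qexp: "u \<in> carrier U \<Longrightarrow> qexp \<otimes>\<^bsub>B\<^esub> e u = e u \<otimes>\<^bsub>B\<^esub> qexp"
  by (simp add: e_def qexp_commute)

lemma left_cancel:
  assumes "m \<in> carrier B" "m \<noteq> \<zero>\<^bsub>B\<^esub>" "g \<in> carrier B" "h \<in> carrier B" "m \<otimes>\<^bsub>B\<^esub> g = m \<otimes>\<^bsub>B\<^esub> h"
  shows "g = h"
  using assms B.L.inv_nonzero[OF assms(1,2)] by (metis B.L.m_assoc B.L.l_one)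

text \<open>Apply $f$ to $y x_{n+1} = x_n y$ and compare coefficients. In degree \<open>0\<close>, the series $z$ commutes with the
  constants and cancels. In degree \<open>1\<close>, as $d(y) = 0$ and $\sigma(y z) = y z (1 + b)$, this reads
  $y z\, d(x_{n+1}) = d(x_n)\, y z (1 + b)$, and $1 + b$ is central.\<close>

lemma f_conj_x: "f (conj_x n) 0 = e (conj_x n)" "f (conj_x n) 1 = p [^]\<^bsub>B\<^esub> n"
proof (induction n)
  case 0
  show "f (conj_x 0) 0 = e (conj_x 0)" "f (conj_x 0) 1 = p [^]\<^bsub>B\<^esub> (0::nat)"
    by (simp_all add: fx[folded e_def] L.add_coeff monomial_def[of B])
next
  case (Suc n)
  define Y where "Y = e y \<otimes>\<^bsub>B\<^esub> qexp"
  have Y: "Y \<in> carrier B" by (simp add: Y_def)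
  have fy': "f y 0 = Y" "f y 1 = \<zero>\<^bsub>B\<^esub>" by (simp_all add: fy Y_def e_def monomial_def)
  have "Y 0 \<noteq> \<zero>"
    using ring_hom_skew_field_inv(2)[OF U.skew_field_axioms F.skew_field_axioms c_hom, of y]
    by (simp add: Y_def e_mult_coeff)
  then have Y0: "Y \<noteq> \<zero>\<^bsub>B\<^esub>" by (auto simp: B.zero_coeff)
  let ?u = "conj_x n" and ?v = "conj_x (Suc n)"
  have v: "?v \<in> carrier U" by (rule conj_x_closed)
  have "Y \<otimes>\<^bsub>B\<^esub> f ?v 0 = e ?u \<otimes>\<^bsub>B\<^esub> Y"
    using f_mult_0[OF y(1) v] f_mult_0[OF conj_x_closed[of n] y(1)]
    unfolding y_conj_x fy' Suc.IH by metis
  also have "\<dots> = e (?u \<otimes>\<^bsub>U\<^esub> y) \<otimes>\<^bsub>B\<^esub> qexp" by (simp add: Y_def B.L.m_assoc)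
  also have "\<dots> = Y \<otimes>\<^bsub>B\<^esub> e ?v"
  proof -
    have ev: "e ?v \<in> carrier B" "e y \<in> carrier B" by (rule e.hom_closed[OF v], rule e.hom_closed[OF y(1)])
    have "e (?u \<otimes>\<^bsub>U\<^esub> y) = e y \<otimes>\<^bsub>B\<^esub> e ?v"
      unfolding y_conj_x[symmetric] by (rule e.hom_mult[OF y(1) v])
    then show ?thesis
      by (simp only: Y_def B.L.m_assoc[OF ev(2) qexp_closed ev(1)] B.L.m_assoc[OF ev(2,1) qexp_closed] e_qexp[OF v])
  qed
  finally show "f ?v 0 = e ?v" by (rule left_cancel[OF Y Y0 f_coeff_closed[OF v] e.hom_closed[OF v]])
  have sY: "scale 1 Y = Y \<otimes>\<^bsub>B\<^esub> p"
    by (simp add: Y_def scale_mult scale_e scale_qexp B.L.m_assoc)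
  have "Y \<otimes>\<^bsub>B\<^esub> f ?v 1 = p [^]\<^bsub>B\<^esub> n \<otimes>\<^bsub>B\<^esub> (Y \<otimes>\<^bsub>B\<^esub> p)"
  proof -
    have "f (y \<otimes>\<^bsub>U\<^esub> ?v) 1 = Y \<otimes>\<^bsub>B\<^esub> f ?v 1"
      unfolding f_mult_1[OF y(1) v] fy' using v Y by (simp add: scale_closed del: conj_x.simps)
    moreover have "f (?u \<otimes>\<^bsub>U\<^esub> y) 1 = p [^]\<^bsub>B\<^esub> n \<otimes>\<^bsub>B\<^esub> (Y \<otimes>\<^bsub>B\<^esub> p)"
      unfolding f_mult_1[OF conj_x_closed y(1)] fy' Suc.IH sY using Y by simp
    ultimately show ?thesis unfolding y_conj_x by metis
  qed
  also have "\<dots> = p [^]\<^bsub>B\<^esub> n \<otimes>\<^bsub>B\<^esub> (p \<otimes>\<^bsub>B\<^esub> Y)" by (simp only: p_commute[OF Y])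
  also have "\<dots> = p [^]\<^bsub>B\<^esub> Suc n \<otimes>\<^bsub>B\<^esub> Y" using Y by (simp add: B.L.m_assoc)
  also have "\<dots> = Y \<otimes>\<^bsub>B\<^esub> p [^]\<^bsub>B\<^esub> Suc n"
    using Y by (intro B.L.group_commutes_pow p_commute[OF Y, symmetric]) auto
  finally show "f ?v 1 = p [^]\<^bsub>B\<^esub> Suc n"
    by (intro left_cancel[OF Y Y0 f_coeff_closed[OF v]]) simp_all
qed

text \<open>The series $d(x_{n+1}) = (1 + b)^{n+1}$ has degree exactly $n + 1$.\<close>

lemma E_strict: "E n \<subset> E (Suc n)"
proof
  show "E n \<subseteq> E (Suc n)" by (auto simp: E_def)
  have "conj_x (Suc n) \<in> E (Suc n)"
    unfolding E_def using f_conj_x[of "Suc n"] p_power[of "Suc n"] conj_x_closed[of "Suc n"] by auto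
  moreover have "f (conj_x (Suc n)) 1 (int (Suc n)) \<noteq> \<zero>"
    using f_conj_x(2)[of "Suc n"] p_power[of "Suc n"] F.one_not_zero by metis
  then have "conj_x (Suc n) \<notin> E n" unfolding E_def by force
  ultimately show "E n \<noteq> E (Suc n)" by blast
qed

lemma constants_in_E:
  assumes "u \<in> carrier U" "f u = monomial B (e u) 0"
  shows "u \<in> E n"
  using assms by (simp add: E_def monomial_def B.zero_coeff)

end

section \<open>An infinite chain of skew subfields of the free field\<close>

text \<open>The Laurent series field of the derivation is $L = U((a))((b))((s))$. Taking constant terms three times is a
  local homomorphism \<open>\<alpha>\<close> to \<open>U\<close>, defined on a subring that contains $x + s$ and $y z$ and sends these to
  $x$ and $y$; so the extension property provides \<open>f\<close>.\<close>

lemma universal_field_chain: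
  fixes F :: "('c, 'f) ring_scheme" and U :: "('u, 'n) ring_scheme"
  assumes F: "cring F" "\<one>\<^bsub>F\<^esub> \<noteq> \<zero>\<^bsub>F\<^esub>" and "x \<noteq> y"
    and "universal_field_of_fractions (free_algebra F {x, y}) U \<iota>"
  shows "\<exists>E. \<forall>n. skew_subfield (E n) U \<and> E n \<subset> E (Suc n)
           \<and> (\<forall>c\<in>carrier F. \<iota> (free_algebra_const F c) \<in> E n)"
proof -
  interpret F: cring F by fact
  define X where X: "X = {x, y}"
  then have xy: "x \<in> X" "y \<in> X" "x \<noteq> y" and univ: "universal_field_of_fractions (free_algebra F X) U \<iota>"
    using assms(3,4) by simp_all
  let ?R = "free_algebra F X"
  have FR: "ring F" by (rule F.ring_axioms)
  interpret R: ring ?R by (rule free_algebra_ring[OF FR])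
  have U: "skew_field U" and \<iota>: "\<iota> \<in> ring_hom ?R U" and inj: "inj_on \<iota> (carrier ?R)"
    using univ by (auto simp: universal_field_of_fractions_def universal_field_over_def epic_field_over_def field_over_def)
  interpret U: skew_field U by (rule U)
  interpret \<iota>: ring_hom_ring ?R U \<iota> by (intro ring_hom_ringI2 R.ring_axioms U.ring_axioms \<iota>)
  interpret MR: monoid_ring_context F "word_monoid X" by (rule word_monoid_context[OF FR])
  have Rmon: "monomial F c w \<in> carrier ?R" if "c \<in> carrier F" "w \<in> lists X" for c w
    unfolding free_algebra_def using that by (intro MR.monomial_closed) auto
  have Rmult: "monomial F c u \<otimes>\<^bsub>?R\<^esub> monomial F d v = monomial F (c \<otimes>\<^bsub>F\<^esub> d) (u @ v)"
    if "c \<in> carrier F" "d \<in> carrier F" "u \<in> lists X" "v \<in> lists X" for c d u v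
    unfolding free_algebra_def using that by (subst MR.monomial_mult) auto
  have const_hom: "free_algebra_const F \<in> ring_hom F ?R"
  proof (rule ring_hom_memI)
    show "free_algebra_const F \<one>\<^bsub>F\<^esub> = \<one>\<^bsub>?R\<^esub>"
      by (simp add: free_algebra_const_def free_algebra_def MR.one_eq)
    show "free_algebra_const F (c \<oplus>\<^bsub>F\<^esub> d) = free_algebra_const F c \<oplus>\<^bsub>?R\<^esub> free_algebra_const F d"
      if "c \<in> carrier F" "d \<in> carrier F" for c d
      unfolding free_algebra_const_def free_algebra_def by (auto simp: fun_eq_iff MR.add_simp) (auto simp: monomial_def)
  qed (auto simp: free_algebra_const_def Rmon Rmult)
  define kU where "kU = \<iota> \<circ> free_algebra_const F"
  have kU: "kU \<in> ring_hom F U" unfolding kU_def by (rule ring_hom_trans[OF const_hom \<iota>])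
  have kUc: "kU c \<in> carrier U" if "c \<in> carrier F" for c using kU that by (rule ring_hom_closed)
  define var where "var a = \<iota> (monomial F \<one>\<^bsub>F\<^esub> [a])" for a
  have var: "var a \<in> carrier U" if "a \<in> X" for a unfolding var_def using that by (intro \<iota>.hom_closed Rmon) auto
  have kvar: "kU c \<otimes>\<^bsub>U\<^esub> var a = var a \<otimes>\<^bsub>U\<^esub> kU c" if "c \<in> carrier F" "a \<in> X" for c a
    using that unfolding kU_def var_def comp_def free_algebra_const_def
    by (subst (1 2) \<iota>.hom_mult[symmetric]) (auto simp: Rmon Rmult)
  have y0: "var y \<noteq> \<zero>\<^bsub>U\<^esub>"
  proof
    assume "var y = \<zero>\<^bsub>U\<^esub>"
    then have "\<iota> (monomial F \<one>\<^bsub>F\<^esub> [y]) = \<iota> \<zero>\<^bsub>?R\<^esub>" by (simp add: var_def)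
    then have "monomial F \<one>\<^bsub>F\<^esub> [y] = \<zero>\<^bsub>?R\<^esub>" using inj_onD[OF inj] Rmon[of "\<one>\<^bsub>F\<^esub>" "[y]"] xy by auto
    then have "monomial F \<one>\<^bsub>F\<^esub> [y] [y] = \<zero>\<^bsub>F\<^esub>" by (simp add: free_algebra_def MR.zero_simp)
    then show False using F(2) by (simp add: monomial_def)
  qed
  let ?L1 = "laurent U untwisted" and ?q = "\<lambda>i :: int. monomial U \<one>\<^bsub>U\<^esub> i"
  interpret L1: skew_laurent U untwisted by (rule U.skew_laurent_untwisted)
  interpret Q: q_laurent ?L1 ?q by (rule U.q_laurent_monomials)
  define c where "c u = monomial U u (0 :: int)" for u
  have c_hom: "c \<in> ring_hom U ?L1" using L1.constant_hom by (simp add: c_def[abs_def])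
  have cc: "c u \<in> carrier ?L1" if "u \<in> carrier U" for u using c_hom that by (rule ring_hom_closed)
  define e where "e u = monomial ?L1 (c u) (0 :: int)" for u
  have e_hom: "e \<in> ring_hom U Q.B"
    using ring_hom_trans[OF c_hom Q.B.constant_hom] by (simp add: e_def[abs_def] comp_def)
  have ec: "e u \<in> carrier Q.B" if "u \<in> carrier U" for u using e_hom that by (rule ring_hom_closed)
  define l where "l m = monomial Q.B m (0 :: int)" for m
  have l_hom: "l \<in> ring_hom Q.B Q.L" using Q.L.constant_hom by (simp add: l_def[abs_def])
  have lc: "l m \<in> carrier Q.L" if "m \<in> carrier Q.B" for m using l_hom that by (rule ring_hom_closed)
  have lmult: "l m \<otimes>\<^bsub>Q.L\<^esub> l m' = l (m \<otimes>\<^bsub>Q.B\<^esub> m')" if "m \<in> carrier Q.B" "m' \<in> carrier Q.B" for m m'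
    using ring_hom_mult[OF l_hom that] by simp
  define s where "s = monomial Q.B \<one>\<^bsub>Q.B\<^esub> (1 :: int)"
  have sc: "s \<in> carrier Q.L" by (simp add: s_def)
  define \<kappa> where "\<kappa> c = l (e (kU c))" for c
  have \<kappa>: "\<kappa> \<in> ring_hom F Q.L"
    using ring_hom_trans[OF kU ring_hom_trans[OF e_hom l_hom]] by (simp add: \<kappa>_def[abs_def] comp_def)
  \<comment> \<open>The images $x + s$ and $y z$ of the two letters\<close>
  define g where "g a = (if a = x then l (e (var x)) \<oplus>\<^bsub>Q.L\<^esub> s else l (e (var y) \<otimes>\<^bsub>Q.B\<^esub> Q.qexp))" for a
  \<comment> \<open>Series in $s$ whose constant term is a power series in $b$ whose constant term is a power series in $a$\<close>
  let ?A = "{f \<in> power_series Q.B Q.scale. f 0 \<in> {m \<in> power_series ?L1 untwisted. m 0 \<in> power_series U untwisted}}"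
  define \<alpha> :: "(int \<Rightarrow> int \<Rightarrow> int \<Rightarrow> 'u) \<Rightarrow> 'u" where "\<alpha> f = f 0 0 0" for f
  have pl: "place Q.L U ?A \<alpha>"
    using place_comp[OF Q.L.laurent_skew_field Q.B.laurent_skew_field U.ring_axioms Q.L.place_constant_term
      place_comp[OF Q.B.laurent_skew_field L1.laurent_skew_field U.ring_axioms Q.B.place_constant_term L1.place_constant_term]]
    by (simp add: \<alpha>_def[abs_def] comp_def)
  have cPS: "c u \<in> power_series U untwisted" if "u \<in> carrier U" for u
    by (rule L1.power_seriesI) (use that in \<open>auto simp: c_def monomial_def\<close>)
  have PS: "m \<in> power_series ?L1 untwisted" if "m \<in> carrier Q.B" "\<And>i. i < 0 \<Longrightarrow> m i = \<zero>\<^bsub>?L1\<^esub>" for m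
    using that by (intro Q.B.power_seriesI) auto
  have lPS: "l m \<in> power_series Q.B Q.scale" if "m \<in> carrier Q.B" for m
    by (rule Q.L.power_seriesI) (use that in \<open>auto simp: l_def monomial_def\<close>)
  have l0: "l m 0 = m" "s 0 = \<zero>\<^bsub>Q.B\<^esub>" for m by (simp_all add: l_def s_def monomial_def)
  have e0: "e u 0 = c u" "c u 0 = u" for u by (simp_all add: e_def c_def monomial_def)
  have lA: "l m \<in> ?A" if "m \<in> carrier Q.B" "\<And>i. i < 0 \<Longrightarrow> m i = \<zero>\<^bsub>?L1\<^esub>" "m 0 \<in> power_series U untwisted" for m
    using that PS lPS by (simp add: l0)
  have eneg: "e u i = \<zero>\<^bsub>?L1\<^esub>" if "i < 0" for u i using that by (simp add: e_def monomial_def)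
  have leA: "l (e u) \<in> ?A" if "u \<in> carrier U" for u
    by (rule lA) (use that ec cPS eneg in \<open>auto simp: e0\<close>)
  have sA: "s \<in> ?A"
  proof -
    have "s \<in> power_series Q.B Q.scale" by (rule Q.L.power_seriesI) (auto simp: s_def monomial_def)
    moreover have "\<zero>\<^bsub>Q.B\<^esub> \<in> power_series ?L1 untwisted" by (rule PS) (auto simp: Q.B.zero_coeff)
    moreover have "\<zero>\<^bsub>?L1\<^esub> \<in> power_series U untwisted" by (rule L1.power_seriesI) (auto simp: L1.zero_coeff)
    ultimately show ?thesis by (simp add: l0 Q.B.zero_coeff)
  qed
  have eq: "(e u \<otimes>\<^bsub>Q.B\<^esub> Q.qexp) i = c u \<otimes>\<^bsub>?L1\<^esub> Q.qexp i" if "u \<in> carrier U" for u i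
    unfolding e_def by (subst Q.B.monomial_mult) (use that cc in \<open>auto simp: untwisted_def\<close>)
  have gA: "g a \<in> ?A" if "a \<in> X" for a
  proof (cases "a = x")
    case True
    then show ?thesis using placeD(6)[OF pl leA[OF var[OF xy(1)]] sA] by (simp add: g_def)
  next
    case False
    have "l (e (var y) \<otimes>\<^bsub>Q.B\<^esub> Q.qexp) \<in> ?A"
      by (rule lA) (use var[OF xy(2)] ec cc cPS in \<open>auto simp: eq Q.qexp_neg\<close>)
    then show ?thesis using False by (simp add: g_def)
  qed
  let ?S = "Q.L\<lparr>carrier := ?A\<rparr>"
  have S: "ring ?S"
    using pl Q.L.L.subring_iff[of ?A] placeD(1)[OF pl] unfolding place_def by blast
  have comm: "\<kappa> d \<otimes>\<^bsub>Q.L\<^esub> g a = g a \<otimes>\<^bsub>Q.L\<^esub> \<kappa> d" if d: "d \<in> carrier F" and a: "a \<in> X" for d a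
  proof -
    let ?m = "e (kU d)"
    have m: "?m \<in> carrier Q.B" using ec kUc d by auto
    have ev: "?m \<otimes>\<^bsub>Q.B\<^esub> e (var b) = e (var b) \<otimes>\<^bsub>Q.B\<^esub> ?m" if "b \<in> X" for b
      using ring_hom_mult[OF e_hom kUc[OF d] var[OF that]] ring_hom_mult[OF e_hom var[OF that] kUc[OF d]]
        kvar[OF d that] by simp
    show ?thesis
    proof (cases "a = x")
      case True
      have "l ?m \<otimes>\<^bsub>Q.L\<^esub> s = s \<otimes>\<^bsub>Q.L\<^esub> l ?m"
      proof
        fix n
        have "Q.scale 1 ?m = ?m" unfolding e_def by (rule Q.scale_const[OF cc[OF kUc[OF d]]])
        moreover have "Q.scale 1 \<zero>\<^bsub>Q.B\<^esub> = \<zero>\<^bsub>Q.B\<^esub>" by (rule Q.L.S_0)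
        ultimately show "(l ?m \<otimes>\<^bsub>Q.L\<^esub> s) n = (s \<otimes>\<^bsub>Q.L\<^esub> l ?m) n"
          using m by (simp add: l_def s_def Q.L.monomial_mult) (simp add: monomial_def[of Q.B])
      qed
      moreover have "l ?m \<otimes>\<^bsub>Q.L\<^esub> l (e (var x)) = l (e (var x)) \<otimes>\<^bsub>Q.L\<^esub> l ?m"
        using lmult m ec[OF var[OF xy(1)]] ev[OF xy(1)] by simp
      ultimately show ?thesis
        using True m sc lc ec[OF var[OF xy(1)]] by (simp add: g_def \<kappa>_def Q.L.mult_distr)
    next
      case False
      have ey: "e (var y) \<in> carrier Q.B" using ec var xy by auto
      have "Q.qexp \<otimes>\<^bsub>Q.B\<^esub> ?m = ?m \<otimes>\<^bsub>Q.B\<^esub> Q.qexp"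
        unfolding e_def by (rule Q.qexp_commute[OF cc[OF kUc[OF d]]])
      then have "?m \<otimes>\<^bsub>Q.B\<^esub> (e (var y) \<otimes>\<^bsub>Q.B\<^esub> Q.qexp) = e (var y) \<otimes>\<^bsub>Q.B\<^esub> Q.qexp \<otimes>\<^bsub>Q.B\<^esub> ?m"
        using ev[OF xy(2)] m ey by (metis Q.B.mult_assoc Q.qexp_closed)
      then show ?thesis using False m ey lmult by (simp add: g_def \<kappa>_def)
    qed
  qed
  have \<kappa>S: "\<kappa> \<in> ring_hom F ?S"
    using \<kappa> leA kUc unfolding ring_hom_def by (auto simp: \<kappa>_def)
  obtain j where j: "j \<in> ring_hom ?R ?S"
    and jc: "\<And>d. d \<in> carrier F \<Longrightarrow> j (free_algebra_const F d) = \<kappa> d"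
    and jg: "\<And>a. a \<in> X \<Longrightarrow> j (monomial F \<one>\<^bsub>F\<^esub> [a]) = g a"
    using free_algebra_hom_exists[OF FR S \<kappa>S, of X g] gA comm by auto
  have jA: "j ` carrier ?R \<subseteq> ?A" using ring_hom_closed[OF j] by auto
  have jL: "j \<in> ring_hom ?R Q.L"
    using j placeD(1)[OF pl] unfolding ring_hom_def by auto
  have \<alpha>hom: "\<alpha> \<in> ring_hom ?S U" using pl unfolding place_def by blast
  have \<alpha>j: "\<alpha> (j r) = \<iota> r" if "r \<in> carrier ?R" for r
  proof -
    have "(\<alpha> \<circ> j) r = \<iota> r"
    proof (rule free_algebra_hom_eqI[OF FR U.ring_axioms ring_hom_trans[OF j \<alpha>hom] \<iota> _ _ that])
      show "(\<alpha> \<circ> j) (free_algebra_const F d) = \<iota> (free_algebra_const F d)" if "d \<in> carrier F" for d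
        using jc[OF that] by (simp add: \<alpha>_def \<kappa>_def l0 e0 kU_def)
      show "(\<alpha> \<circ> j) (monomial F \<one>\<^bsub>F\<^esub> [a]) = \<iota> (monomial F \<one>\<^bsub>F\<^esub> [a])" if a: "a \<in> X" for a
      proof (cases "a = x")
        case True
        have "g x 0 = e (var x)" using ec[OF var[OF xy(1)]] by (simp add: g_def Q.L.add_coeff l0)
        then show ?thesis using True jg[OF a] by (simp add: \<alpha>_def e0 var_def)
      next
        case False
        then have "a = y" using a X by auto
        moreover have "g y 0 0 0 = var y"
          using xy cc[OF var[OF xy(2)]] by (simp add: g_def l0 eq[OF var[OF xy(2)]] e0)
        ultimately show ?thesis using jg[OF a] by (simp add: \<alpha>_def var_def)
      qed
    qed
    then show ?thesis by simp
  qed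
  obtain f where f: "f \<in> ring_hom U Q.L" "f ` carrier U \<subseteq> ?A" "\<And>r. r \<in> carrier ?R \<Longrightarrow> f (\<iota> r) = j r"
    using universal_field_extension[where \<alpha> = \<alpha> and j = j and \<iota> = \<iota>, OF _ free_algebra_infinite[OF FR F(2) xy(1)] Q.L.laurent_skew_field pl jL jA \<alpha>j] univ
    unfolding universal_field_of_fractions_def by blast
  have fv: "f (var a) = g a" if "a \<in> X" for a
    unfolding var_def using f(3)[OF Rmon[of "\<one>\<^bsub>F\<^esub>" "[a]"]] jg[OF that] that by auto
  interpret D: q_derivation ?L1 ?q U c f "var x" "var y"
  proof (intro q_derivation.intro q_derivation_axioms.intro Q.q_laurent_axioms U c_hom f(1) y0 var xy(1,2))
    show "f ` carrier U \<subseteq> power_series Q.B Q.scale" using f(2) by auto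
    show "f (var x) = monomial Q.B (monomial ?L1 (c (var x)) 0) 0 \<oplus>\<^bsub>Q.L\<^esub> monomial Q.B \<one>\<^bsub>Q.B\<^esub> 1"
      using fv[OF xy(1)] by (simp add: g_def l_def e_def s_def)
    show "f (var y) = monomial Q.B (monomial ?L1 (c (var y)) 0 \<otimes>\<^bsub>Q.B\<^esub> Q.qexp) 0"
      using fv[OF xy(2)] xy(3) by (simp add: g_def l_def e_def)
  qed
  have "\<iota> (free_algebra_const F d) \<in> D.E n" if "d \<in> carrier F" for d n
  proof (rule D.constants_in_E)
    have dR: "free_algebra_const F d \<in> carrier ?R" using ring_hom_closed[OF const_hom that] .
    then show "\<iota> (free_algebra_const F d) \<in> carrier U" by simp
    show "f (\<iota> (free_algebra_const F d)) = monomial Q.B (D.e (\<iota> (free_algebra_const F d))) 0"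
      using f(3)[OF dR] jc[OF that] by (simp add: \<kappa>_def l_def e_def D.e_def kU_def)
  qed
  then show ?thesis using D.E_skew_subfield D.E_strict by blast
qed

theorem theorem2p2:
  fixes D :: "('a, 'm) ring_scheme" and k :: "'a set"
    and x y :: 'x
    and U :: "('u, 'n) ring_scheme" and \<iota> :: "('x list \<Rightarrow> 'a) \<Rightarrow> 'u" and \<phi> :: "'u \<Rightarrow> 'a"
  assumes "skew_field D"
    and "central_subfield k D"
    and "x \<noteq> y"
    and "universal_field_of_fractions (free_algebra (D\<lparr>carrier := k\<rparr>) {x, y}) U \<iota>"
    and "\<phi> \<in> ring_hom U D"
    and "\<And>c. c \<in> k \<Longrightarrow> \<phi> (\<iota> (free_algebra_const (D\<lparr>carrier := k\<rparr>) c)) = c"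
  shows "\<not> left_noetherian (tensor_algebra (D\<lparr>carrier := k\<rparr>) id D id (opposite D))"
proof -
  interpret D: skew_field D by fact
  interpret A: skew_field_algebra D k
    by (intro skew_field_algebra.intro skew_field_algebra_axioms.intro assms(1,2))
  have U: "skew_field U"
    using assms(4) by (auto simp: universal_field_of_fractions_def universal_field_over_def epic_field_over_def field_over_def)
  have "cring (D\<lparr>carrier := k\<rparr>)"
    using A.F_ring A.k_commute A.k_subset
    by (intro cring.intro comm_monoid.intro comm_monoid_axioms.intro) (auto simp: ring_def)
  from universal_field_chain[OF this _ assms(3,4)] D.one_not_zero
  obtain E where "\<forall>n. skew_subfield (E n) U \<and> E n \<subset> E (Suc n)
      \<and> (\<forall>c\<in>k. \<iota> (free_algebra_const (D\<lparr>carrier := k\<rparr>) c) \<in> E n)"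
    by auto
  then have E: "\<And>n. skew_subfield (E n) U" "\<And>n. E n \<subset> E (Suc n)"
      "\<And>n c. c \<in> k \<Longrightarrow> \<iota> (free_algebra_const (D\<lparr>carrier := k\<rparr>) c) \<in> E n"
    by auto
  have inj: "inj_on \<phi> (carrier U)" by (rule ring_hom_skew_field_inj[OF U assms(1,5)])
  show ?thesis
  proof (rule A.tensor_not_noetherian)
    show "skew_subfield (\<phi> ` E n) D" for n by (rule skew_subfield_image[OF U assms(1,5) E(1)])
    show "k \<subseteq> \<phi> ` E n" for n
    proof
      fix c assume "c \<in> k"
      then show "c \<in> \<phi> ` E n" using assms(6)[of c] E(3)[of c n] by (metis imageI)
    qed
    show "\<phi> ` E n \<subset> \<phi> ` E (Suc n)" for n
      using E(2)[of n] inj_on_image_eq_iff[OF inj skew_subfieldD(1)[OF E(1)] skew_subfieldD(1)[OF E(1)], of n "Suc n"]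
      by blast
  qed
qed

end
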